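(* Let $(X_k)_{k\geq-1}$ be an INAR(2) process with autoregressive parameters $(\alpha,\beta)=(0,1)$ (hence it is unstable, indecomposable but not positively regular). Suppose that $X_0=X_{-1}=0$, $\mathbb{E}(\varepsilon_1^2)<\infty$ and $\mu>0$. Let $(\widehat\alpha_n(\boldsymbol{X}_n),\widehat\beta_n(\boldsymbol{X}_n),\widehat\mu_n(\boldsymbol{X}_n))$ be a conditional least squares (CLS) estimator of $(\alpha,\beta,\mu)$ based on $\boldsymbol{X}_n=(X_1,\dots,X_n)$ and $\widehat\varrho_n(\boldsymbol{X}_n)=\widehat\alpha_n(\boldsymbol{X}_n)+\widehat\beta_n(\boldsymbol{X}_n)$. Then, as $n\to\infty$, $$n^{3/2}\bigl(\widehat\varrho_n(\boldsymbol{X}_n)-1\bigr)\xrightarrow{\mathcal{L}}\mathcal{N}_1\Big(0,\frac{48\sigma^2}{\mu^2}\Big),$$ $$\begin{bmatrix}n\,\widehat\alpha_n(\boldsymbol{X}_n)\\ n(\widehat\beta_n(\boldsymbol{X}_n)-1)\end{bmatrix}\xrightarrow{\mathcal{L}}\frac{\int_0^1\mathcal{W}_t\,\mathrm{d}\mathcal{W}_t}{\int_0^1\mathcal{W}_t^2\,\mathrm{d}t}\begin{bmatrix}-1\\ 1\end{bmatrix},$$ $$n^{1/2}\bigl(\widehat\mu_n(\boldsymbol{X}_n)-\mu\bigr)\xrightarrow{\mathcal{L}}\mathcal{N}_1(0,4\sigma^2),$$ where $(\mathcal{W}_t)_{t\geq0}$ is a standard Wiener process.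
   Context: INAR(2) process: let $(\varepsilon_k)_{k\in\mathbb{N}}$ be i.i.d. non-negative integer-valued random variables and $(\alpha,\beta)\in[0,1]^2$. An INAR(2) process with autoregressive parameters $(\alpha,\beta)$ and innovations $(\varepsilon_k)$ is a process $(X_k)_{k\geq-1}$ with $$X_k=\sum_{j=1}^{X_{k-1}}\xi_{k,j}+\sum_{j=1}^{X_{k-2}}\eta_{k,j}+\varepsilon_k,\qquad k\in\mathbb{N},$$ where for each $k$, $(\xi_{k,j})_{j\in\mathbb{N}}$ and $(\eta_{k,j})_{j\in\mathbb{N}}$ are sequences of i.i.d. Bernoulli random variables with mean $\alpha$ and $\beta$ respectively, these sequences are mutually independent (over all $k$) and independent of $(\varepsilon_k)_{k\in\mathbb{N}}$, and $X_0,X_{-1}$ are non-negative integer-valued random variables independent of all of $(\xi_{k,j})$, $(\eta_{k,j})$, $(\varepsilon_k)$. The process is unstable if $\alpha+\beta=1$, and it is indecomposable but not positively regular if $\alpha=0$ and $\beta>0$. Notation: $\mu:=\mathbb{E}(\varepsilon_1)$, $\sigma^2:=\operatorname{Var}(\varepsilon_1)$. CLS estimator: for $\boldsymbol{x}_n=(x_1,\dots,x_n)\in\mathbb{R}^n$ put $x_{-1}:=x_0:=0$ and $Q_n(\boldsymbol{x}_n;\alpha',\beta',\mu'):=\sum_{k=1}^n(x_k-\alpha'x_{k-1}-\beta'x_{k-2}-\mu')^2$. A CLS estimator of $(\alpha,\beta,\mu)$ is a measurable function $(\widehat\alpha_n,\widehat\beta_n,\widehat\mu_n):\mathbb{R}^n\to\mathbb{R}^3$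 with $Q_n(\boldsymbol{x}_n;\widehat\alpha_n(\boldsymbol{x}_n),\widehat\beta_n(\boldsymbol{x}_n),\widehat\mu_n(\boldsymbol{x}_n))=\inf_{(\alpha',\beta',\mu')\in\mathbb{R}^3}Q_n(\boldsymbol{x}_n;\alpha',\beta',\mu')$ for all $\boldsymbol{x}_n\in\mathbb{R}^n$. On the event $\{\sum_{k=1}^nX_{k-2}^2>0\}$ (whose probability tends to $1$) it is uniquely determined: $$\begin{bmatrix}\widehat\alpha_n(\boldsymbol{X}_n)\\ \widehat\beta_n(\boldsymbol{X}_n)\\ \widehat\mu_n(\boldsymbol{X}_n)\end{bmatrix}=\left(\sum_{k=1}^n\begin{bmatrix}X_{k-1}^2&X_{k-1}X_{k-2}&X_{k-1}\\ X_{k-1}X_{k-2}&X_{k-2}^2&X_{k-2}\\ X_{k-1}&X_{k-2}&1\end{bmatrix}\right)^{-1}\sum_{k=1}^n\begin{bmatrix}X_kX_{k-1}\\ X_kX_{k-2}\\ X_k\end{bmatrix}.$$ The stability parameter is $\varrho:=\alpha+\beta$, and its CLS estimator is $\widehat\varrho_n:=\widehat\alpha_n+\widehat\beta_n$. $\xrightarrow{\mathcal{L}}$ denotes convergence in distribution, and $\mathcal{N}_1(m,v)$ is the normal distribution with mean $m$ and variance $v$.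
   Formalization: The second limit (for the pair of scaled estimators of α and β) is stated only when σ² > 0, since for σ² = 0 the least squares fit is exact and the scaled vector is (0,0), so that limit fails; the other two limits are unrestricted. *)

theory Defs
  imports "HOL-Probability.Probability"
begin

section \<open>INAR(2) processes\<close>

datatype noise_index = Innov nat | Thin1 nat nat | Thin2 nat nat

fun inar2_noise ::
  "(nat \<Rightarrow> 'a \<Rightarrow> nat) \<Rightarrow> (nat \<Rightarrow> nat \<Rightarrow> 'a \<Rightarrow> nat) \<Rightarrow> (nat \<Rightarrow> nat \<Rightarrow> 'a \<Rightarrow> nat) \<Rightarrow> noise_index \<Rightarrow> 'a \<Rightarrow> nat"
where
  "inar2_noise \<epsilon> \<xi> \<eta> (Innov k) = \<epsilon> k"
| "inar2_noise \<epsilon> \<xi> \<eta> (Thin1 k j) = \<xi> k j"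
| "inar2_noise \<epsilon> \<xi> \<eta> (Thin2 k j) = \<eta> k j"

text \<open>The noise variables are indexed by the positive integers; values at index 0 are irrelevant.\<close>

definition noise_indices :: "noise_index set" where
  "noise_indices = {Innov k | k. 1 \<le> k} \<union> {Thin1 k j | k j. 1 \<le> k \<and> 1 \<le> j}
     \<union> {Thin2 k j | k j. 1 \<le> k \<and> 1 \<le> j}"

text \<open>The process is indexed by integers; only the values \<open>X k\<close> for \<open>k \<ge> -1\<close> matter.
  The pair of initial values is independent of the whole noise family, but
  \<open>X 0\<close> and \<open>X (-1)\<close> need not be independent of each other.\<close>

locale inar2_process = prob_space M
  for M :: "'a measure" and \<alpha> \<beta> :: real
    and \<epsilon> :: "nat \<Rightarrow> 'a \<Rightarrow> nat"
    and \<xi> \<eta> :: "nat \<Rightarrow> nat \<Rightarrow> 'a \<Rightarrow> nat"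
    and X :: "int \<Rightarrow> 'a \<Rightarrow> nat" +
  assumes \<alpha>_range: "\<alpha> \<in> {0..1}" and \<beta>_range: "\<beta> \<in> {0..1}"
    and X_measurable: "\<And>k. -1 \<le> k \<Longrightarrow> random_variable (count_space UNIV) (X k)"
    and noise_indep: "indep_vars (\<lambda>_. count_space UNIV) (inar2_noise \<epsilon> \<xi> \<eta>) noise_indices"
    and initial_indep:
      "indep_set
         {(\<lambda>\<omega>. \<lambda>i\<in>noise_indices. inar2_noise \<epsilon> \<xi> \<eta> i \<omega>) -` A \<inter> space M
           | A. A \<in> sets (PiM noise_indices (\<lambda>_. count_space UNIV))}
         {(\<lambda>\<omega>. (X 0 \<omega>, X (-1) \<omega>)) -` B \<inter> space M | B. B \<in> sets (count_space UNIV)}"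
    and \<epsilon>_identical:
      "\<And>k. 1 \<le> k \<Longrightarrow> distr M (count_space UNIV) (\<epsilon> k) = distr M (count_space UNIV) (\<epsilon> 1)"
    and \<xi>_bernoulli:
      "\<And>k j. 1 \<le> k \<Longrightarrow> 1 \<le> j \<Longrightarrow>
         distr M (count_space UNIV) (\<xi> k j) = measure_pmf (map_pmf of_bool (bernoulli_pmf \<alpha>))"
    and \<eta>_bernoulli:
      "\<And>k j. 1 \<le> k \<Longrightarrow> 1 \<le> j \<Longrightarrow>
         distr M (count_space UNIV) (\<eta> k j) = measure_pmf (map_pmf of_bool (bernoulli_pmf \<beta>))"
    and recursion:
      "\<And>k. 1 \<le> k \<Longrightarrow> AE \<omega> in M.
         X (int k) \<omega> = (\<Sum>j = 1..X (int k - 1) \<omega>. \<xi> k j \<omega>)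
                      + (\<Sum>j = 1..X (int k - 2) \<omega>. \<eta> k j \<omega>) + \<epsilon> k \<omega>"

section \<open>Conditional least squares estimators\<close>

text \<open>A vector \<open>(x\<^sub>1, \<dots>, x\<^sub>n)\<close> is a function on \<open>{1..n}\<close>, i.e. an element
  of the space of \<open>PiM {1..n} (\<lambda>_. borel)\<close>. It is extended by \<open>x\<^sub>0 = x\<^sub>-\<^sub>1 = 0\<close>.\<close>

definition zero_extend :: "(nat \<Rightarrow> real) \<Rightarrow> int \<Rightarrow> real" where
  "zero_extend x k = (if 1 \<le> k then x (nat k) else 0)"

definition cls_objective :: "nat \<Rightarrow> (nat \<Rightarrow> real) \<Rightarrow> real \<Rightarrow> real \<Rightarrow> real \<Rightarrow> real" where
  "cls_objective n x a b m =
     (\<Sum>k = 1..n. (zero_extend x (int k) - a * zero_extend x (int k - 1)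
                    - b * zero_extend x (int k - 2) - m)\<^sup>2)"

definition cls_estimator ::
  "nat \<Rightarrow> ((nat \<Rightarrow> real) \<Rightarrow> real) \<Rightarrow> ((nat \<Rightarrow> real) \<Rightarrow> real) \<Rightarrow> ((nat \<Rightarrow> real) \<Rightarrow> real) \<Rightarrow> bool"
where
  "cls_estimator n a b m \<longleftrightarrow>
     (\<lambda>x. (a x, b x, m x)) \<in> borel_measurable (PiM {1..n} (\<lambda>_. borel)) \<and>
     (\<forall>x \<in> space (PiM {1..n} (\<lambda>_. borel)).
        cls_objective n x (a x) (b x) (m x) = (INF (a', b', m')\<in>UNIV. cls_objective n x a' b' m'))"

definition sample :: "(int \<Rightarrow> 'a \<Rightarrow> nat) \<Rightarrow> nat \<Rightarrow> 'a \<Rightarrow> (nat \<Rightarrow> real)" where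
  "sample X n \<omega> = (\<lambda>k\<in>{1..n}. real (X (int k) \<omega>))"

section \<open>Normal distributions and convergence in distribution\<close>

text \<open>\<open>normal_distribution m v\<close> has mean \<open>m\<close> and variance \<open>v\<close>. It is the Dirac measure
  at \<open>m\<close> if \<open>v = 0\<close>, a case that \<open>normal_density\<close> does not cover.\<close>

definition normal_distribution :: "real \<Rightarrow> real \<Rightarrow> real measure" where
  "normal_distribution m v =
     (if v = 0 then return borel m else density lborel (\<lambda>x. ennreal (normal_density m (sqrt v) x)))"

text \<open>The library's \<open>weak_conv_m\<close> only covers measures on the real line.\<close>

definition weak_conv_measures ::
  "(nat \<Rightarrow> 'a::topological_space measure) \<Rightarrow> 'a measure \<Rightarrow> bool" where
  "weak_conv_measures \<nu> \<mu> \<longleftrightarrow>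
     (\<forall>f::'a \<Rightarrow> real. continuous_on UNIV f \<longrightarrow> bounded (range f) \<longrightarrow>
        (\<lambda>n. integral\<^sup>L (\<nu> n) f) \<longlonglongrightarrow> integral\<^sup>L \<mu> f)"

lemma weak_conv_m_iff_weak_conv_measures:
  assumes "\<And>n. real_distribution (\<nu> n)" "real_distribution \<mu>"
  shows "weak_conv_m \<nu> \<mu> \<longleftrightarrow> weak_conv_measures \<nu> \<mu>"
proof
  assume w: "weak_conv_m \<nu> \<mu>"
  show "weak_conv_measures \<nu> \<mu>"
    unfolding weak_conv_measures_def
  proof (intro allI impI)
    fix f :: "real \<Rightarrow> real"
    assume c: "continuous_on UNIV f" and "bounded (range f)"
    then obtain B where B: "\<And>x. norm (f x) \<le> B"
      by (auto simp: bounded_iff)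
    have "isCont f x" for x
      using c by (simp add: continuous_on_eq_continuous_at)
    then show "(\<lambda>n. integral\<^sup>L (\<nu> n) f) \<longlonglongrightarrow> integral\<^sup>L \<mu> f"
      using weak_conv_imp_integral_bdd_continuous_conv[OF assms w, of f B] B by blast
  qed
next
  assume w: "weak_conv_measures \<nu> \<mu>"
  show "weak_conv_m \<nu> \<mu>"
  proof (rule integral_bdd_continuous_conv_imp_weak_conv[OF assms])
    fix f :: "real \<Rightarrow> real"
    assume "\<And>x. isCont f x" "\<And>x. \<bar>f x\<bar> \<le> 1"
    then have "continuous_on UNIV f" "bounded (range f)"
      by (auto simp: continuous_on_eq_continuous_at bounded_iff)
    then show "(\<lambda>n. integral\<^sup>L (\<nu> n) f) \<longlonglongrightarrow> integral\<^sup>L \<mu> f"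
      using w by (auto simp: weak_conv_measures_def)
  qed
qed

section \<open>Wiener processes and the Ito integral\<close>

text \<open>Only the values \<open>W t\<close> for \<open>t \<ge> 0\<close> matter.\<close>

locale wiener_process = prob_space N
  for N :: "'b measure" and W :: "real \<Rightarrow> 'b \<Rightarrow> real" +
  assumes W_measurable: "\<And>t. 0 \<le> t \<Longrightarrow> random_variable borel (W t)"
    and W_zero: "AE \<omega> in N. W 0 \<omega> = 0"
    and W_continuous: "\<And>\<omega>. \<omega> \<in> space N \<Longrightarrow> continuous_on {0..} (\<lambda>t. W t \<omega>)"
    and W_increments_normal:
      "\<And>s t. 0 \<le> s \<Longrightarrow> s < t \<Longrightarrow>
         distr N borel (\<lambda>\<omega>. W t \<omega> - W s \<omega>) = normal_distribution 0 (t - s)"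
    and W_increments_indep:
      "\<And>(m::nat) \<tau>. 0 \<le> \<tau> 0 \<Longrightarrow> (\<And>i. i < m \<Longrightarrow> \<tau> i < \<tau> (Suc i)) \<Longrightarrow>
         indep_vars (\<lambda>_. borel) (\<lambda>i \<omega>. W (\<tau> (Suc i)) \<omega> - W (\<tau> i) \<omega>) {..<m}"

definition natural_filtration ::
  "'b measure \<Rightarrow> (real \<Rightarrow> 'b \<Rightarrow> real) \<Rightarrow> real \<Rightarrow> 'b measure" where
  "natural_filtration N W t =
     sigma (space N) (\<Union>s\<in>{0..t}. {W s -` A \<inter> space N | A. A \<in> sets borel})"

text \<open>A triple \<open>(m, \<tau>, h)\<close> represents the simple process that takes the value \<open>h i\<close>
  on \<open>(\<tau> i, \<tau> (i + 1)]\<close> for \<open>i < m\<close>.\<close>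

definition simple_integrand ::
  "'b measure \<Rightarrow> (real \<Rightarrow> 'b \<Rightarrow> real) \<Rightarrow> real \<Rightarrow> nat \<Rightarrow> (nat \<Rightarrow> real) \<Rightarrow> (nat \<Rightarrow> 'b \<Rightarrow> real) \<Rightarrow> bool"
where
  "simple_integrand N W T m \<tau> h \<longleftrightarrow>
     \<tau> 0 = 0 \<and> \<tau> m = T \<and> (\<forall>i<m. \<tau> i < \<tau> (Suc i)) \<and>
     (\<forall>i<m. h i \<in> borel_measurable (natural_filtration N W (\<tau> i)) \<and> integrable N (\<lambda>\<omega>. (h i \<omega>)\<^sup>2))"

definition simple_process ::
  "nat \<Rightarrow> (nat \<Rightarrow> real) \<Rightarrow> (nat \<Rightarrow> 'b \<Rightarrow> real) \<Rightarrow> real \<Rightarrow> 'b \<Rightarrow> real" where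
  "simple_process m \<tau> h t \<omega> = (\<Sum>i<m. h i \<omega> * indicator {\<tau> i<..\<tau> (Suc i)} t)"

definition simple_ito_integral ::
  "(real \<Rightarrow> 'b \<Rightarrow> real) \<Rightarrow> nat \<Rightarrow> (nat \<Rightarrow> real) \<Rightarrow> (nat \<Rightarrow> 'b \<Rightarrow> real) \<Rightarrow> 'b \<Rightarrow> real" where
  "simple_ito_integral W m \<tau> h \<omega> = (\<Sum>i<m. h i \<omega> * (W (\<tau> (Suc i)) \<omega> - W (\<tau> i) \<omega>))"

text \<open>\<open>I\<close> is a version of the Ito integral of \<open>H\<close> against \<open>W\<close> over \<open>[0, T]\<close> if there are
  simple processes converging to \<open>H\<close> in \<open>L\<^sup>2([0, T] \<times> \<Omega>)\<close> whose elementary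
  integrals converge to \<open>I\<close> in \<open>L\<^sup>2(\<Omega>)\<close>.\<close>

definition is_ito_integral ::
  "'b measure \<Rightarrow> (real \<Rightarrow> 'b \<Rightarrow> real) \<Rightarrow> real \<Rightarrow> (real \<Rightarrow> 'b \<Rightarrow> real) \<Rightarrow> ('b \<Rightarrow> real) \<Rightarrow> bool"
where
  "is_ito_integral N W T H I \<longleftrightarrow>
     I \<in> borel_measurable N \<and>
     (\<lambda>(t, \<omega>). H t \<omega>) \<in> borel_measurable (restrict_space lborel {0..T} \<Otimes>\<^sub>M N) \<and>
     (\<exists>m \<tau> h. (\<forall>r::nat. simple_integrand N W T (m r) (\<tau> r) (h r)) \<and>
        (\<lambda>r. \<integral>\<^sup>+ \<omega>. (\<integral>\<^sup>+ t\<in>{0..T}. ennreal ((H t \<omega> - simple_process (m r) (\<tau> r) (h r) t \<omega>)\<^sup>2) \<partial>lborel) \<partial>N)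
           \<longlonglongrightarrow> 0 \<and>
        (\<lambda>r. \<integral>\<^sup>+ \<omega>. ennreal ((I \<omega> - simple_ito_integral W (m r) (\<tau> r) (h r) \<omega>)\<^sup>2) \<partial>N)
           \<longlonglongrightarrow> 0)"

text \<open>By the Ito isometry, versions of the integral agree almost surely, so the law of any
  quantity computed from \<open>ito_integral\<close> does not depend on the choice made here.\<close>

definition ito_integral ::
  "'b measure \<Rightarrow> (real \<Rightarrow> 'b \<Rightarrow> real) \<Rightarrow> real \<Rightarrow> (real \<Rightarrow> 'b \<Rightarrow> real) \<Rightarrow> 'b \<Rightarrow> real" where
  "ito_integral N W T H = (SOME I. is_ito_integral N W T H I)"

end

theory Submission
  imports Defs "HOL-Real_Asymp.Real_Asymp"
begin

text \<open>
  Since \<open>\<alpha> = 0\<close> and \<open>\<beta> = 1\<close>, thinning is trivial: almost surely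
  \<open>X k = X (k - 2) + \<epsilon> k\<close>. Write \<open>e i = \<epsilon> (i + 1) - \<mu>\<close> for the centred innovations, so that
  the regression estimates the coefficients of \<open>e i\<close> on \<open>X i\<close>, \<open>X (i - 1)\<close> and \<open>1\<close>. The two
  regressors are nearly collinear, and the proof lives in coordinates that separate their scales:
  \<open>v i = X i + X (i - 1) = i * \<mu> + (e 0 + \<dots> + e (i - 1))\<close>, a random walk with drift of order \<open>n\<close>, and
  \<open>d i = X i - X (i - 1) - \<mu> / 2 = (- 1) ^ (i + 1) * (A i + \<mu> / 2)\<close>, where \<open>A\<close> is the walk with the
  alternating steps \<open>(- 1) ^ i * e i\<close>, an oscillating sequence of order \<open>sqrt n\<close>. The coefficient of
  \<open>v\<close> is half of \<open>\<alpha>_hat + \<beta>_hat - 1\<close>, and that of \<open>d\<close> is half of \<open>\<alpha>_hat - \<beta>_hat + 1\<close>.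

  After scaling the three coefficients by \<open>n * sqrt n\<close>, \<open>n\<close> and \<open>sqrt n\<close>, the off-diagonal entries of
  the Gram matrix that involve \<open>d\<close> vanish in probability: \<open>d (i + 1) = - d i + e i\<close> turns sums of
  oscillating terms into boundary terms and smaller sums (\<open>sum_d\<close>, \<open>sum_vd\<close>). So the problem splits.
  The block for \<open>v\<close> and \<open>1\<close> converges to a constant matrix. Inverting it exhibits
  the estimators of the stability parameter and of the mean as weighted sums of the \<open>e i\<close> up to a null term
  (\<open>conv_\<theta>1\<close>, \<open>conv_\<theta>3\<close>), and a central limit theorem for weighted sums gives the two normal limits.
  The remaining coefficient is asymptotically the quotient of \<open>R2 = (\<Sum>i<n. d i * e i) / n\<close> by
  \<open>G22 = (\<Sum>i<n. (d i)\<^sup>2) / n\<^sup>2\<close>. Here \<open>d i * e i\<close> telescopes up to squares, because it is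
  minus the increment of \<open>(A i + \<mu> / 2)\<^sup>2 / 2\<close> plus \<open>(e i)\<^sup>2 / 2\<close>, so the weak law of large numbers expresses
  \<open>R2\<close> by \<open>(A n)\<^sup>2 / n\<close>.

  It remains to find the limit law of such a quotient. As the denominator is positive, the event
  that the quotient is at most \<open>x\<close> says that a single linear combination of \<open>(A n)\<^sup>2 / n\<close> and
  \<open>(\<Sum>i<n. (A i)\<^sup>2) / n\<^sup>2\<close> is bounded by a constant. Hence it suffices to know the limit laws of these real
  random variables (\<open>quad_weak_conv\<close>). They are found by approximating with quadratic forms in finitely many
  independent block increments, uniformly in \<open>n\<close>, for the walk and for the Wiener process alike.

  Finally \<open>\<integral> W dW\<close> must be identified with \<open>((W 1)\<^sup>2 - 1) / 2\<close>. This follows from an isometry that holds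
  for every simple integrand \<open>h\<close>: the squared \<open>L\<^sup>2\<close> distance between \<open>((W 1)\<^sup>2 - 1) / 2\<close> and the elementary integral
  of \<open>h\<close> equals the squared \<open>L\<^sup>2\<close> distance between \<open>W\<close> and \<open>h\<close>, which gives existence and uniqueness at once.
  If the innovations have variance zero, the residuals of the true parameters vanish, the least squares
  fit is exact, and the two normal limits are Dirac measures.
\<close>

section \<open>Convergence in probability as convergence along a filter\<close>

text \<open>A property holds eventually along this filter if it holds on events whose probability tends to one.
  With it, convergence in probability is an ordinary limit, so that the library's rules for
  limits of sums, products and quotients apply. Asking for an event on which the
  property holds, instead of for the probability of the property, gives a meaning to properties that need not be measurable.\<close>
definition in_prob :: "'a measure \<Rightarrow> (nat \<times> 'a) filter" where
  "in_prob M = Abs_filter (\<lambda>P. \<forall>\<delta>>0. \<forall>\<^sub>F n in sequentially.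
     \<exists>A\<in>sets M. measure M A \<ge> 1 - \<delta> \<and> (\<forall>\<omega>\<in>A. P (n, \<omega>)))"

abbreviation conv_prob :: "'a measure \<Rightarrow> (nat \<Rightarrow> 'a \<Rightarrow> 'c::topological_space) \<Rightarrow> 'c \<Rightarrow> bool" where
  "conv_prob M Y c \<equiv> ((\<lambda>p. Y (fst p) (snd p)) \<longlongrightarrow> c) (in_prob M)"

text \<open>Tightness. This is weaker than boundedness along the filter, since the bound may depend
  on the exceptional probability \<open>\<delta>\<close>.\<close>
definition bounded_in_prob :: "'a measure \<Rightarrow> (nat \<Rightarrow> 'a \<Rightarrow> real) \<Rightarrow> bool" where
  "bounded_in_prob M Y \<longleftrightarrow> (\<forall>\<delta>>0. \<exists>K. \<forall>\<^sub>F n in sequentially.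
     \<exists>A\<in>sets M. measure M A \<ge> 1 - \<delta> \<and> (\<forall>\<omega>\<in>A. \<bar>Y n \<omega>\<bar> \<le> K))"

context prob_space
begin

lemma prob_Int_ge:
  assumes "A \<in> events" "B \<in> events" "prob A \<ge> 1 - a" "prob B \<ge> 1 - b"
  shows "prob (A \<inter> B) \<ge> 1 - (a + b)"
proof -
  have "prob (A \<union> B) = prob A + prob (B - A)"
    using assms by (metis finite_measure_Union')
  moreover have "prob (B - A) = prob B - prob (A \<inter> B)"
    using assms by (metis finite_measure_Diff' inf_commute)
  moreover have "prob (A \<union> B) \<le> 1" by simp
  ultimately show ?thesis using assms by linarith
qed

lemma eventually_in_prob:
  "eventually P (in_prob M) \<longleftrightarrow> (\<forall>\<delta>>0. \<forall>\<^sub>F n in sequentially.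
     \<exists>A\<in>events. prob A \<ge> 1 - \<delta> \<and> (\<forall>\<omega>\<in>A. P (n, \<omega>)))"
  unfolding in_prob_def
proof (rule eventually_Abs_filter, rule is_filter.intro)
  show "\<forall>\<delta>>0. \<forall>\<^sub>F n in sequentially. \<exists>A\<in>events. prob A \<ge> 1 - \<delta> \<and> (\<forall>\<omega>\<in>A. True)"
    by (auto intro!: always_eventually bexI[of _ "space M"] simp: prob_space)
next
  fix P Q :: "nat \<times> 'a \<Rightarrow> bool"
  assume P: "\<forall>\<delta>>0. \<forall>\<^sub>F n in sequentially. \<exists>A\<in>events. prob A \<ge> 1 - \<delta> \<and> (\<forall>\<omega>\<in>A. P (n, \<omega>))"
    and Q: "\<forall>\<delta>>0. \<forall>\<^sub>F n in sequentially. \<exists>A\<in>events. prob A \<ge> 1 - \<delta> \<and> (\<forall>\<omega>\<in>A. Q (n, \<omega>))"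
  show "\<forall>\<delta>>0. \<forall>\<^sub>F n in sequentially. \<exists>A\<in>events. prob A \<ge> 1 - \<delta> \<and> (\<forall>\<omega>\<in>A. P (n, \<omega>) \<and> Q (n, \<omega>))"
  proof (intro allI impI)
    fix \<delta> :: real assume "\<delta> > 0"
    then have "\<delta> / 2 > 0" by simp
    from P[rule_format, OF this] Q[rule_format, OF this]
    show "\<forall>\<^sub>F n in sequentially. \<exists>A\<in>events. prob A \<ge> 1 - \<delta> \<and> (\<forall>\<omega>\<in>A. P (n, \<omega>) \<and> Q (n, \<omega>))"
    proof eventually_elim
      case (elim n)
      then obtain A B where "A \<in> events" "B \<in> events" "prob A \<ge> 1 - \<delta>/2" "prob B \<ge> 1 - \<delta>/2"
        and "\<forall>\<omega>\<in>A. P (n, \<omega>)" "\<forall>\<omega>\<in>B. Q (n, \<omega>)"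
        by blast
      then show ?case
        using prob_Int_ge[of A B "\<delta>/2" "\<delta>/2"] by (intro bexI[of _ "A \<inter> B"]) auto
    qed
  qed
next
  fix P Q :: "nat \<times> 'a \<Rightarrow> bool"
  assume PQ: "\<forall>x. P x \<longrightarrow> Q x"
    and P: "\<forall>\<delta>>0. \<forall>\<^sub>F n in sequentially. \<exists>A\<in>events. prob A \<ge> 1 - \<delta> \<and> (\<forall>\<omega>\<in>A. P (n, \<omega>))"
  show "\<forall>\<delta>>0. \<forall>\<^sub>F n in sequentially. \<exists>A\<in>events. prob A \<ge> 1 - \<delta> \<and> (\<forall>\<omega>\<in>A. Q (n, \<omega>))"
  proof (intro allI impI)
    fix \<delta> :: real assume "\<delta> > 0"
    from P[rule_format, OF this]
    show "\<forall>\<^sub>F n in sequentially. \<exists>A\<in>events. prob A \<ge> 1 - \<delta> \<and> (\<forall>\<omega>\<in>A. Q (n, \<omega>))"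
      by (rule eventually_mono) (use PQ in blast)
  qed
qed

text \<open>Deterministic limits are limits along the filter.\<close>
lemma filterlim_fst_in_prob: "filterlim fst sequentially (in_prob M)"
  unfolding filterlim_iff eventually_in_prob
  by (auto intro!: bexI[of _ "space M"] simp: prob_space elim!: eventually_mono)

lemma conv_prob_const_seq: "a \<longlonglongrightarrow> c \<Longrightarrow> conv_prob M (\<lambda>n _. a n) c"
  by (rule filterlim_compose[OF _ filterlim_fst_in_prob])

lemma eventually_in_prob_AE_seq:
  assumes "\<forall>\<^sub>F n in sequentially. AE \<omega> in M. P n \<omega>"
  shows "\<forall>\<^sub>F p in in_prob M. P (fst p) (snd p)"
  unfolding eventually_in_prob
proof (intro allI impI)
  fix \<delta> :: real assume \<delta>: "\<delta> > 0"
  from assms show "\<forall>\<^sub>F n in sequentially. \<exists>A\<in>events. prob A \<ge> 1 - \<delta> \<and> (\<forall>\<omega>\<in>A. P (fst (n, \<omega>)) (snd (n, \<omega>)))"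
  proof eventually_elim
    case (elim n)
    then obtain B where B: "{\<omega>\<in>space M. \<not> P n \<omega>} \<subseteq> B" "B \<in> events" "emeasure M B = 0"
      by (rule AE_E)
    then have "prob B = 0" by (simp add: measure_def)
    then have "prob (space M - B) = 1"
      using B(2) by (simp add: prob_compl)
    with B(1,2) \<delta> show ?case
      by (intro bexI[of _ "space M - B"]) auto
  qed
qed

lemma prob_tendsto_0_of_eventually:
  assumes P: "\<forall>\<^sub>F p in in_prob M. P (fst p) (snd p)"
    and E: "\<And>n. E n \<in> events" "\<And>n \<omega>. \<omega> \<in> E n \<Longrightarrow> \<not> P n \<omega>"
  shows "(\<lambda>n. prob (E n)) \<longlonglongrightarrow> 0"
proof (rule LIMSEQ_I)
  fix r :: real assume "r > 0"
  then have "\<forall>\<^sub>F n in sequentially. \<exists>A\<in>events. prob A \<ge> 1 - r/2 \<and> (\<forall>\<omega>\<in>A. P n \<omega>)"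
    using P unfolding eventually_in_prob by (auto dest: spec[of _ "r/2"])
  then have "\<forall>\<^sub>F n in sequentially. norm (prob (E n) - 0) < r"
  proof eventually_elim
    case (elim n)
    then obtain A where A: "A \<in> events" "prob A \<ge> 1 - r/2" "\<forall>\<omega>\<in>A. P n \<omega>" by blast
    then have "prob (A \<union> E n) = prob A + prob (E n)"
      using E by (intro finite_measure_Union) auto
    moreover have "prob (A \<union> E n) \<le> 1" by simp
    ultimately show ?case using A \<open>r > 0\<close> by simp
  qed
  then show "\<exists>no. \<forall>n\<ge>no. norm (prob (E n) - 0) < r"
    by (simp add: eventually_sequentially)
qed

text \<open>Bounded convergence for convergence in probability.\<close>
lemma expectation_tendsto_0_of_conv_prob:
  fixes Y :: "nat \<Rightarrow> 'a \<Rightarrow> real"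
  assumes Y: "conv_prob M Y 0" and meas[measurable]: "\<And>n. Y n \<in> borel_measurable M"
    and bnd: "\<And>n \<omega>. \<bar>Y n \<omega>\<bar> \<le> B"
  shows "(\<lambda>n. expectation (Y n)) \<longlonglongrightarrow> 0"
proof (rule LIMSEQ_I)
  fix r :: real assume r: "r > 0"
  let ?E = "\<lambda>n. {\<omega>\<in>space M. \<bar>Y n \<omega>\<bar> \<ge> r/2}"
  have B: "B \<ge> 0" using bnd[of 0 undefined] by linarith
  have "\<forall>\<^sub>F p in in_prob M. \<bar>Y (fst p) (snd p)\<bar> < r/2"
    using Y r by (auto simp: tendsto_iff dist_real_def dest: spec[of _ "r/2"])
  then have "(\<lambda>n. prob (?E n)) \<longlonglongrightarrow> 0"
    by (rule prob_tendsto_0_of_eventually) auto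
  then have "(\<lambda>n. B * prob (?E n)) \<longlonglongrightarrow> 0"
    by (rule tendsto_mult_right_zero)
  then have "\<forall>\<^sub>F n in sequentially. B * prob (?E n) < r/2"
    using r by (rule order_tendstoD(2)[OF _ half_gt_zero])
  then have "\<forall>\<^sub>F n in sequentially. norm (expectation (Y n) - 0) < r"
  proof eventually_elim
    case (elim n)
    have int: "integrable M (Y n)"
      by (rule integrable_const_bound[of _ B]) (auto simp: bnd)
    have "norm (expectation (Y n)) \<le> expectation (\<lambda>\<omega>. norm (Y n \<omega>))"
      by (rule integral_norm_bound)
    also have "\<dots> \<le> expectation (\<lambda>\<omega>. r/2 + B * indicator (?E n) \<omega>)"
    proof (rule integral_mono)
      show "norm (Y n \<omega>) \<le> r/2 + B * indicator (?E n) \<omega>" if "\<omega> \<in> space M" for \<omega>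
        using bnd[of n \<omega>] r B that by (cases "\<omega> \<in> ?E n") auto
      show "integrable M (\<lambda>\<omega>. r/2 + B * indicator (?E n) \<omega>)"
        by (intro Bochner_Integration.integrable_add integrable_mult_right integrable_real_indicator)
           (auto simp: less_top[symmetric])
    qed (use int in auto)
    also have "\<dots> = r/2 + B * prob (?E n)"
      by (subst Bochner_Integration.integral_add)
         (auto simp: prob_space less_top[symmetric] intro!: integrable_mult_right integrable_real_indicator)
    finally show ?case using elim by simp
  qed
  then show "\<exists>no. \<forall>n\<ge>no. norm (expectation (Y n) - 0) < r"
    by (simp add: eventually_sequentially)
qed

lemma conv_prob_of_L1:
  fixes Y :: "nat \<Rightarrow> 'a \<Rightarrow> real"
  assumes int: "\<And>n. integrable M (Y n)"
    and lim: "(\<lambda>n. expectation (\<lambda>\<omega>. \<bar>Y n \<omega>\<bar>)) \<longlonglongrightarrow> 0"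
  shows "conv_prob M Y 0"
  unfolding tendsto_iff eventually_in_prob
proof (intro allI impI)
  fix e \<delta> :: real assume e: "e > 0" and d: "\<delta> > 0"
  have [measurable]: "Y n \<in> borel_measurable M" for n using int[of n] by simp
  have "\<forall>\<^sub>F n in sequentially. expectation (\<lambda>\<omega>. \<bar>Y n \<omega>\<bar>) < \<delta> * e"
    using lim e d by (intro order_tendstoD(2)) auto
  then show "\<forall>\<^sub>F n in sequentially. \<exists>A\<in>events. 1 - \<delta> \<le> prob A \<and> (\<forall>\<omega>\<in>A. dist (Y (fst (n, \<omega>)) (snd (n, \<omega>))) 0 < e)"
  proof eventually_elim
    case (elim n)
    let ?A = "{\<omega>\<in>space M. \<bar>Y n \<omega>\<bar> < e}"
    have "prob {\<omega>\<in>space M. \<bar>Y n \<omega>\<bar> \<ge> e} \<le> expectation (\<lambda>\<omega>. \<bar>Y n \<omega>\<bar>) / e"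
      using e int by (intro integral_Markov_inequality_measure[where A="space M"]) auto
    also have "\<dots> \<le> \<delta>" using elim e by (simp add: divide_le_eq)
    finally have "prob {\<omega>\<in>space M. \<bar>Y n \<omega>\<bar> \<ge> e} \<le> \<delta>" .
    moreover have "?A = space M - {\<omega>\<in>space M. \<bar>Y n \<omega>\<bar> \<ge> e}" by auto
    ultimately have "1 - \<delta> \<le> prob ?A" by (simp add: prob_compl)
    then show ?case by (intro bexI[of _ ?A]) auto
  qed
qed

lemma conv_prob_of_L1_bound:
  fixes Y :: "nat \<Rightarrow> 'a \<Rightarrow> real"
  assumes int: "\<And>n. integrable M (Y n)" and "\<And>n. expectation (\<lambda>\<omega>. \<bar>Y n \<omega>\<bar>) \<le> b n" "b \<longlonglongrightarrow> 0"
  shows "conv_prob M Y 0"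
  by (rule conv_prob_of_L1[OF int tendsto_sandwich[OF _ _ tendsto_const assms(3)]])
     (use assms in \<open>auto intro!: always_eventually\<close>)

lemma bounded_in_probE:
  assumes "bounded_in_prob M Y" "\<delta> > 0"
  obtains K where "\<forall>\<^sub>F n in sequentially. \<exists>A\<in>events. prob A \<ge> 1 - \<delta> \<and> (\<forall>\<omega>\<in>A. \<bar>Y n \<omega>\<bar> \<le> K)"
  using assms unfolding bounded_in_prob_def by blast

lemma bounded_in_prob_cong:
  assumes eq: "\<forall>\<^sub>F p in in_prob M. Y (fst p) (snd p) = Z (fst p) (snd p)"
    and Y: "bounded_in_prob M Y"
  shows "bounded_in_prob M Z"
  unfolding bounded_in_prob_def
proof (intro allI impI)
  fix \<delta> :: real assume "\<delta> > 0"
  then have d: "\<delta>/2 > 0" by simp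
  obtain K where K: "\<forall>\<^sub>F n in sequentially. \<exists>A\<in>events. prob A \<ge> 1 - \<delta>/2 \<and> (\<forall>\<omega>\<in>A. \<bar>Y n \<omega>\<bar> \<le> K)"
    by (rule bounded_in_probE[OF Y d])
  have "\<forall>\<^sub>F n in sequentially. \<exists>A\<in>events. prob A \<ge> 1 - \<delta>/2 \<and> (\<forall>\<omega>\<in>A. Y n \<omega> = Z n \<omega>)"
    using eq d unfolding eventually_in_prob by simp
  with K have "\<forall>\<^sub>F n in sequentially. \<exists>A\<in>events. prob A \<ge> 1 - \<delta> \<and> (\<forall>\<omega>\<in>A. \<bar>Z n \<omega>\<bar> \<le> K)"
  proof eventually_elim
    case (elim n)
    then obtain A B where "A \<in> events" "B \<in> events" "prob A \<ge> 1 - \<delta>/2" "prob B \<ge> 1 - \<delta>/2"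
        and "\<forall>\<omega>\<in>A. \<bar>Y n \<omega>\<bar> \<le> K" "\<forall>\<omega>\<in>B. Y n \<omega> = Z n \<omega>"
      by blast
    then show ?case
      using prob_Int_ge[of A B "\<delta>/2" "\<delta>/2"] by (intro bexI[of _ "A \<inter> B"]) auto
  qed
  then show "\<exists>K. \<forall>\<^sub>F n in sequentially. \<exists>A\<in>events. prob A \<ge> 1 - \<delta> \<and> (\<forall>\<omega>\<in>A. \<bar>Z n \<omega>\<bar> \<le> K)" ..
qed

text \<open>Tightness is preserved by every operation that maps bounded sets to bounded sets; sums, differences
  and products are instances.\<close>
lemma bounded_in_prob_compose2:
  assumes Y: "bounded_in_prob M Y" and Z: "bounded_in_prob M Z"
    and g: "\<And>y z K L. \<bar>y\<bar> \<le> K \<Longrightarrow> \<bar>z\<bar> \<le> L \<Longrightarrow> \<bar>g y z\<bar> \<le> b K L"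
  shows "bounded_in_prob M (\<lambda>n \<omega>. g (Y n \<omega>) (Z n \<omega>))"
  unfolding bounded_in_prob_def
proof (intro allI impI)
  fix \<delta> :: real assume "\<delta> > 0"
  then have d: "\<delta>/2 > 0" by simp
  obtain K where K: "\<forall>\<^sub>F n in sequentially. \<exists>A\<in>events. prob A \<ge> 1 - \<delta>/2 \<and> (\<forall>\<omega>\<in>A. \<bar>Y n \<omega>\<bar> \<le> K)"
    by (rule bounded_in_probE[OF Y d])
  obtain L where L: "\<forall>\<^sub>F n in sequentially. \<exists>A\<in>events. prob A \<ge> 1 - \<delta>/2 \<and> (\<forall>\<omega>\<in>A. \<bar>Z n \<omega>\<bar> \<le> L)"
    by (rule bounded_in_probE[OF Z d])
  from K L have "\<forall>\<^sub>F n in sequentially. \<exists>A\<in>events. prob A \<ge> 1 - \<delta> \<and> (\<forall>\<omega>\<in>A. \<bar>g (Y n \<omega>) (Z n \<omega>)\<bar> \<le> b K L)"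
  proof eventually_elim
    case (elim n)
    then obtain A B where "A \<in> events" "B \<in> events" "prob A \<ge> 1 - \<delta>/2" "prob B \<ge> 1 - \<delta>/2"
        and "\<forall>\<omega>\<in>A. \<bar>Y n \<omega>\<bar> \<le> K" "\<forall>\<omega>\<in>B. \<bar>Z n \<omega>\<bar> \<le> L"
      by blast
    then show ?case
      using prob_Int_ge[of A B "\<delta>/2" "\<delta>/2"] g by (intro bexI[of _ "A \<inter> B"]) auto
  qed
  then show "\<exists>K. \<forall>\<^sub>F n in sequentially. \<exists>A\<in>events. prob A \<ge> 1 - \<delta> \<and> (\<forall>\<omega>\<in>A. \<bar>g (Y n \<omega>) (Z n \<omega>)\<bar> \<le> K)" ..
qed

lemma bounded_in_prob_add:
  "bounded_in_prob M Y \<Longrightarrow> bounded_in_prob M Z \<Longrightarrow> bounded_in_prob M (\<lambda>n \<omega>. Y n \<omega> + Z n \<omega>)"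
  by (rule bounded_in_prob_compose2[where b="(+)"]) auto

lemma bounded_in_prob_diff:
  "bounded_in_prob M Y \<Longrightarrow> bounded_in_prob M Z \<Longrightarrow> bounded_in_prob M (\<lambda>n \<omega>. Y n \<omega> - Z n \<omega>)"
  by (rule bounded_in_prob_compose2[where b="(+)"]) auto

lemma bounded_in_prob_mult:
  "bounded_in_prob M Y \<Longrightarrow> bounded_in_prob M Z \<Longrightarrow> bounded_in_prob M (\<lambda>n \<omega>. Y n \<omega> * Z n \<omega>)"
  by (rule bounded_in_prob_compose2[where b="\<lambda>K L. \<bar>K\<bar> * \<bar>L\<bar>"])
     (auto simp: abs_mult intro!: mult_mono)

lemma bounded_in_prob_of_conv_prob:
  assumes "conv_prob M Y (c::real)"
  shows "bounded_in_prob M Y"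
  unfolding bounded_in_prob_def
proof (intro allI impI)
  fix \<delta> :: real assume d: "\<delta> > 0"
  have "\<forall>\<^sub>F p in in_prob M. \<bar>Y (fst p) (snd p)\<bar> \<le> \<bar>c\<bar> + 1"
  proof -
    have "\<forall>\<^sub>F p in in_prob M. dist (Y (fst p) (snd p)) c < 1"
      using assms by (auto simp: tendsto_iff dest: spec[of _ 1])
    then show ?thesis by eventually_elim (auto simp: dist_real_def)
  qed
  then show "\<exists>K. \<forall>\<^sub>F n in sequentially. \<exists>A\<in>events. prob A \<ge> 1 - \<delta> \<and> (\<forall>\<omega>\<in>A. \<bar>Y n \<omega>\<bar> \<le> K)"
    using d unfolding eventually_in_prob by auto
qed

lemma bounded_in_prob_of_L2:
  fixes Y :: "nat \<Rightarrow> 'a \<Rightarrow> real"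
  assumes [measurable]: "\<And>n. Y n \<in> borel_measurable M"
    and int: "\<And>n. integrable M (\<lambda>\<omega>. (Y n \<omega>)\<^sup>2)"
    and bnd: "\<And>n. expectation (\<lambda>\<omega>. (Y n \<omega>)\<^sup>2) \<le> B"
  shows "bounded_in_prob M Y"
  unfolding bounded_in_prob_def
proof (intro allI impI)
  fix \<delta> :: real assume d: "\<delta> > 0"
  define K where "K = sqrt ((\<bar>B\<bar> + 1) / \<delta>)"
  have K: "K > 0" "K\<^sup>2 = (\<bar>B\<bar> + 1) / \<delta>" using d by (auto simp: K_def)
  have "1 - \<delta> \<le> prob {\<omega>\<in>space M. \<bar>Y n \<omega>\<bar> \<le> K}" for n
  proof -
    have "prob {\<omega>\<in>space M. (Y n \<omega>)\<^sup>2 \<ge> K\<^sup>2} \<le> expectation (\<lambda>\<omega>. (Y n \<omega>)\<^sup>2) / K\<^sup>2"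
      using int zero_less_power[OF K(1), of 2]
      by (intro integral_Markov_inequality_measure[where A="space M"]) auto
    also have "\<dots> \<le> (\<bar>B\<bar> + 1) / K\<^sup>2"
      using bnd[of n] by (intro divide_right_mono) auto
    also have "\<dots> = \<delta>" using K d by (simp add: field_simps)
    finally have le: "prob {\<omega>\<in>space M. (Y n \<omega>)\<^sup>2 \<ge> K\<^sup>2} \<le> \<delta>" .
    have "1 - prob {\<omega>\<in>space M. (Y n \<omega>)\<^sup>2 \<ge> K\<^sup>2} = prob (space M - {\<omega>\<in>space M. (Y n \<omega>)\<^sup>2 \<ge> K\<^sup>2})"
      by (simp add: prob_compl)
    also have "\<dots> \<le> prob {\<omega>\<in>space M. \<bar>Y n \<omega>\<bar> \<le> K}"
      using K(1) by (intro finite_measure_mono) (auto intro!: power2_le_imp_le[of "\<bar>_\<bar>" K])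
    finally show ?thesis using le by linarith
  qed
  then show "\<exists>K. \<forall>\<^sub>F n in sequentially. \<exists>A\<in>events. prob A \<ge> 1 - \<delta> \<and> (\<forall>\<omega>\<in>A. \<bar>Y n \<omega>\<bar> \<le> K)"
    by (intro exI[of _ K] always_eventually allI bexI[of _ "{\<omega>\<in>space M. \<bar>Y _ \<omega>\<bar> \<le> K}"]) auto
qed

text \<open>On the compact set in which \<open>Y\<close> lives with high probability, \<open>g\<close> is uniformly continuous, so that
  \<open>g (Y, Z)\<close> is close to \<open>g (Y, 0)\<close>. Two uses: products of a tight and a null
  sequence, and the replacement of the argument of a test function that is merely continuous.\<close>
lemma conv_prob_continuous_null:
  fixes g :: "real \<times> real \<Rightarrow> real"
  assumes Y: "bounded_in_prob M Y" and Z: "conv_prob M Z 0"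
    and cont: "continuous_on UNIV g" and null: "\<And>y. g (y, 0) = 0"
  shows "conv_prob M (\<lambda>n \<omega>. g (Y n \<omega>, Z n \<omega>)) 0"
  unfolding tendsto_iff eventually_in_prob
proof (intro allI impI)
  fix e \<delta> :: real assume e: "e > 0" and d: "\<delta> > 0"
  then have d2: "\<delta>/2 > 0" by simp
  obtain K where K: "\<forall>\<^sub>F n in sequentially. \<exists>A\<in>events. prob A \<ge> 1 - \<delta>/2 \<and> (\<forall>\<omega>\<in>A. \<bar>Y n \<omega>\<bar> \<le> K)"
    by (rule bounded_in_probE[OF Y d2])
  have "uniformly_continuous_on (cbox (-K,-1) (K,1)) g"
    by (rule compact_uniformly_continuous[OF continuous_on_subset[OF cont]]) auto
  then obtain \<eta> where \<eta>: "\<eta> > 0"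
    "\<And>x x'. x \<in> cbox (-K,-1) (K,1) \<Longrightarrow> x' \<in> cbox (-K,-1) (K,1) \<Longrightarrow> dist x' x < \<eta> \<Longrightarrow> dist (g x') (g x) < e"
    unfolding uniformly_continuous_on_def using e by metis
  have small: "\<bar>g (y, z)\<bar> < e" if "\<bar>y\<bar> \<le> K" "\<bar>z\<bar> < min \<eta> 1" for y z
  proof -
    have "dist (g (y, z)) (g (y, 0)) < e"
      by (rule \<eta>) (use that in \<open>auto simp: dist_Pair_Pair dist_real_def cbox_Pair_eq\<close>)
    then show ?thesis by (simp add: null)
  qed
  have "\<forall>\<^sub>F p in in_prob M. dist (Z (fst p) (snd p)) 0 < min \<eta> 1"
    using Z \<eta>(1) by (intro tendstoD) auto
  then have "\<forall>\<^sub>F n in sequentially. \<exists>A\<in>events. prob A \<ge> 1 - \<delta>/2 \<and> (\<forall>\<omega>\<in>A. \<bar>Z n \<omega>\<bar> < min \<eta> 1)"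
    using d2 unfolding eventually_in_prob by simp
  with K show "\<forall>\<^sub>F n in sequentially. \<exists>A\<in>events. 1 - \<delta> \<le> prob A \<and>
      (\<forall>\<omega>\<in>A. dist (g (Y (fst (n, \<omega>)) (snd (n, \<omega>)), Z (fst (n, \<omega>)) (snd (n, \<omega>)))) 0 < e)"
  proof eventually_elim
    case (elim n)
    then obtain A B where "A \<in> events" "B \<in> events" "prob A \<ge> 1 - \<delta>/2" "prob B \<ge> 1 - \<delta>/2"
        and "\<forall>\<omega>\<in>A. \<bar>Y n \<omega>\<bar> \<le> K" "\<forall>\<omega>\<in>B. \<bar>Z n \<omega>\<bar> < min \<eta> 1"
      by blast
    then show ?case
      using prob_Int_ge[of A B "\<delta>/2" "\<delta>/2"] small by (intro bexI[of _ "A \<inter> B"]) auto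
  qed
qed

lemma conv_prob_mult_bounded:
  assumes "bounded_in_prob M Y" "conv_prob M Z (0::real)"
  shows "conv_prob M (\<lambda>n \<omega>. Y n \<omega> * Z n \<omega>) 0"
proof -
  have "continuous_on UNIV (\<lambda>p::real \<times> real. fst p * snd p)"
    by (intro continuous_intros)
  from conv_prob_continuous_null[OF assms this] show ?thesis by simp
qed

text \<open>Slutsky's lemma, by comparison of characteristic functions:
  \<open>iexp (t * (Z n - Y n)) - 1\<close> is bounded and tends to zero in probability.\<close>
lemma weak_conv_m_of_conv_prob_diff:
  fixes Y Z :: "nat \<Rightarrow> 'a \<Rightarrow> real"
  assumes [measurable]: "\<And>n. Y n \<in> borel_measurable M" "\<And>n. Z n \<in> borel_measurable M"
    and \<nu>: "real_distribution \<nu>"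
    and Y: "weak_conv_m (\<lambda>n. distr M borel (Y n)) \<nu>"
    and diff: "conv_prob M (\<lambda>n \<omega>. Z n \<omega> - Y n \<omega>) 0"
  shows "weak_conv_m (\<lambda>n. distr M borel (Z n)) \<nu>"
proof (rule levy_continuity)
  fix t :: real
  let ?\<phi> = "\<lambda>n. char (distr M borel (Y n)) t" and ?\<psi> = "\<lambda>n. char (distr M borel (Z n)) t"
  have Ylim: "?\<phi> \<longlonglongrightarrow> char \<nu> t"
    by (rule levy_continuity1[OF _ \<nu> Y]) auto
  have "conv_prob M (\<lambda>n \<omega>. norm (iexp (t * (Z n \<omega> - Y n \<omega>)) - 1)) (norm (iexp (t * 0) - 1))"
    by (intro tendsto_intros diff)
  moreover have "norm (iexp (t * (z - y)) - 1) = norm (iexp (t * z) - iexp (t * y))" for y z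
  proof -
    have "iexp (t * z) - iexp (t * y) = iexp (t * y) * (iexp (t * (z - y)) - 1)"
      by (simp add: algebra_simps flip: exp_add)
    then show ?thesis by (simp add: norm_mult)
  qed
  ultimately have "conv_prob M (\<lambda>n \<omega>. norm (iexp (t * Z n \<omega>) - iexp (t * Y n \<omega>))) 0"
    by simp
  then have lim: "(\<lambda>n. expectation (\<lambda>\<omega>. norm (iexp (t * Z n \<omega>) - iexp (t * Y n \<omega>)))) \<longlonglongrightarrow> 0"
    by (rule expectation_tendsto_0_of_conv_prob[where B=2])
       (auto intro!: order_trans[OF norm_triangle_ineq4])
  have int: "integrable M (\<lambda>\<omega>. iexp (t * U \<omega>))" if [measurable]: "U \<in> borel_measurable M" for U :: "'a \<Rightarrow> real"
    by (rule integrable_const_bound[of _ 1]) auto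
  have "norm (?\<psi> n - ?\<phi> n) \<le> expectation (\<lambda>\<omega>. norm (iexp (t * Z n \<omega>) - iexp (t * Y n \<omega>)))" for n
  proof -
    have "?\<psi> n - ?\<phi> n = (CLINT \<omega>|M. iexp (t * Z n \<omega>) - iexp (t * Y n \<omega>))"
      unfolding char_def by (simp add: integral_distr int Bochner_Integration.integral_diff del: of_real_mult)
    also have "norm \<dots> \<le> expectation (\<lambda>\<omega>. norm (iexp (t * Z n \<omega>) - iexp (t * Y n \<omega>)))"
      by (rule integral_norm_bound)
    finally show ?thesis .
  qed
  then have "(\<lambda>n. ?\<psi> n - ?\<phi> n) \<longlonglongrightarrow> 0"
    by (intro Lim_null_comparison[OF _ lim]) auto
  from tendsto_add[OF this Ylim] show "?\<psi> \<longlonglongrightarrow> char \<nu> t" by simp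
qed (use \<nu> in auto)

end

section \<open>Limit theorems for weighted sums of i.i.d. variables\<close>

lemma real_distribution_normal_distribution:
  assumes "v \<ge> 0"
  shows "real_distribution (normal_distribution m v)"
proof (cases "v = 0")
  case True
  then show ?thesis
    by (auto simp: normal_distribution_def intro!: real_distribution.intro prob_space_return
        real_distribution_axioms.intro)
next
  case False
  with assms have "prob_space (density lborel (\<lambda>x. ennreal (normal_density m (sqrt v) x)))"
    by (intro prob_space_normal_density) auto
  with False show ?thesis
    by (auto simp: normal_distribution_def intro!: real_distribution.intro real_distribution_axioms.intro)
qed

lemma char_normal_distribution:
  assumes "v \<ge> 0"
  shows "char (normal_distribution 0 v) t = complex_of_real (exp (- (v * t\<^sup>2) / 2))"
proof (cases "v = 0")
  case True
  then show ?thesis by (simp add: normal_distribution_def char_def integral_return)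
next
  case False
  with assms have v: "v > 0" by simp
  let ?N = "density lborel (\<lambda>x. ennreal (normal_density 0 (sqrt v) x))"
  interpret N: prob_space ?N
    by (intro prob_space_normal_density) (use v in auto)
  have "distributed ?N lborel (\<lambda>x. x) (\<lambda>x. ennreal (normal_density 0 (sqrt v) x))"
    unfolding distributed_def by (auto simp: distr_id2)
  then have "distributed ?N lborel (\<lambda>x. (x - 0) / sqrt v) (\<lambda>x. ennreal (std_normal_density x))"
    using v by (subst (asm) N.normal_standard_normal_convert[of "sqrt v"]) auto
  then have "distr ?N lborel (\<lambda>x. x / sqrt v) = std_normal_distribution"
    by (simp add: distributed_def)
  then have "char std_normal_distribution (t * sqrt v) = (CLINT x|distr ?N lborel (\<lambda>x. x / sqrt v). iexp (t * sqrt v * x))"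
    by (simp add: char_def)
  also have "\<dots> = (CLINT x|?N. iexp (t * sqrt v * (x / sqrt v)))"
    by (subst integral_distr) auto
  also have "\<dots> = char ?N t"
    using v by (simp add: char_def)
  finally have "char std_normal_distribution (t * sqrt v) = char ?N t" .
  then have "char ?N t = complex_of_real (exp (- ((t * sqrt v)\<^sup>2) / 2))"
    by (simp only: char_std_normal_distribution)
  moreover have "(t * sqrt v)\<^sup>2 = v * t\<^sup>2"
    by (subst power_mult_distrib, subst real_sqrt_pow2) (use v in \<open>auto simp: mult.commute\<close>)
  ultimately show ?thesis
    using False unfolding normal_distribution_def by (simp only: if_False)
qed

text \<open>A form of the Cauchy-Schwarz inequality that is convenient when the best \<open>c\<close> is known in advance;
  it is \<open>(c * \<bar>z\<bar> - 1)\<^sup>2 \<ge> 0\<close>.\<close>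
lemma (in prob_space) expectation_abs_le_L2:
  fixes Z :: "'a \<Rightarrow> real"
  assumes [measurable]: "Z \<in> borel_measurable M" and int: "integrable M (\<lambda>\<omega>. (Z \<omega>)\<^sup>2)" and c: "c > 0"
  shows "expectation (\<lambda>\<omega>. \<bar>Z \<omega>\<bar>) \<le> (c * expectation (\<lambda>\<omega>. (Z \<omega>)\<^sup>2) + 1 / c) / 2"
proof -
  have "\<bar>z\<bar> \<le> (c * z\<^sup>2 + 1 / c) / 2" for z :: real
  proof -
    have "0 \<le> (c * \<bar>z\<bar> - 1)\<^sup>2 / c" using c by simp
    also have "\<dots> = c * z\<^sup>2 + 1 / c - 2 * \<bar>z\<bar>"
      using c by (simp add: power2_diff power_mult_distrib field_simps power2_eq_square)
    finally show ?thesis by simp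
  qed
  then have "expectation (\<lambda>\<omega>. \<bar>Z \<omega>\<bar>) \<le> expectation (\<lambda>\<omega>. (c * (Z \<omega>)\<^sup>2 + 1 / c) / 2)"
    using int square_integrable_imp_integrable[of Z] by (intro integral_mono) auto
  also have "\<dots> = (c * expectation (\<lambda>\<omega>. (Z \<omega>)\<^sup>2) + 1 / c) / 2"
    using int by (simp add: prob_space)
  finally show ?thesis .
qed

lemma (in prob_space)
  fixes h :: "real \<Rightarrow> real"
  assumes "X \<in> borel_measurable M" "Y \<in> borel_measurable M"
    and eq: "distr M borel X = distr M borel Y" and "h \<in> borel_measurable borel"
  shows integrable_cong_distr: "integrable M (\<lambda>\<omega>. h (X \<omega>)) \<longleftrightarrow> integrable M (\<lambda>\<omega>. h (Y \<omega>))"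
    and expectation_cong_distr: "expectation (\<lambda>\<omega>. h (X \<omega>)) = expectation (\<lambda>\<omega>. h (Y \<omega>))"
proof -
  have "integrable M (\<lambda>\<omega>. h (Z \<omega>)) = integrable (distr M borel Z) h"
    and "expectation (\<lambda>\<omega>. h (Z \<omega>)) = integral\<^sup>L (distr M borel Z) h"
    if "Z \<in> borel_measurable M" for Z
    using that assms(4) by (auto intro!: integrable_distr_eq[symmetric] integral_distr[symmetric])
  from this[OF assms(1)] this[OF assms(2)]
  show "integrable M (\<lambda>\<omega>. h (X \<omega>)) \<longleftrightarrow> integrable M (\<lambda>\<omega>. h (Y \<omega>))"
    and "expectation (\<lambda>\<omega>. h (X \<omega>)) = expectation (\<lambda>\<omega>. h (Y \<omega>))"
    by (simp_all only: eq)
qed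

locale centered_iid = prob_space M for M :: "'a measure" +
  fixes e :: "nat \<Rightarrow> 'a \<Rightarrow> real" and \<sigma>2 :: real
  assumes indep: "indep_vars (\<lambda>_. borel) e UNIV"
    and ident: "\<And>i. distr M borel (e i) = distr M borel (e 0)"
    and int2_0: "integrable M (\<lambda>\<omega>. (e 0 \<omega>)\<^sup>2)"
    and mean_0: "expectation (e 0) = 0"
    and \<sigma>2: "\<sigma>2 = expectation (\<lambda>\<omega>. (e 0 \<omega>)\<^sup>2)"
begin

lemma e_meas[measurable]: "e i \<in> borel_measurable M"
  using indep unfolding indep_vars_def2 by blast

lemma int2: "integrable M (\<lambda>\<omega>. (e i \<omega>)\<^sup>2)"
  using integrable_cong_distr[OF e_meas e_meas ident, of "\<lambda>x. x\<^sup>2" i] int2_0 by simp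

lemma int1: "integrable M (e i)"
  by (rule square_integrable_imp_integrable[OF e_meas int2])

lemma mean: "expectation (e i) = 0"
  using expectation_cong_distr[OF e_meas e_meas ident, of "\<lambda>x. x" i] mean_0 by simp

lemma variance_e: "expectation (\<lambda>\<omega>. (e i \<omega>)\<^sup>2) = \<sigma>2"
  using expectation_cong_distr[OF e_meas e_meas ident, of "\<lambda>x. x\<^sup>2" i] \<sigma>2 by simp

lemma \<sigma>2_nonneg: "\<sigma>2 \<ge> 0"
  unfolding \<sigma>2 by simp

lemma product_moment:
  shows "integrable M (\<lambda>\<omega>. e i \<omega> * e j \<omega>)"
    and "expectation (\<lambda>\<omega>. e i \<omega> * e j \<omega>) = (if i = j then \<sigma>2 else 0)"
proof -
  have "integrable M (\<lambda>\<omega>. e i \<omega> * e j \<omega>) \<and> expectation (\<lambda>\<omega>. e i \<omega> * e j \<omega>) = (if i = j then \<sigma>2 else 0)"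
  proof (cases "i = j")
    case True
    then show ?thesis using int2[of j] variance_e[of j] by (simp add: power2_eq_square)
  next
    case False
    have ij: "indep_vars (\<lambda>_. borel) e {i, j}"
      by (rule indep_vars_subset[OF indep]) auto
    show ?thesis
      using indep_vars_integrable[OF _ ij] indep_vars_lebesgue_integral[OF _ ij] int1 mean False by simp
  qed
  then show "integrable M (\<lambda>\<omega>. e i \<omega> * e j \<omega>)"
    and "expectation (\<lambda>\<omega>. e i \<omega> * e j \<omega>) = (if i = j then \<sigma>2 else 0)" by auto
qed

lemma weighted_sum_second_moment:
  assumes "finite I"
  shows "integrable M (\<lambda>\<omega>. (\<Sum>i\<in>I. w i * e i \<omega>)\<^sup>2)"
    and "expectation (\<lambda>\<omega>. (\<Sum>i\<in>I. w i * e i \<omega>)\<^sup>2) = \<sigma>2 * (\<Sum>i\<in>I. (w i)\<^sup>2)"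
proof -
  have eq: "(\<Sum>i\<in>I. w i * e i \<omega>)\<^sup>2 = (\<Sum>i\<in>I. \<Sum>j\<in>I. w i * w j * (e i \<omega> * e j \<omega>))" for \<omega>
    by (subst power2_eq_square, subst sum_product, intro sum.cong refl)
       (metis mult.assoc mult.left_commute)
  show "integrable M (\<lambda>\<omega>. (\<Sum>i\<in>I. w i * e i \<omega>)\<^sup>2)"
    unfolding eq by (intro Bochner_Integration.integrable_sum integrable_mult_right product_moment)
  have "expectation (\<lambda>\<omega>. (\<Sum>i\<in>I. w i * e i \<omega>)\<^sup>2) = (\<Sum>i\<in>I. \<Sum>j\<in>I. w i * w j * (if i = j then \<sigma>2 else 0))"
    unfolding eq
    by (simp only: Bochner_Integration.integral_sum[OF Bochner_Integration.integrable_sum] Bochner_Integration.integral_sum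
        integrable_mult_right product_moment integral_mult_right_zero)
  also have "\<dots> = (\<Sum>i\<in>I. w i * w i * \<sigma>2)"
  proof (intro sum.cong refl)
    fix i assume "i \<in> I"
    have "(\<Sum>j\<in>I. w i * w j * (if i = j then \<sigma>2 else 0)) = (\<Sum>j\<in>I. if j = i then w i * w j * \<sigma>2 else 0)"
      by (intro sum.cong) auto
    then show "(\<Sum>j\<in>I. w i * w j * (if i = j then \<sigma>2 else 0)) = w i * w i * \<sigma>2"
      using assms \<open>i \<in> I\<close> by (simp add: sum.delta')
  qed
  finally show "expectation (\<lambda>\<omega>. (\<Sum>i\<in>I. w i * e i \<omega>)\<^sup>2) = \<sigma>2 * (\<Sum>i\<in>I. (w i)\<^sup>2)"
    by (simp add: sum_distrib_left power2_eq_square mult.commute)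
qed

text \<open>The second-order expansions of the characteristic function of \<open>e 0\<close> and of the Gaussian one agree.
  Comparing with the Gaussian directly makes products over non-identically weighted
  factors easy.\<close>
lemma char_minus_gaussian_little_o:
  assumes "r > 0"
  shows "\<exists>d>0. \<forall>u. \<bar>u\<bar> < d \<longrightarrow> norm (char (distr M borel (e 0)) u - complex_of_real (exp (- (\<sigma>2 * u\<^sup>2) / 2))) \<le> r * u\<^sup>2"
proof -
  define h where "h u = expectation (\<lambda>\<omega>. min (6 * (e 0 \<omega>)\<^sup>2) (\<bar>u\<bar> * \<bar>e 0 \<omega>\<bar> ^ 3))" for u :: real
  have h0: "(h \<longlongrightarrow> 0) (at 0)"
    unfolding tendsto_at_iff_sequentially
  proof (intro allI impI)
    fix u :: "nat \<Rightarrow> real" assume u: "u \<longlonglongrightarrow> 0"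
    have "(\<lambda>n. expectation (\<lambda>\<omega>. min (6 * (e 0 \<omega>)\<^sup>2) (\<bar>u n\<bar> * \<bar>e 0 \<omega>\<bar> ^ 3)))
        \<longlonglongrightarrow> expectation (\<lambda>\<omega>. min (6 * (e 0 \<omega>)\<^sup>2) (\<bar>0\<bar> * \<bar>e 0 \<omega>\<bar> ^ 3))"
    proof (rule integral_dominated_convergence[where w="\<lambda>\<omega>. 6 * (e 0 \<omega>)\<^sup>2"])
      show "AE \<omega> in M. (\<lambda>n. min (6 * (e 0 \<omega>)\<^sup>2) (\<bar>u n\<bar> * \<bar>e 0 \<omega>\<bar> ^ 3))
          \<longlonglongrightarrow> min (6 * (e 0 \<omega>)\<^sup>2) (\<bar>0\<bar> * \<bar>e 0 \<omega>\<bar> ^ 3)"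
        by (intro AE_I2 tendsto_intros u)
      show "AE \<omega> in M. norm (min (6 * (e 0 \<omega>)\<^sup>2) (\<bar>u n\<bar> * \<bar>e 0 \<omega>\<bar> ^ 3)) \<le> 6 * (e 0 \<omega>)\<^sup>2" for n
        by (intro AE_I2) auto
    qed (use int2[of 0] in auto)
    then show "(h \<circ> u) \<longlonglongrightarrow> 0"
      by (simp add: h_def comp_def)
  qed
  have "\<forall>\<^sub>F u in at 0. h u < 3 * r"
    using h0 assms by (intro order_tendstoD(2)) auto
  then obtain d1 where d1: "d1 > 0" "\<And>u. u \<noteq> 0 \<Longrightarrow> \<bar>u\<bar> < d1 \<Longrightarrow> h u < 3 * r"
    by (auto simp: eventually_at dist_real_def)
  define k where "k = \<sigma>2 / 2"
  have k: "k \<ge> 0" using \<sigma>2_nonneg by (simp add: k_def)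
  define d where "d = min d1 (min 1 (r / (2 * (k\<^sup>2 + 1))))"
  have dpos: "d > 0" unfolding d_def using d1(1) assms by (auto simp: add_nonneg_pos)
  show ?thesis
  proof (intro exI[of _ d] conjI allI impI dpos)
    fix u :: real assume u: "\<bar>u\<bar> < d"
    let ?c = "char (distr M borel (e 0)) u"
    show "norm (?c - complex_of_real (exp (- (\<sigma>2 * u\<^sup>2) / 2))) \<le> r * u\<^sup>2"
    proof (cases "u = 0")
      case True
      interpret D: real_distribution "distr M borel (e 0)" by simp
      show ?thesis using True by (simp add: D.char_zero)
    next
      case False
      have "norm (?c - (1 - u\<^sup>2 * \<sigma>2 / 2)) \<le> u\<^sup>2 / 6 * h u"
        unfolding h_def
        by (rule char_approx3'[OF _ int1 int2 mean]) (auto simp: mean variance_e)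
      also have "\<dots> \<le> u\<^sup>2 / 6 * (3 * r)"
        using d1(2)[OF False] u unfolding d_def by (intro mult_left_mono) auto
      finally have 1: "norm (?c - (1 - u\<^sup>2 * \<sigma>2 / 2)) \<le> r / 2 * u\<^sup>2" by simp
      define y where "y = k * u\<^sup>2"
      have y: "y \<ge> 0" using k by (simp add: y_def)
      have "\<bar>exp (- y) - (1 - y)\<bar> \<le> y\<^sup>2"
      proof -
        have "exp (-y) \<ge> 1 - y" using exp_ge_add_one_self[of "-y"] by simp
        moreover have "exp (-y) \<le> 1 - y + y\<^sup>2"
        proof -
          have "exp (-y) \<le> 1 / (1 + y)"
            using exp_ge_add_one_self[of y] y by (simp add: exp_minus field_simps)
          also have "\<dots> \<le> 1 - y + y\<^sup>2"
          proof -
            have "(1 - y + y\<^sup>2) * (1 + y) = 1 + y * y\<^sup>2" by (simp add: algebra_simps power2_eq_square)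
            then show ?thesis using y by (simp add: divide_le_eq)
          qed
          finally show ?thesis .
        qed
        ultimately show ?thesis by (auto simp: abs_if)
      qed
      also have "y\<^sup>2 \<le> r / 2 * u\<^sup>2"
      proof -
        have "u\<^sup>2 = \<bar>u\<bar> * \<bar>u\<bar>" by (simp add: power2_eq_square)
        also have "\<dots> \<le> (r / (2 * (k\<^sup>2 + 1))) * 1"
          using u unfolding d_def by (intro mult_mono) auto
        finally have "k\<^sup>2 * u\<^sup>2 \<le> k\<^sup>2 * (r / (2 * (k\<^sup>2 + 1)))" by (intro mult_left_mono) auto
        also have "\<dots> = r / 2 * (k\<^sup>2 / (k\<^sup>2 + 1))" by (simp add: field_simps)
        also have "\<dots> \<le> r / 2 * 1"
          using assms by (intro mult_left_mono) (auto simp: divide_le_eq add_nonneg_pos)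
        finally have "k\<^sup>2 * u\<^sup>2 * u\<^sup>2 \<le> r / 2 * u\<^sup>2" by (intro mult_right_mono) auto
        then show ?thesis by (simp add: y_def power_mult_distrib power2_eq_square algebra_simps)
      qed
      finally have 2: "\<bar>exp (- y) - (1 - y)\<bar> \<le> r / 2 * u\<^sup>2" .
      have "norm (complex_of_real (1 - y) - complex_of_real (exp (- y))) \<le> r / 2 * u\<^sup>2"
        using 2 by (subst of_real_diff[symmetric], subst norm_of_real) (simp add: abs_minus_commute)
      moreover have "1 - u\<^sup>2 * \<sigma>2 / 2 = 1 - y" by (simp add: y_def k_def)
      ultimately have "norm ((?c - complex_of_real (1 - u\<^sup>2 * \<sigma>2 / 2)) + (complex_of_real (1 - y) - complex_of_real (exp (- y)))) \<le> r / 2 * u\<^sup>2 + r / 2 * u\<^sup>2"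
        using 1 by (intro norm_triangle_mono) (auto simp: of_real_diff)
      moreover have "- (\<sigma>2 * u\<^sup>2) / 2 = - y" by (simp add: y_def k_def)
      moreover have "r / 2 * u\<^sup>2 + r / 2 * u\<^sup>2 = r * u\<^sup>2" by simp
      ultimately show ?thesis
        using \<open>1 - u\<^sup>2 * \<sigma>2 / 2 = 1 - y\<close> by simp
    qed
  qed
qed

text \<open>The characteristic function of the sum is the product of those of its terms. It differs from the product of
  the Gaussian ones by at most the sum of the differences of the factors, which by the previous lemma is at most
  \<open>r * t\<^sup>2 * (\<Sum>i\<in>I n. (w n i)\<^sup>2)\<close> once the weights are small.\<close>
theorem weighted_central_limit_theorem:
  fixes w :: "nat \<Rightarrow> nat \<Rightarrow> real"
  assumes fin: "\<And>n. finite (I n)"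
    and sq: "(\<lambda>n. \<Sum>i\<in>I n. (w n i)\<^sup>2) \<longlonglongrightarrow> s"
    and small: "\<And>n i. i \<in> I n \<Longrightarrow> \<bar>w n i\<bar> \<le> c n" "c \<longlonglongrightarrow> 0"
  shows "weak_conv_m (\<lambda>n. distr M borel (\<lambda>\<omega>. \<Sum>i\<in>I n. w n i * e i \<omega>)) (normal_distribution 0 (s * \<sigma>2))"
proof (rule levy_continuity)
  have s: "s \<ge> 0"
    by (rule LIMSEQ_le_const[OF sq]) (auto intro!: sum_nonneg)
  then have s\<sigma>: "s * \<sigma>2 \<ge> 0" using \<sigma>2_nonneg by simp
  show "real_distribution (normal_distribution 0 (s * \<sigma>2))"
    by (rule real_distribution_normal_distribution[OF s\<sigma>])
  show "real_distribution (distr M borel (\<lambda>\<omega>. \<Sum>i\<in>I n. w n i * e i \<omega>))" for n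
    by (intro real_distribution_distr) measurable
  fix t :: real
  let ?\<phi> = "char (distr M borel (e 0))"
  let ?g = "\<lambda>u. complex_of_real (exp (- (\<sigma>2 * u\<^sup>2) / 2))"
  interpret D: real_distribution "distr M borel (e 0)" by simp
  have char_eq: "char (distr M borel (\<lambda>\<omega>. \<Sum>i\<in>I n. w n i * e i \<omega>)) t = (\<Prod>i\<in>I n. ?\<phi> (t * w n i))" for n
  proof -
    have "indep_vars (\<lambda>_. borel) (\<lambda>i \<omega>. w n i * e i \<omega>) (I n)"
      by (rule indep_vars_compose2[OF indep_vars_subset[OF indep]]) auto
    then have "char (distr M borel (\<lambda>\<omega>. \<Sum>i\<in>I n. w n i * e i \<omega>)) t = (\<Prod>i\<in>I n. char (distr M borel (\<lambda>\<omega>. w n i * e i \<omega>)) t)"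
      by (rule char_distr_sum)
    moreover have "char (distr M borel (\<lambda>\<omega>. w n i * e i \<omega>)) t = char (distr M borel (e i)) (t * w n i)" for i
      unfolding char_def by (simp add: integral_distr mult.assoc)
    then have "char (distr M borel (\<lambda>\<omega>. w n i * e i \<omega>)) t = ?\<phi> (t * w n i)" for i
      by (simp only: ident[of i])
    ultimately show ?thesis by simp
  qed
  have prod_g: "(\<Prod>i\<in>I n. ?g (t * w n i)) = ?g (t * sqrt (\<Sum>i\<in>I n. (w n i)\<^sup>2))" for n
  proof -
    have "(\<Prod>i\<in>I n. ?g (t * w n i)) = complex_of_real (exp (\<Sum>i\<in>I n. - (\<sigma>2 * (t * w n i)\<^sup>2) / 2))"
      using fin[of n] by (simp add: exp_sum)
    also have "(\<Sum>i\<in>I n. - (\<sigma>2 * (t * w n i)\<^sup>2) / 2) = - (\<sigma>2 * t\<^sup>2) / 2 * (\<Sum>i\<in>I n. (w n i)\<^sup>2)"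
      unfolding sum_distrib_left by (intro sum.cong) (auto simp: power_mult_distrib)
    finally show ?thesis
      by (simp add: power_mult_distrib real_sqrt_pow2 sum_nonneg mult.assoc)
  qed
  have "(\<lambda>n. (\<Prod>i\<in>I n. ?\<phi> (t * w n i)) - (\<Prod>i\<in>I n. ?g (t * w n i))) \<longlonglongrightarrow> 0"
  proof (rule LIMSEQ_I)
    fix \<epsilon> :: real assume \<epsilon>: "\<epsilon> > 0"
    define r where "r = \<epsilon> / (t\<^sup>2 * (s + 1) + 1)"
    have den: "t\<^sup>2 * (s + 1) + 1 > 0" using s by (intro add_nonneg_pos) auto
    then have r: "r > 0" using \<epsilon> by (simp add: r_def)
    obtain d where d: "d > 0" "\<And>u. \<bar>u\<bar> < d \<Longrightarrow> norm (?\<phi> u - ?g u) \<le> r * u\<^sup>2"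
      using char_minus_gaussian_little_o[OF r] by blast
    have "(\<lambda>n. \<bar>t\<bar> * c n) \<longlonglongrightarrow> 0" using small(2) by (rule tendsto_mult_right_zero)
    then have "\<forall>\<^sub>F n in sequentially. \<bar>t\<bar> * c n < d"
      using d(1) by (rule order_tendstoD(2))
    moreover have "\<forall>\<^sub>F n in sequentially. (\<Sum>i\<in>I n. (w n i)\<^sup>2) < s + 1"
      using sq by (rule order_tendstoD(2)) simp
    ultimately have "\<forall>\<^sub>F n in sequentially. norm ((\<Prod>i\<in>I n. ?\<phi> (t * w n i)) - (\<Prod>i\<in>I n. ?g (t * w n i)) - 0) < \<epsilon>"
    proof eventually_elim
      case (elim n)
      have "norm ((\<Prod>i\<in>I n. ?\<phi> (t * w n i)) - (\<Prod>i\<in>I n. ?g (t * w n i))) \<le> (\<Sum>i\<in>I n. norm (?\<phi> (t * w n i) - ?g (t * w n i)))"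
        using \<sigma>2_nonneg by (intro norm_prod_diff D.cmod_char_le_1) auto
      also have "\<dots> \<le> (\<Sum>i\<in>I n. r * (t * w n i)\<^sup>2)"
      proof (intro sum_mono d(2))
        fix i assume "i \<in> I n"
        then have "\<bar>t * w n i\<bar> \<le> \<bar>t\<bar> * c n" using small(1) by (simp add: abs_mult mult_left_mono)
        then show "\<bar>t * w n i\<bar> < d" using elim by simp
      qed
      also have "\<dots> = r * t\<^sup>2 * (\<Sum>i\<in>I n. (w n i)\<^sup>2)"
        by (simp add: sum_distrib_left power_mult_distrib mult.assoc)
      also have "\<dots> \<le> r * t\<^sup>2 * (s + 1)"
        using elim r by (intro mult_left_mono) auto
      also have "\<dots> < r * (t\<^sup>2 * (s + 1) + 1)" using r by (simp add: algebra_simps)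
      also have "\<dots> = \<epsilon>" using den by (simp add: r_def)
      finally show ?case by simp
    qed
    then show "\<exists>no. \<forall>n\<ge>no. norm ((\<Prod>i\<in>I n. ?\<phi> (t * w n i)) - (\<Prod>i\<in>I n. ?g (t * w n i)) - 0) < \<epsilon>"
      by (simp add: eventually_sequentially)
  qed
  moreover have "(\<lambda>n. \<Prod>i\<in>I n. ?g (t * w n i)) \<longlonglongrightarrow> ?g (t * sqrt s)"
    unfolding prod_g by (intro tendsto_intros sq) auto
  ultimately have "(\<lambda>n. \<Prod>i\<in>I n. ?\<phi> (t * w n i)) \<longlonglongrightarrow> ?g (t * sqrt s)"
    using tendsto_add by fastforce
  moreover have "?g (t * sqrt s) = char (normal_distribution 0 (s * \<sigma>2)) t"
    unfolding char_normal_distribution[OF s\<sigma>]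
    using s by (simp add: power_mult_distrib mult.commute mult.left_commute)
  ultimately show "(\<lambda>n. char (distr M borel (\<lambda>\<omega>. \<Sum>i\<in>I n. w n i * e i \<omega>)) t) \<longlonglongrightarrow> char (normal_distribution 0 (s * \<sigma>2)) t"
    by (simp add: char_eq)
qed

end

text \<open>A first moment must suffice, because the law is applied to squares of innovations. Truncate at \<open>K\<close>: the
  truncated variables have a variance, and the remainder is small in \<open>L\<^sup>1\<close> uniformly in \<open>n\<close>.\<close>
theorem (in prob_space) weak_law_of_large_numbers:
  fixes Y :: "nat \<Rightarrow> 'a \<Rightarrow> real"
  assumes indep: "indep_vars (\<lambda>_. borel) Y UNIV"
    and ident: "\<And>i. distr M borel (Y i) = distr M borel (Y 0)"
    and int: "integrable M (Y 0)"
  shows "(\<lambda>n. expectation (\<lambda>\<omega>. \<bar>(\<Sum>i<n. Y i \<omega>) / n - expectation (Y 0)\<bar>)) \<longlonglongrightarrow> 0"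
proof (rule LIMSEQ_I)
  fix \<epsilon> :: real assume \<epsilon>: "\<epsilon> > 0"
  have [measurable]: "Y i \<in> borel_measurable M" for i
    using indep unfolding indep_vars_def2 by simp
  define f where "f K y = (if \<bar>y\<bar> \<le> real K then y else 0)" for K :: nat and y :: real
  have [measurable]: "f K \<in> borel_measurable borel" for K unfolding f_def by measurable
  have fK: "\<bar>f K y\<bar> \<le> real K" "\<bar>y - f K y\<bar> \<le> \<bar>y\<bar>" for K y by (auto simp: f_def)
  have meas: "Y i \<in> borel_measurable M" for i by simp
  have intY: "integrable M (Y i)" for i
    using integrable_cong_distr[OF meas meas ident, of "\<lambda>x. x" i] int by simp
  have E_ident: "expectation (\<lambda>\<omega>. h (Y i \<omega>)) = expectation (\<lambda>\<omega>. h (Y 0 \<omega>))"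
    if "h \<in> borel_measurable borel" for h :: "real \<Rightarrow> real" and i
    by (rule expectation_cong_distr[OF meas meas ident that])
  have "(\<lambda>K. \<bar>y - f K y\<bar>) \<longlonglongrightarrow> 0" for y
  proof (rule tendsto_eventually)
    obtain K0 :: nat where "\<bar>y\<bar> \<le> real K0" using real_arch_simple by blast
    then show "\<forall>\<^sub>F K in sequentially. \<bar>y - f K y\<bar> = 0"
      by (intro eventually_sequentiallyI[of K0]) (auto simp: f_def)
  qed
  then have "(\<lambda>K. expectation (\<lambda>\<omega>. \<bar>Y 0 \<omega> - f K (Y 0 \<omega>)\<bar>)) \<longlonglongrightarrow> expectation (\<lambda>\<omega>. 0)"
    by (intro integral_dominated_convergence[where w="\<lambda>\<omega>. \<bar>Y 0 \<omega>\<bar>"]) (use int fK in auto)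
  then have "\<forall>\<^sub>F K in sequentially. expectation (\<lambda>\<omega>. \<bar>Y 0 \<omega> - f K (Y 0 \<omega>)\<bar>) < \<epsilon> / 4"
    using \<epsilon> by (intro order_tendstoD(2)) auto
  then obtain K where K: "expectation (\<lambda>\<omega>. \<bar>Y 0 \<omega> - f K (Y 0 \<omega>)\<bar>) < \<epsilon> / 4"
    by (auto simp: eventually_sequentially)
  define m where "m = expectation (\<lambda>\<omega>. f K (Y 0 \<omega>))"
  define e where "e i \<omega> = f K (Y i \<omega>) - m" for i \<omega>
  have int_f: "integrable M (\<lambda>\<omega>. f K (Y i \<omega>))" for i
    by (rule integrable_const_bound[of _ K]) (auto simp: fK)
  have [measurable]: "e i \<in> borel_measurable M" for i unfolding e_def by measurable
  interpret e: centered_iid M e "expectation (\<lambda>\<omega>. (e 0 \<omega>)\<^sup>2)"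
  proof unfold_locales
    show "indep_vars (\<lambda>_. borel) e UNIV"
      unfolding e_def by (rule indep_vars_compose2[OF indep]) auto
    have "distr M borel (e i) = distr (distr M borel (Y i)) borel (\<lambda>y. f K y - m)" for i
      by (subst distr_distr) (auto simp: e_def[abs_def] comp_def)
    then show "distr M borel (e i) = distr M borel (e 0)" for i
      by (metis ident)
    show "integrable M (\<lambda>\<omega>. (e 0 \<omega>)\<^sup>2)"
    proof (rule integrable_const_bound[of _ "(real K + \<bar>m\<bar>)\<^sup>2"])
      have "\<bar>f K y - m\<bar> \<le> real K + \<bar>m\<bar>" for y using fK(1)[of K y] by linarith
      then show "AE \<omega> in M. norm ((e 0 \<omega>)\<^sup>2) \<le> (real K + \<bar>m\<bar>)\<^sup>2"
        by (intro AE_I2) (auto simp: e_def abs_le_square_iff[symmetric])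
    qed auto
    show "expectation (e 0) = 0"
      using int_f[of 0] by (simp add: e_def[abs_def] m_def prob_space)
  qed simp
  define v where "v = expectation (\<lambda>\<omega>. (e 0 \<omega>)\<^sup>2)"
  have v: "v \<ge> 0" by (simp add: v_def)
  have bound: "expectation (\<lambda>\<omega>. \<bar>(\<Sum>i<n. Y i \<omega>) / n - expectation (Y 0)\<bar>) < (v + 1) / 2 * (1 / sqrt n) + \<epsilon> / 2"
    if n: "n > 0" for n
  proof -
    let ?Z = "\<lambda>\<omega>. \<Sum>i<n. 1 / n * e i \<omega>"
    let ?R = "\<lambda>i \<omega>. \<bar>Y i \<omega> - f K (Y i \<omega>)\<bar>"
    let ?\<rho> = "expectation (?R 0)"
    have intR: "integrable M (?R i)" for i
      using intY int_f by auto
    have "expectation (\<lambda>\<omega>. \<bar>?Z \<omega>\<bar>) \<le> (sqrt n * (v * (\<Sum>i<n. (1 / n)\<^sup>2)) + 1 / sqrt n) / 2"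
      using expectation_abs_le_L2[of ?Z "sqrt n"] e.weighted_sum_second_moment[of "{..<n}" "\<lambda>_. 1 / n"] n
      by (simp add: v_def)
    also have "\<dots> = (v + 1) / 2 * (1 / sqrt n)"
      using n by (simp add: field_simps power2_eq_square)
    finally have 1: "expectation (\<lambda>\<omega>. \<bar>?Z \<omega>\<bar>) \<le> (v + 1) / 2 * (1 / sqrt n)" .
    have diff: "\<bar>m - expectation (Y 0)\<bar> \<le> ?\<rho>"
    proof -
      have "expectation (Y 0) - m = expectation (\<lambda>\<omega>. Y 0 \<omega> - f K (Y 0 \<omega>))"
        unfolding m_def using int int_f by simp
      also have "\<bar>\<dots>\<bar> \<le> ?\<rho>" by (rule integral_abs_bound)
      finally show ?thesis by simp
    qed
    have pw: "\<bar>(\<Sum>i<n. Y i \<omega>) / n - expectation (Y 0)\<bar> \<le> \<bar>?Z \<omega>\<bar> + (\<Sum>i<n. 1 / n * ?R i \<omega>) + ?\<rho>" for \<omega>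
    proof -
      have "(\<Sum>i<n. Y i \<omega>) / n - expectation (Y 0) = ?Z \<omega> + (\<Sum>i<n. 1 / n * (Y i \<omega> - f K (Y i \<omega>))) + (m - expectation (Y 0))"
      proof -
        have "?Z \<omega> = (\<Sum>i<n. 1 / n * f K (Y i \<omega>)) - m"
          using n by (simp add: e_def right_diff_distrib sum_subtractf)
        moreover have "(\<Sum>i<n. 1 / n * (Y i \<omega> - f K (Y i \<omega>))) = (\<Sum>i<n. Y i \<omega>) / n - (\<Sum>i<n. 1 / n * f K (Y i \<omega>))"
          by (simp add: right_diff_distrib sum_subtractf sum_divide_distrib diff_divide_distrib)
        ultimately show ?thesis by simp
      qed
      also have "\<bar>\<dots>\<bar> \<le> \<bar>?Z \<omega>\<bar> + \<bar>\<Sum>i<n. 1 / n * (Y i \<omega> - f K (Y i \<omega>))\<bar> + \<bar>m - expectation (Y 0)\<bar>"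
        by linarith
      also have "\<bar>\<Sum>i<n. 1 / n * (Y i \<omega> - f K (Y i \<omega>))\<bar> \<le> (\<Sum>i<n. 1 / n * ?R i \<omega>)"
        by (rule order_trans[OF sum_abs]) (simp add: abs_mult)
      finally show ?thesis using diff by linarith
    qed
    have intZ: "integrable M (\<lambda>\<omega>. \<bar>?Z \<omega>\<bar>)"
      by (intro integrable_abs Bochner_Integration.integrable_sum integrable_mult_right e.int1)
    have "expectation (\<lambda>\<omega>. \<bar>(\<Sum>i<n. Y i \<omega>) / n - expectation (Y 0)\<bar>) \<le> expectation (\<lambda>\<omega>. \<bar>?Z \<omega>\<bar> + (\<Sum>i<n. 1 / n * ?R i \<omega>) + ?\<rho>)"
      by (rule integral_mono[OF _ _ pw]) (use intY intR intZ in auto)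
    also have "\<dots> = expectation (\<lambda>\<omega>. \<bar>?Z \<omega>\<bar>) + (\<Sum>i<n. 1 / n * expectation (?R i)) + ?\<rho>"
      using intR intZ by (simp add: prob_space)
    also have "(\<Sum>i<n. 1 / n * expectation (?R i)) = ?\<rho>"
    proof -
      have R: "expectation (?R i) = ?\<rho>" for i
        by (rule E_ident[of "\<lambda>y. \<bar>y - f K y\<bar>"]) measurable
      have "(\<Sum>i<n. 1 / n * expectation (?R i)) = (\<Sum>i<n. 1 / n * ?\<rho>)"
        by (intro sum.cong refl arg_cong[where f="\<lambda>z. 1 / real n * z"]) (rule R)
      also have "\<dots> = ?\<rho>" using n by simp
      finally show ?thesis .
    qed
    finally show ?thesis using 1 K by linarith
  qed
  have "(\<lambda>n. (v + 1) / 2 * (1 / sqrt n)) \<longlonglongrightarrow> 0"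
    by real_asymp
  then have "\<forall>\<^sub>F n in sequentially. (v + 1) / 2 * (1 / sqrt (real n)) < \<epsilon> / 2"
    using \<epsilon> by (intro order_tendstoD(2)) auto
  with eventually_gt_at_top[of 0]
  have "\<forall>\<^sub>F n in sequentially. norm (expectation (\<lambda>\<omega>. \<bar>(\<Sum>i<n. Y i \<omega>) / n - expectation (Y 0)\<bar>) - 0) < \<epsilon>"
  proof eventually_elim
    case (elim n)
    have "expectation (\<lambda>\<omega>. \<bar>(\<Sum>i<n. Y i \<omega>) / n - expectation (Y 0)\<bar>) \<ge> 0"
      by (rule integral_nonneg_AE) auto
    with bound[OF elim(1)] elim(2) show ?case by (simp only: diff_zero real_norm_def abs_of_nonneg)
  qed
  then show "\<exists>no. \<forall>n\<ge>no. norm (expectation (\<lambda>\<omega>. \<bar>(\<Sum>i<n. Y i \<omega>) / n - expectation (Y 0)\<bar>) - 0) < \<epsilon>"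
    by (simp only: eventually_sequentially)
qed

section \<open>Weak convergence of independent coordinates\<close>

lemma joint_law_eq_of_indep:
  assumes M: "prob_space M" and N: "prob_space N" and I: "I \<noteq> {}"
    and Z: "prob_space.indep_vars M (\<lambda>_. borel) Z I" and Y: "prob_space.indep_vars N (\<lambda>_. borel) Y I"
    and eq: "\<And>j. j \<in> I \<Longrightarrow> distr M borel (Z j) = distr N borel (Y j)"
  shows "distr M (PiM I (\<lambda>_. borel)) (\<lambda>\<omega>. \<lambda>j\<in>I. Z j \<omega>) = distr N (PiM I (\<lambda>_. borel)) (\<lambda>\<omega>. \<lambda>j\<in>I. Y j \<omega>)"
proof -
  interpret M: prob_space M by (rule M)
  interpret N: prob_space N by (rule N)
  have "distr M (PiM I (\<lambda>_. borel)) (\<lambda>\<omega>. \<lambda>j\<in>I. Z j \<omega>) = PiM I (\<lambda>j. distr M borel (Z j))"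
    using Z I by (subst M.indep_vars_iff_distr_eq_PiM'[symmetric]) (auto simp: M.indep_vars_def2)
  also have "\<dots> = PiM I (\<lambda>j. distr N borel (Y j))"
    by (rule PiM_cong[OF refl eq])
  also have "\<dots> = distr N (PiM I (\<lambda>_. borel)) (\<lambda>\<omega>. \<lambda>j\<in>I. Y j \<omega>)"
    using Y I by (intro sym[OF iffD1[OF N.indep_vars_iff_distr_eq_PiM']]) (auto simp: N.indep_vars_def2)
  finally show ?thesis .
qed

lemma indep_vars_PiM_components:
  assumes \<Omega>: "\<And>j. j \<in> I \<Longrightarrow> prob_space (\<Omega> j)" and I: "I \<noteq> {}"
  shows "prob_space.indep_vars (PiM I \<Omega>) \<Omega> (\<lambda>j x. x j) I"
proof -
  interpret P: prob_space "PiM I \<Omega>" by (rule prob_space_PiM[OF \<Omega>])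
  have "distr (PiM I \<Omega>) (PiM I \<Omega>) (\<lambda>x. \<lambda>j\<in>I. x j) = distr (PiM I \<Omega>) (PiM I \<Omega>) (\<lambda>x. x)"
    by (intro distr_cong) (auto simp: space_PiM PiE_def extensional_restrict)
  also have "\<dots> = PiM I \<Omega>" by (rule distr_id2) simp
  also have "\<dots> = PiM I (\<lambda>j. distr (PiM I \<Omega>) (\<Omega> j) (\<lambda>x. x j))"
    by (intro PiM_cong refl distr_PiM_component[symmetric] \<Omega>)
  finally show ?thesis
    using I by (subst P.indep_vars_iff_distr_eq_PiM') auto
qed

text \<open>Each coordinate has, by Skorohod's theorem, a copy that converges pointwise. On the product of the
  underlying spaces the copies are independent, hence have the right joint law, and
  dominated convergence applies.\<close>
theorem indep_weak_conv_expectation: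
  fixes Z :: "nat \<Rightarrow> nat \<Rightarrow> 'a \<Rightarrow> real" and Y :: "nat \<Rightarrow> 'b \<Rightarrow> real" and f :: "(nat \<Rightarrow> real) \<Rightarrow> complex"
  assumes M: "prob_space M" and N: "prob_space N"
    and Z: "\<And>n. prob_space.indep_vars M (\<lambda>_. borel) (Z n) {..<r}"
    and Y: "prob_space.indep_vars N (\<lambda>_. borel) Y {..<r}"
    and weak: "\<And>j. j < r \<Longrightarrow> weak_conv_m (\<lambda>n. distr M borel (Z n j)) (distr N borel (Y j))"
    and meas: "f \<in> borel_measurable (PiM {..<r} (\<lambda>_. borel))" and bnd: "\<And>x. norm (f x) \<le> B"
    and cont: "\<And>x y. (\<And>j. j < r \<Longrightarrow> (\<lambda>n. x n j) \<longlonglongrightarrow> y j) \<Longrightarrow> (\<lambda>n. f (x n)) \<longlonglongrightarrow> f y"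
    and r: "r > 0"
  shows "(\<lambda>n. CLINT \<omega>|M. f (\<lambda>j\<in>{..<r}. Z n j \<omega>)) \<longlonglongrightarrow> (CLINT \<omega>|N. f (\<lambda>j\<in>{..<r}. Y j \<omega>))"
proof -
  interpret M: prob_space M by (rule M)
  interpret N: prob_space N by (rule N)
  note [measurable] = meas
  let ?I = "{..<r}"
  have Zm: "Z n j \<in> borel_measurable M" if "j < r" for n j
    using Z[of n] that by (auto simp: M.indep_vars_def2)
  have Ym: "Y j \<in> borel_measurable N" if "j < r" for j
    using Y that by (auto simp: N.indep_vars_def2)
  define Q where "Q j \<Omega> U V \<longleftrightarrow> prob_space \<Omega> \<and> (\<forall>n. U n \<in> borel_measurable \<Omega>) \<and>
      (\<forall>n. distr \<Omega> borel (U n) = distr M borel (Z n j)) \<and> V \<in> borel_measurable \<Omega> \<and>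
      distr \<Omega> borel V = distr N borel (Y j) \<and> (\<forall>x\<in>space \<Omega>. (\<lambda>n. U n x) \<longlonglongrightarrow> V x)"
    for j :: nat and \<Omega> :: "real measure" and U V
  have "\<exists>\<Omega> U V. Q j \<Omega> U V" if "j < r" for j
  proof -
    have "\<exists>\<Omega> U V. prob_space (\<Omega> :: real measure) \<and> (\<forall>n. U n \<in> borel_measurable \<Omega>) \<and>
      (\<forall>n. distr \<Omega> borel (U n) = distr M borel (Z n j)) \<and> V \<in> measurable \<Omega> lborel \<and>
      distr \<Omega> borel V = distr N borel (Y j) \<and> (\<forall>x\<in>space \<Omega>. (\<lambda>n. U n x) \<longlonglongrightarrow> V x)"
      by (rule Skorohod[OF _ _ weak[OF that]]) (use that Zm Ym in auto)
    then show ?thesis by (simp add: Q_def)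
  qed
  then obtain \<Omega> U V where Q: "\<And>j. j < r \<Longrightarrow> Q j (\<Omega> j) (U j) (V j)"
    by metis
  have UV:
    "\<And>j. j < r \<Longrightarrow> prob_space (\<Omega> j)"
    "\<And>j n. j < r \<Longrightarrow> U j n \<in> borel_measurable (\<Omega> j)"
    "\<And>j n. j < r \<Longrightarrow> distr (\<Omega> j) borel (U j n) = distr M borel (Z n j)"
    "\<And>j. j < r \<Longrightarrow> V j \<in> borel_measurable (\<Omega> j)"
    "\<And>j. j < r \<Longrightarrow> distr (\<Omega> j) borel (V j) = distr N borel (Y j)"
    "\<And>j x. j < r \<Longrightarrow> x \<in> space (\<Omega> j) \<Longrightarrow> (\<lambda>n. U j n x) \<longlonglongrightarrow> V j x"
    using Q unfolding Q_def by blast+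
  let ?P = "PiM ?I \<Omega>"
  interpret P: prob_space ?P by (rule prob_space_PiM) (use UV in auto)
  have comp: "P.indep_vars \<Omega> (\<lambda>j x. x j) ?I"
    by (rule indep_vars_PiM_components) (use UV r in \<open>auto simp: lessThan_empty_iff\<close>)
  have indep: "P.indep_vars (\<lambda>_. borel) (\<lambda>j x. T j (x j)) ?I"
    if "\<And>j. j < r \<Longrightarrow> T j \<in> borel_measurable (\<Omega> j)" for T :: "nat \<Rightarrow> real \<Rightarrow> real"
    by (rule P.indep_vars_compose2[OF comp]) (use that in auto)
  have marginal: "distr ?P borel (\<lambda>x. T (x j)) = distr (\<Omega> j) borel T"
    if "j < r" "T \<in> borel_measurable (\<Omega> j)" for T :: "real \<Rightarrow> real" and j
  proof -
    have "distr (distr ?P (\<Omega> j) (\<lambda>x. x j)) borel T = distr ?P borel (\<lambda>x. T (x j))"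
      by (subst distr_distr) (use that in \<open>auto simp: comp_def\<close>)
    also have "distr ?P (\<Omega> j) (\<lambda>x. x j) = \<Omega> j"
      by (rule distr_PiM_component) (use UV that in auto)
    finally show ?thesis by simp
  qed
  have transfer: "(CLINT \<omega>|L. f (\<lambda>j\<in>?I. A j \<omega>)) = (CLINT x|?P. f (\<lambda>j\<in>?I. T j (x j)))"
    if L: "prob_space L" and A: "prob_space.indep_vars L (\<lambda>_. borel) A ?I"
      and Am: "\<And>j. j < r \<Longrightarrow> A j \<in> borel_measurable L"
      and T: "\<And>j. j < r \<Longrightarrow> T j \<in> borel_measurable (\<Omega> j)"
      and eq: "\<And>j. j < r \<Longrightarrow> distr (\<Omega> j) borel (T j) = distr L borel (A j)"
    for L :: "'z measure" and A :: "nat \<Rightarrow> 'z \<Rightarrow> real" and T :: "nat \<Rightarrow> real \<Rightarrow> real"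
  proof -
    have law: "distr L (PiM ?I (\<lambda>_. borel)) (\<lambda>\<omega>. \<lambda>j\<in>?I. A j \<omega>) = distr ?P (PiM ?I (\<lambda>_. borel)) (\<lambda>x. \<lambda>j\<in>?I. T j (x j))"
      by (rule joint_law_eq_of_indep[OF L P.prob_space_axioms _ A indep])
         (use r T marginal eq in \<open>auto simp: lessThan_empty_iff\<close>)
    have Tm: "(\<lambda>x. T j (x j)) \<in> borel_measurable ?P" if "j < r" for j
      using T that by (intro measurable_compose[OF measurable_component_singleton]) auto
    have "(CLINT \<omega>|L. f (\<lambda>j\<in>?I. A j \<omega>)) = integral\<^sup>L (distr L (PiM ?I (\<lambda>_. borel)) (\<lambda>\<omega>. \<lambda>j\<in>?I. A j \<omega>)) f"
      by (rule integral_distr[symmetric], rule measurable_restrict) (use Am meas in auto)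
    also have "\<dots> = (CLINT x|?P. f (\<lambda>j\<in>?I. T j (x j)))"
      unfolding law by (rule integral_distr, rule measurable_restrict) (use Tm meas in auto)
    finally show ?thesis .
  qed
  have fm: "(\<lambda>x. f (\<lambda>j\<in>?I. T j (x j))) \<in> borel_measurable ?P"
    if "\<And>j. j < r \<Longrightarrow> T j \<in> borel_measurable (\<Omega> j)" for T :: "nat \<Rightarrow> real \<Rightarrow> real"
  proof (rule measurable_compose[OF _ meas], rule measurable_restrict)
    fix j assume "j \<in> ?I"
    then show "(\<lambda>x. T j (x j)) \<in> borel_measurable ?P"
      using that by (intro measurable_compose[OF measurable_component_singleton]) auto
  qed
  have "(\<lambda>n. CLINT x|?P. f (\<lambda>j\<in>?I. U j n (x j))) \<longlonglongrightarrow> (CLINT x|?P. f (\<lambda>j\<in>?I. V j (x j)))"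
  proof (rule integral_dominated_convergence[where w="\<lambda>_. B"])
    show "AE x in ?P. (\<lambda>n. f (\<lambda>j\<in>?I. U j n (x j))) \<longlonglongrightarrow> f (\<lambda>j\<in>?I. V j (x j))"
      by (intro AE_I2 cont) (use UV(6) in \<open>auto simp: space_PiM\<close>)
  qed (use bnd fm UV in auto)
  moreover have "(CLINT \<omega>|M. f (\<lambda>j\<in>?I. Z n j \<omega>)) = (CLINT x|?P. f (\<lambda>j\<in>?I. U j n (x j)))" for n
    by (rule transfer[OF M Z Zm]) (use UV in auto)
  moreover have "(CLINT \<omega>|N. f (\<lambda>j\<in>?I. Y j \<omega>)) = (CLINT x|?P. f (\<lambda>j\<in>?I. V j (x j)))"
    by (rule transfer[OF N Y Ym]) (use UV in auto)
  ultimately show ?thesis by simp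
qed

section \<open>Quadratic functionals of a signed random walk\<close>

lemma riemann_sum_tendsto:
  fixes g :: "real \<Rightarrow> real"
  assumes cont: "continuous_on {0..1} g"
  shows "(\<lambda>r. (\<Sum>j<r. g (real j / real r)) / real r) \<longlonglongrightarrow> integral {0..1} g"
proof (rule LIMSEQ_I)
  fix \<epsilon> :: real assume \<epsilon>: "\<epsilon> > 0"
  have "uniformly_continuous_on {0..1} g"
    by (rule compact_uniformly_continuous[OF cont]) simp
  then obtain d where d: "d > 0" "\<And>x y. x \<in> {0..1} \<Longrightarrow> y \<in> {0..1} \<Longrightarrow> dist y x < d \<Longrightarrow> dist (g y) (g x) < \<epsilon> / 2"
    unfolding uniformly_continuous_on_def using half_gt_zero[OF \<epsilon>] by metis
  obtain R :: nat where R: "1 / d < real R" using reals_Archimedean2 by blast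
  have "norm ((\<Sum>j<r. g (real j / real r)) / real r - integral {0..1} g) < \<epsilon>" if "r \<ge> R" for r
  proof -
    have "real R > 0" using R d(1) by (metis less_trans zero_less_divide_1_iff)
    then have r: "real r > 0" and rd: "1 / d < real r" using that R by auto
    have rd': "1 / real r < d" using rd r d(1) by (simp add: field_simps)
    have sub: "{real j / real r..real k / real r} \<subseteq> {0..1}" if "k \<le> r" for j k
      using that r by (auto simp: divide_le_eq intro: order_trans[of 0 "real j / real r"] order_trans[of _ "real k / real r"])
    have int: "g integrable_on {real j / real r..real k / real r}" if "k \<le> r" for j k
      by (rule integrable_continuous_real[OF continuous_on_subset[OF cont sub[OF that]]])
    have split: "integral {0..real k / real r} g = (\<Sum>j<k. integral {real j / real r..real (Suc j) / real r} g)" if "k \<le> r" for k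
      using that
    proof (induction k)
      case (Suc k)
      have "integral {0..real k / real r} g + integral {real k / real r..real (Suc k) / real r} g = integral {0..real (Suc k) / real r} g"
        by (rule Henstock_Kurzweil_Integration.integral_combine) (use r int[of "Suc k" 0] Suc.prems in \<open>auto simp: divide_right_mono\<close>)
      then show ?case using Suc by simp
    qed simp
    have local: "\<bar>g (real j / real r) / real r - integral {real j / real r..real (Suc j) / real r} g\<bar> \<le> \<epsilon> / 2 / real r" if j: "j < r" for j
    proof -
      let ?a = "real j / real r" and ?b = "real (Suc j) / real r"
      have len: "?b - ?a = 1 / real r" using r by (simp add: field_simps)
      have ab: "?a \<le> ?b" by (simp add: divide_right_mono)
      have "((\<lambda>x. g x - g ?a) has_integral (integral {?a..?b} g - (?b - ?a) *\<^sub>R g ?a)) {?a..?b}"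
        using int[of "Suc j" j] j ab has_integral_const_real[of "g ?a" ?a ?b]
        by (intro has_integral_diff integrable_integral) auto
      then have "norm (integral {?a..?b} g - (?b - ?a) *\<^sub>R g ?a) \<le> \<epsilon> / 2 * measure lborel {?a..?b}"
      proof (rule has_integral_bound_real[where S="{}", rotated 2])
        fix x assume x: "x \<in> {?a..?b} - {}"
        have "x \<in> {0..1}" "?a \<in> {0..1}"
          by (rule subsetD[OF sub[of "Suc j" j]], use j x ab in simp, use x ab in simp)+
        moreover have "dist x ?a < d" using x len rd' by (auto simp: dist_real_def)
        ultimately show "norm (g x - g ?a) \<le> \<epsilon> / 2" using d(2)[of ?a x] by (simp add: dist_real_def less_imp_le)
      qed (use \<epsilon> in auto)
      then show ?thesis using len ab by (simp add: abs_minus_commute)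
    qed
    have "(\<Sum>j<r. g (real j / real r)) / real r - integral {0..1} g = (\<Sum>j<r. g (real j / real r) / real r - integral {real j / real r..real (Suc j) / real r} g)"
      using split[of r] r by (simp add: sum_subtractf sum_divide_distrib)
    also have "\<bar>\<dots>\<bar> \<le> (\<Sum>j<r. \<bar>g (real j / real r) / real r - integral {real j / real r..real (Suc j) / real r} g\<bar>)"
      by (rule sum_abs)
    also have "\<dots> \<le> (\<Sum>j<r. \<epsilon> / 2 / real r)"
      by (intro sum_mono local) auto
    also have "\<dots> = \<epsilon> / 2" using r by simp
    finally show ?thesis using \<epsilon> by simp
  qed
  then show "\<exists>no. \<forall>n\<ge>no. norm ((\<Sum>j<n. g (real j / real n)) / real n - integral {0..1} g) < \<epsilon>"
    by blast
qed

context wiener_process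
begin

abbreviation sq_int :: "'b \<Rightarrow> real" where
  "sq_int \<omega> \<equiv> LINT t:{0..1}|lborel. (W t \<omega>)\<^sup>2"

lemma W_continuous_unit: "\<omega> \<in> space N \<Longrightarrow> continuous_on {0..1} (\<lambda>t. W t \<omega>)"
  by (rule continuous_on_subset[OF W_continuous]) auto

lemma sq_int_eq: "\<omega> \<in> space N \<Longrightarrow> sq_int \<omega> = integral {0..1} (\<lambda>t. (W t \<omega>)\<^sup>2)"
  by (intro set_borel_integral_eq_integral borel_integrable_atLeastAtMost' continuous_intros W_continuous_unit)

lemma riemann_sum_sq_int:
  "\<omega> \<in> space N \<Longrightarrow> (\<lambda>r. (\<Sum>j<r. (W (real j / real r) \<omega>)\<^sup>2) / real r) \<longlonglongrightarrow> sq_int \<omega>"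
  unfolding sq_int_eq by (intro riemann_sum_tendsto continuous_intros W_continuous_unit)

lemma W_meas[measurable]: "0 \<le> t \<Longrightarrow> W t \<in> borel_measurable N"
  by (rule W_measurable)

lemma sq_int_meas[measurable]: "sq_int \<in> borel_measurable N"
  by (rule borel_measurable_LIMSEQ_real[OF riemann_sum_sq_int]) measurable

end

lemma (in prob_space) norm_char_diff_le:
  fixes X Y :: "'a \<Rightarrow> real"
  assumes [measurable]: "X \<in> borel_measurable M" "Y \<in> borel_measurable M"
    and int: "integrable M (\<lambda>\<omega>. X \<omega> - Y \<omega>)"
  shows "norm ((CLINT \<omega>|M. iexp (t * X \<omega>)) - (CLINT \<omega>|M. iexp (t * Y \<omega>))) \<le> \<bar>t\<bar> * expectation (\<lambda>\<omega>. \<bar>X \<omega> - Y \<omega>\<bar>)"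
proof -
  have pw: "norm (iexp (t * x) - iexp (t * y)) \<le> \<bar>t\<bar> * \<bar>x - y\<bar>" for x y
  proof -
    have "iexp (t * x) - iexp (t * y) = iexp (t * y) * (iexp (t * (x - y)) - 1)"
      by (simp add: algebra_simps flip: exp_add)
    then have "norm (iexp (t * x) - iexp (t * y)) = norm (iexp (t * (x - y)) - 1)"
      by (simp add: norm_mult)
    also have "\<dots> \<le> \<bar>t * (x - y)\<bar>"
      using iexp_approx1[of "t * (x - y)" 0] by simp
    finally show ?thesis by (simp add: abs_mult)
  qed
  have i: "integrable M (\<lambda>\<omega>. iexp (t * U \<omega>))" if [measurable]: "U \<in> borel_measurable M" for U :: "'a \<Rightarrow> real"
    by (rule integrable_const_bound[of _ 1]) auto
  have "(CLINT \<omega>|M. iexp (t * X \<omega>)) - (CLINT \<omega>|M. iexp (t * Y \<omega>)) = (CLINT \<omega>|M. iexp (t * X \<omega>) - iexp (t * Y \<omega>))"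
    by (rule Bochner_Integration.integral_diff[symmetric]) (intro i assms)+
  also have "norm \<dots> \<le> expectation (\<lambda>\<omega>. norm (iexp (t * X \<omega>) - iexp (t * Y \<omega>)))"
    by (rule integral_norm_bound)
  also have "\<dots> \<le> expectation (\<lambda>\<omega>. \<bar>t\<bar> * \<bar>X \<omega> - Y \<omega>\<bar>)"
    by (rule integral_mono[OF _ _ pw]) (auto intro!: integrable_norm Bochner_Integration.integrable_diff i integrable_mult_right integrable_abs int simp del: of_real_mult)
  finally show ?thesis by simp
qed

text \<open>Signs are kept general because two walks are needed: the plain partial sums of the
  innovations, and their alternating partial sums.\<close>
locale signed_walk = centered_iid +
  fixes s :: "nat \<Rightarrow> real"
  assumes sign: "\<And>i. (s i)\<^sup>2 = 1"
begin

definition T :: "nat \<Rightarrow> 'a \<Rightarrow> real" where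
  "T n \<omega> = (\<Sum>i<n. s i * e i \<omega>)"

lemma T_meas[measurable]: "T n \<in> borel_measurable M"
  unfolding T_def[abs_def] by measurable

lemma T_diff: "a \<le> b \<Longrightarrow> T b \<omega> - T a \<omega> = (\<Sum>i\<in>{a..<b}. s i * e i \<omega>)"
  unfolding T_def by (simp add: lessThan_atLeast0 sum_diff_nat_ivl)

lemma T_increment_second_moment:
  assumes "a \<le> b"
  shows "integrable M (\<lambda>\<omega>. (T b \<omega> - T a \<omega>)\<^sup>2)"
    and "expectation (\<lambda>\<omega>. (T b \<omega> - T a \<omega>)\<^sup>2) = \<sigma>2 * (real b - real a)"
  using weighted_sum_second_moment[of "{a..<b}" s] assms by (simp_all add: T_diff sign of_nat_diff)

lemma T_second_moment:
  shows "integrable M (\<lambda>\<omega>. (T n \<omega>)\<^sup>2)" and "expectation (\<lambda>\<omega>. (T n \<omega>)\<^sup>2) = \<sigma>2 * real n"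
  using weighted_sum_second_moment[of "{..<n}" s] by (simp_all add: T_def sign)

lemma T_integrable: "integrable M (T n)"
  by (rule square_integrable_imp_integrable[OF T_meas T_second_moment(1)])

text \<open>\<open>\<bar>x\<^sup>2 - y\<^sup>2\<bar> = \<bar>x - y\<bar> * \<bar>x + y\<bar>\<close>, where the first factor is small and the second is not; \<open>c\<close>
  balances their second moments. It will be the square root of the number of blocks.\<close>
lemma expectation_T_sq_diff_le:
  assumes ab: "a \<le> b" and bn: "b \<le> n" and c: "c > 0"
  shows "expectation (\<lambda>\<omega>. \<bar>(T b \<omega>)\<^sup>2 - (T a \<omega>)\<^sup>2\<bar>) \<le> \<sigma>2 * (c * (real b - real a) + 4 * real n / c) / 2"
proof -
  have pw: "\<bar>x\<^sup>2 - y\<^sup>2\<bar> \<le> (c * (x - y)\<^sup>2 + (2 * x\<^sup>2 + 2 * y\<^sup>2) / c) / 2" for x y :: real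
  proof -
    have "0 \<le> (c * \<bar>x - y\<bar> - \<bar>x + y\<bar>)\<^sup>2 / c" using c by simp
    also have "\<dots> = c * (x - y)\<^sup>2 + (x + y)\<^sup>2 / c - 2 * (\<bar>x - y\<bar> * \<bar>x + y\<bar>)"
      using c by (simp add: power2_diff[of "c * _"] power_mult_distrib field_simps power2_eq_square[of c])
    also have "\<bar>x - y\<bar> * \<bar>x + y\<bar> = \<bar>x\<^sup>2 - y\<^sup>2\<bar>"
      by (simp add: abs_mult[symmetric] power2_eq_square algebra_simps)
    finally have "\<bar>x\<^sup>2 - y\<^sup>2\<bar> \<le> (c * (x - y)\<^sup>2 + (x + y)\<^sup>2 / c) / 2" by simp
    also have "(x + y)\<^sup>2 \<le> 2 * x\<^sup>2 + 2 * y\<^sup>2"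
      using zero_le_power2[of "x - y"] by (simp add: power2_eq_square algebra_simps)
    finally show ?thesis using c by (simp add: divide_right_mono)
  qed
  have "expectation (\<lambda>\<omega>. \<bar>(T b \<omega>)\<^sup>2 - (T a \<omega>)\<^sup>2\<bar>) \<le> expectation (\<lambda>\<omega>. (c * (T b \<omega> - T a \<omega>)\<^sup>2 + (2 * (T b \<omega>)\<^sup>2 + 2 * (T a \<omega>)\<^sup>2) / c) / 2)"
    by (rule integral_mono[OF _ _ pw])
       (intro integrable_abs Bochner_Integration.integrable_diff Bochner_Integration.integrable_add integrable_mult_right integrable_divide T_second_moment T_increment_second_moment ab)+
  also have "\<dots> = (c * (\<sigma>2 * (real b - real a)) + (2 * (\<sigma>2 * real b) + 2 * (\<sigma>2 * real a)) / c) / 2"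
    using T_second_moment T_increment_second_moment[OF ab] by simp
  also have "\<dots> \<le> (c * (\<sigma>2 * (real b - real a)) + (2 * (\<sigma>2 * real n) + 2 * (\<sigma>2 * real n)) / c) / 2"
    using ab bn c \<sigma>2_nonneg by (intro divide_right_mono add_mono mult_left_mono) auto
  also have "\<dots> = \<sigma>2 * (c * (real b - real a) + 4 * real n / c) / 2"
    using c by (simp add: field_simps)
  finally show ?thesis .
qed

lemma block_variable_indep:
  fixes m :: "nat \<Rightarrow> nat"
  assumes mono: "\<And>i j. i \<le> j \<Longrightarrow> m i \<le> m j"
  shows "indep_vars (\<lambda>_. borel) (\<lambda>j \<omega>. (T (m (Suc j)) \<omega> - T (m j) \<omega>) / c) {..<r}"
proof -
  let ?K = "\<lambda>j. {m j..<m (Suc j)}"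
  have disj: "disjoint_family_on ?K {..<r}"
  proof (unfold disjoint_family_on_def, intro ballI impI)
    fix i j :: nat assume "i \<noteq> j"
    then show "?K i \<inter> ?K j = {}"
      using mono[of "Suc i" j] mono[of "Suc j" i] by (cases "i < j") (auto simp: not_less)
  qed
  have "indep_vars (\<lambda>j. PiM (?K j) (\<lambda>_. borel)) (\<lambda>j \<omega>. restrict (\<lambda>i. e i \<omega>) (?K j)) {..<r}"
    by (rule indep_vars_restrict[OF indep _ disj]) auto
  then have "indep_vars (\<lambda>_. borel) (\<lambda>j \<omega>. (\<Sum>i\<in>?K j. s i * restrict (\<lambda>i. e i \<omega>) (?K j) i) / c) {..<r}"
    by (rule indep_vars_compose2)
       (intro borel_measurable_divide borel_measurable_sum borel_measurable_times borel_measurable_const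
         measurable_component_singleton)
  moreover have "(\<Sum>i\<in>?K j. s i * restrict (\<lambda>i. e i \<omega>) (?K j) i) / c = (T (m (Suc j)) \<omega> - T (m j) \<omega>) / c" for j \<omega>
    using mono[of j "Suc j"] by (simp add: T_diff)
  ultimately show ?thesis by (simp only:)
qed

lemma sum_blocks:
  fixes m :: "nat \<Rightarrow> nat" and g :: "nat \<Rightarrow> real"
  assumes "m 0 = 0" "\<And>i j. i \<le> j \<Longrightarrow> m i \<le> m j"
  shows "(\<Sum>i<m r. g i) = (\<Sum>j<r. \<Sum>i\<in>{m j..<m (Suc j)}. g i)"
proof (induction r)
  case (Suc r)
  have "(\<Sum>i<m (Suc r). g i) = (\<Sum>i<m r. g i) + (\<Sum>i\<in>{m r..<m (Suc r)}. g i)"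
    using assms(2)[of r "Suc r"] by (simp add: lessThan_atLeast0 sum.atLeastLessThan_concat)
  then show ?case using Suc by simp
qed (simp add: assms)

text \<open>The blocks are \<open>{block r n j..<block r n (Suc j)}\<close> for \<open>j < r\<close>. They partition \<open>{..<n}\<close> exactly, for
  every \<open>n\<close>, at the price of lengths that differ slightly.\<close>
definition block :: "nat \<Rightarrow> nat \<Rightarrow> nat \<Rightarrow> nat" where
  "block r n j = j * n div r"

lemma block_mono: "i \<le> j \<Longrightarrow> block r n i \<le> block r n j"
  unfolding block_def by (intro div_le_mono mult_right_mono) auto

lemma block_0: "block r n 0 = 0" by (simp add: block_def)

lemma block_r: "r > 0 \<Longrightarrow> block r n r = n" by (simp add: block_def)

lemma real_block:
  assumes "r > 0"
  shows "real (block r n j) \<le> real j * real n / real r" "real (block r n j) > real j * real n / real r - 1"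
proof -
  have "real (block r n j) = of_int \<lfloor>real (j * n) / real r\<rfloor>"
    unfolding block_def by (metis floor_divide_of_nat_eq of_int_of_nat_eq)
  moreover have "real (j * n) / real r = real j * real n / real r" by simp
  ultimately show "real (block r n j) \<le> real j * real n / real r" "real (block r n j) > real j * real n / real r - 1"
    using floor_correct[of "real (j * n) / real r"] by linarith+
qed

lemma block_length:
  assumes "r > 0"
  shows "\<bar>real (block r n (Suc j)) - real (block r n j) - real n / real r\<bar> \<le> 1"
proof -
  have "real (Suc j) * real n / real r = real j * real n / real r + real n / real r"
    by (simp add: add_divide_distrib algebra_simps)
  then show ?thesis
    using real_block[OF assms, where n=n and j=j] real_block[OF assms, where n=n and j="Suc j"] by linarith
qed

lemma block_fraction_tendsto:
  assumes "r > 0"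
  shows "(\<lambda>n. (real (block r n (Suc j)) - real (block r n j)) / real n) \<longlonglongrightarrow> 1 / real r"
proof -
  have "(\<lambda>n. (real (block r n (Suc j)) - real (block r n j)) / real n - 1 / real r) \<longlonglongrightarrow> 0"
  proof (rule Lim_null_comparison)
    show "\<forall>\<^sub>F n in sequentially. norm ((real (block r n (Suc j)) - real (block r n j)) / real n - 1 / real r) \<le> 1 / real n"
      using eventually_gt_at_top[of 0]
    proof eventually_elim
      case (elim n)
      have "(real (block r n (Suc j)) - real (block r n j)) / real n - 1 / real r
          = (real (block r n (Suc j)) - real (block r n j) - real n / real r) / real n"
        using elim assms by (simp add: field_simps)
      then show ?case using block_length[OF assms, of n j] elim by (simp add: divide_right_mono)
    qed
  qed (rule lim_1_over_n)
  from tendsto_add[OF this tendsto_const[of "1 / real r"]] show ?thesis by simp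
qed

lemma block_increment_weak_conv:
  assumes r: "r > 0"
  shows "weak_conv_m (\<lambda>n. distr M borel (\<lambda>\<omega>. (T (block r n (Suc j)) \<omega> - T (block r n j) \<omega>) / sqrt n))
    (normal_distribution 0 (1 / r * \<sigma>2))"
proof -
  let ?I = "\<lambda>n. {block r n j..<block r n (Suc j)}"
  have "weak_conv_m (\<lambda>n. distr M borel (\<lambda>\<omega>. \<Sum>i\<in>?I n. (s i / sqrt n) * e i \<omega>)) (normal_distribution 0 (1 / r * \<sigma>2))"
  proof (rule weighted_central_limit_theorem)
    have "(\<Sum>i\<in>?I n. (s i / sqrt n)\<^sup>2) = (real (block r n (Suc j)) - real (block r n j)) / real n" for n
      using block_mono[of j "Suc j" r n] by (simp add: power_divide sign of_nat_diff)
    then show "(\<lambda>n. \<Sum>i\<in>?I n. (s i / sqrt n)\<^sup>2) \<longlonglongrightarrow> 1 / real r"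
      using block_fraction_tendsto[OF r] by simp
    show "\<bar>s i / sqrt n\<bar> \<le> 1 / sqrt n" for n :: nat and i
      using sign[of i] by (simp add: abs_square_eq_1)
    show "(\<lambda>n. 1 / sqrt (real n)) \<longlonglongrightarrow> 0" by real_asymp
  qed auto
  moreover have "(\<Sum>i\<in>?I n. (s i / sqrt n) * e i \<omega>) = (T (block r n (Suc j)) \<omega> - T (block r n j) \<omega>) / sqrt n" for n :: nat and \<omega>
    using block_mono[of j "Suc j" r n] by (simp add: T_diff sum_divide_distrib)
  ultimately show ?thesis by simp
qed

text \<open>The functional whose limit is sought; \<open>block_form\<close> is its approximation by the increments over \<open>r\<close>
  blocks, which applies in the same way to the discrete walk and to the Wiener process.\<close>
definition quad :: "real \<Rightarrow> real \<Rightarrow> nat \<Rightarrow> 'a \<Rightarrow> real" where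
  "quad u x n \<omega> = u * (T n \<omega>)\<^sup>2 / real n + x * (\<Sum>i<n. (T i \<omega>)\<^sup>2) / (real n)\<^sup>2"

definition block_form :: "real \<Rightarrow> real \<Rightarrow> nat \<Rightarrow> (nat \<Rightarrow> real) \<Rightarrow> real" where
  "block_form u x r z = u * (\<Sum>j<r. z j)\<^sup>2 + x * (\<Sum>j<r. (\<Sum>i<j. z i)\<^sup>2) / real r"

definition block_increment :: "nat \<Rightarrow> nat \<Rightarrow> nat \<Rightarrow> 'a \<Rightarrow> real" where
  "block_increment r n j \<omega> = (T (block r n (Suc j)) \<omega> - T (block r n j) \<omega>) / sqrt (real n)"

lemma quad_meas[measurable]: "quad u x n \<in> borel_measurable M"
  unfolding quad_def[abs_def] by measurable

lemma block_form_cong: "(\<And>j. j < r \<Longrightarrow> z j = z' j) \<Longrightarrow> block_form u x r z = block_form u x r z'"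
  unfolding block_form_def by (auto intro!: arg_cong2[where f="(+)"] arg_cong2[where f="(*)"] arg_cong2[where f="(/)"] arg_cong[where f="\<lambda>x. x\<^sup>2"] sum.cong)

text \<open>This bounds the error of the block approximation in \<open>L\<^sup>1\<close>. Its limit as \<open>n\<close> grows is of order \<open>1 / sqrt r\<close>, and so
  the approximation is uniform in large \<open>n\<close>.\<close>
definition approx_bound :: "real \<Rightarrow> nat \<Rightarrow> nat \<Rightarrow> real" where
  "approx_bound x r n = \<bar>x\<bar> * \<sigma>2 * ((sqrt r * (1 / r + 1 / n) + 4 / sqrt r) / 2
     + (\<Sum>j<r. \<bar>(real (block r n (Suc j)) - real (block r n j)) / n - 1 / r\<bar>))"

lemma approx_bound_tendsto:
  assumes "r > 0"
  shows "approx_bound x r \<longlonglongrightarrow> \<bar>x\<bar> * \<sigma>2 * (5 / 2) / sqrt r"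
proof -
  have "(\<lambda>n. \<bar>x\<bar> * \<sigma>2 * ((sqrt r * (1 / r + 1 / real n) + 4 / sqrt r) / 2
     + (\<Sum>j<r. \<bar>(real (block r n (Suc j)) - real (block r n j)) / n - 1 / r\<bar>)))
     \<longlonglongrightarrow> \<bar>x\<bar> * \<sigma>2 * ((sqrt r * (1 / r + 0) + 4 / sqrt r) / 2 + (\<Sum>j<r. \<bar>1 / r - 1 / r\<bar>))"
    by (intro tendsto_intros block_fraction_tendsto[OF assms] lim_1_over_n) auto
  moreover have "sqrt r * (1 / r) = 1 / sqrt r"
    using assms by (simp add: field_simps)
  ultimately show ?thesis
    by (simp add: approx_bound_def[abs_def] mult.commute)
qed

text \<open>The telescoping sums of the block increments are the values of the walk at the block boundaries. So the error
  consists of \<open>(T i)\<^sup>2 - (T m)\<^sup>2\<close> for \<open>i\<close> in the block that starts at \<open>m\<close>, and of the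
  difference between the relative block lengths and \<open>1 / r\<close>.\<close>
lemma quad_block_approx:
  assumes r: "r > 0" and n: "n > 0"
  shows "integrable M (\<lambda>\<omega>. quad u x n \<omega> - block_form u x r (\<lambda>j. block_increment r n j \<omega>))"
    and "expectation (\<lambda>\<omega>. \<bar>quad u x n \<omega> - block_form u x r (\<lambda>j. block_increment r n j \<omega>)\<bar>) \<le> approx_bound x r n"
proof -
  let ?m = "block r n"
  let ?J = "\<lambda>j. {?m j..<?m (Suc j)}"
  define L where "L j = real (?m (Suc j)) - real (?m j)" for j
  have L: "L j \<ge> 0" "L j = real (card (?J j))" "L j \<le> real n / real r + 1" for j
    using block_mono[of j "Suc j" r n] block_length[OF r, of n j] by (auto simp: L_def of_nat_diff)
  define A where "A j i \<omega> = ((T i \<omega>)\<^sup>2 - (T (?m j) \<omega>)\<^sup>2)" for j i \<omega>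
  define D where "D \<omega> = x * (\<Sum>j<r. ((\<Sum>i\<in>?J j. A j i \<omega>) / (real n)\<^sup>2 + (L j / n - 1 / r) * ((T (?m j) \<omega>)\<^sup>2 / n)))" for \<omega>
  have tele: "(\<Sum>i<j. block_increment r n i \<omega>) = T (?m j) \<omega> / sqrt n" for j \<omega>
    unfolding block_increment_def
    by (subst sum_divide_distrib[symmetric], subst sum_lessThan_telescope) (simp add: block_0 T_def)
  have form: "block_form u x r (\<lambda>j. block_increment r n j \<omega>) = u * (T n \<omega>)\<^sup>2 / n + x * (\<Sum>j<r. (T (?m j) \<omega>)\<^sup>2 / n) / r" for \<omega>
    unfolding block_form_def tele by (simp add: block_r[OF r] power_divide)
  have diff: "quad u x n \<omega> - block_form u x r (\<lambda>j. block_increment r n j \<omega>) = D \<omega>" for \<omega>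
  proof -
    have "(\<Sum>i<n. (T i \<omega>)\<^sup>2) = (\<Sum>j<r. \<Sum>i\<in>?J j. (T i \<omega>)\<^sup>2)"
      using sum_blocks[of ?m "\<lambda>i. (T i \<omega>)\<^sup>2" r] block_0 block_mono block_r[OF r] by metis
    moreover have "(\<Sum>i\<in>?J j. (T i \<omega>)\<^sup>2) = (\<Sum>i\<in>?J j. A j i \<omega>) + L j * (T (?m j) \<omega>)\<^sup>2" for j
      unfolding A_def by (simp add: sum_subtractf L(2))
    ultimately have sq: "(\<Sum>i<n. (T i \<omega>)\<^sup>2) = (\<Sum>j<r. (\<Sum>i\<in>?J j. A j i \<omega>) + L j * (T (?m j) \<omega>)\<^sup>2)"
      by simp
    have lin: "(\<Sum>j<r. f j) / a - (\<Sum>j<r. g j) / c = (\<Sum>j<r. f j / a - g j / c)" for f g :: "nat \<Rightarrow> real" and a c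
      by (simp add: sum_divide_distrib sum_subtractf)
    have "(\<Sum>i<n. (T i \<omega>)\<^sup>2) / (real n)\<^sup>2 - (\<Sum>j<r. (T (?m j) \<omega>)\<^sup>2 / n) / r
        = (\<Sum>j<r. ((\<Sum>i\<in>?J j. A j i \<omega>) / (real n)\<^sup>2 + (L j / n - 1 / r) * ((T (?m j) \<omega>)\<^sup>2 / n)))"
      unfolding sq lin
      by (intro sum.cong refl) (simp add: add_divide_distrib power2_eq_square[of "real n"] left_diff_distrib diff_divide_distrib mult.commute)
    then have "x * ((\<Sum>i<n. (T i \<omega>)\<^sup>2) / (real n)\<^sup>2 - (\<Sum>j<r. (T (?m j) \<omega>)\<^sup>2 / n) / r) = D \<omega>"
      unfolding D_def by (rule arg_cong)
    then show ?thesis unfolding quad_def form by (simp add: right_diff_distrib)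
  qed
  have intA: "integrable M (A j i)" for j i
    unfolding A_def by (intro Bochner_Integration.integrable_diff T_second_moment)
  have intD: "integrable M D"
    unfolding D_def
    by (intro integrable_mult_right Bochner_Integration.integrable_sum Bochner_Integration.integrable_add integrable_divide intA T_second_moment)
  then show "integrable M (\<lambda>\<omega>. quad u x n \<omega> - block_form u x r (\<lambda>j. block_increment r n j \<omega>))"
    by (simp add: diff)
  \<comment> \<open>the bound of \<open>expectation_T_sq_diff_le\<close> with \<open>c = sqrt r\<close>, over a block of length at most \<open>n / r + 1\<close>\<close>
  define b where "b = \<sigma>2 * (sqrt r * (real n / r + 1) + 4 * real n / sqrt r) / 2"
  have b0: "b \<ge> 0" using \<sigma>2_nonneg by (simp add: b_def)
  have m_le: "?m j \<le> n" if "j \<le> r" for j using block_mono[OF that, of r n] by (simp add: block_r[OF r])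
  have EA: "expectation (\<lambda>\<omega>. \<bar>A j i \<omega>\<bar>) \<le> b" if "i \<in> ?J j" "j < r" for i j
  proof -
    have "expectation (\<lambda>\<omega>. \<bar>A j i \<omega>\<bar>) \<le> \<sigma>2 * (sqrt r * (real i - real (?m j)) + 4 * real n / sqrt r) / 2"
      unfolding A_def using that m_le[of "Suc j"] r by (intro expectation_T_sq_diff_le) auto
    also have "\<dots> \<le> b"
      unfolding b_def using that L(3)[of j] \<sigma>2_nonneg
      by (intro divide_right_mono mult_left_mono add_mono) (auto simp: L_def)
    finally show ?thesis .
  qed
  have ET: "expectation (\<lambda>\<omega>. (T (?m j) \<omega>)\<^sup>2 / n) \<le> \<sigma>2" if "j < r" for j
  proof -
    have "\<sigma>2 * real (?m j) \<le> \<sigma>2 * real n" using m_le[of j] that \<sigma>2_nonneg by (intro mult_left_mono) auto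
    then show ?thesis using n T_second_moment by (simp add: divide_le_eq)
  qed
  have "expectation (\<lambda>\<omega>. \<bar>D \<omega>\<bar>) \<le> expectation (\<lambda>\<omega>. \<bar>x\<bar> * (\<Sum>j<r. ((\<Sum>i\<in>?J j. \<bar>A j i \<omega>\<bar>) / (real n)\<^sup>2 + \<bar>L j / n - 1 / r\<bar> * ((T (?m j) \<omega>)\<^sup>2 / n))))"
  proof (rule integral_mono)
    show "integrable M (\<lambda>\<omega>. \<bar>x\<bar> * (\<Sum>j<r. ((\<Sum>i\<in>?J j. \<bar>A j i \<omega>\<bar>) / (real n)\<^sup>2 + \<bar>L j / n - 1 / r\<bar> * ((T (?m j) \<omega>)\<^sup>2 / n))))"
      by (intro integrable_mult_right Bochner_Integration.integrable_sum Bochner_Integration.integrable_add integrable_divide integrable_abs intA T_second_moment)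
    fix \<omega>
    show "\<bar>D \<omega>\<bar> \<le> \<bar>x\<bar> * (\<Sum>j<r. ((\<Sum>i\<in>?J j. \<bar>A j i \<omega>\<bar>) / (real n)\<^sup>2 + \<bar>L j / n - 1 / r\<bar> * ((T (?m j) \<omega>)\<^sup>2 / n)))"
      unfolding D_def abs_mult
      by (intro mult_left_mono order_trans[OF sum_abs] sum_mono order_trans[OF abs_triangle_ineq] add_mono)
         (auto simp: abs_mult abs_divide intro!: divide_right_mono sum_abs)
  qed (use intD in auto)
  also have "\<dots> = \<bar>x\<bar> * (\<Sum>j<r. ((\<Sum>i\<in>?J j. expectation (\<lambda>\<omega>. \<bar>A j i \<omega>\<bar>)) / (real n)\<^sup>2 + \<bar>L j / n - 1 / r\<bar> * expectation (\<lambda>\<omega>. (T (?m j) \<omega>)\<^sup>2 / n)))"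
  proof -
    have lin: "expectation (\<lambda>\<omega>. c * (\<Sum>j<r. ((\<Sum>i\<in>?J j. a j i \<omega>) / d + k j * b j \<omega>)))
        = c * (\<Sum>j<r. ((\<Sum>i\<in>?J j. expectation (a j i)) / d + k j * expectation (b j)))"
      if "\<And>j i. integrable M (a j i)" "\<And>j. integrable M (b j)"
      for a :: "nat \<Rightarrow> nat \<Rightarrow> 'a \<Rightarrow> real" and b k c d
      using that by simp
    show ?thesis
      by (rule lin) (auto intro: integrable_abs intA integrable_divide T_second_moment)
  qed
  also have "\<dots> \<le> \<bar>x\<bar> * (\<Sum>j<r. L j * b / (real n)\<^sup>2 + \<bar>L j / n - 1 / r\<bar> * \<sigma>2)"
  proof (intro mult_left_mono sum_mono add_mono divide_right_mono)
    fix j assume "j \<in> {..<r}"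
    then have j: "j < r" by simp
    have "(\<Sum>i\<in>?J j. expectation (\<lambda>\<omega>. \<bar>A j i \<omega>\<bar>)) \<le> (\<Sum>i\<in>?J j. b)"
      by (intro sum_mono EA j)
    then show "(\<Sum>i\<in>?J j. expectation (\<lambda>\<omega>. \<bar>A j i \<omega>\<bar>)) \<le> L j * b" by (simp add: L(2))
    show "expectation (\<lambda>\<omega>. (T (?m j) \<omega>)\<^sup>2 / n) \<le> \<sigma>2" by (rule ET[OF j])
  qed auto
  also have "\<dots> = \<bar>x\<bar> * ((\<Sum>j<r. L j) * b / (real n)\<^sup>2 + \<sigma>2 * (\<Sum>j<r. \<bar>L j / n - 1 / r\<bar>))"
    by (simp add: sum.distrib sum_distrib_left sum_distrib_right sum_divide_distrib mult.commute)
  also have "(\<Sum>j<r. L j) = real n"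
    unfolding L_def by (subst sum_lessThan_telescope) (simp add: block_r[OF r] block_0)
  also have "real n * b / (real n)\<^sup>2 = \<sigma>2 * (sqrt r * (1 / r + 1 / n) + 4 / sqrt r) / 2"
    using n by (simp add: b_def power2_eq_square field_simps)
  also have "\<bar>x\<bar> * (\<sigma>2 * (sqrt r * (1 / r + 1 / n) + 4 / sqrt r) / 2 + \<sigma>2 * (\<Sum>j<r. \<bar>L j / n - 1 / r\<bar>)) = approx_bound x r n"
    by (simp add: approx_bound_def L_def algebra_simps)
  finally show "expectation (\<lambda>\<omega>. \<bar>quad u x n \<omega> - block_form u x r (\<lambda>j. block_increment r n j \<omega>)\<bar>) \<le> approx_bound x r n"
    by (simp add: diff)
qed

lemma block_form_tendsto:
  assumes "\<And>j. j < r \<Longrightarrow> (\<lambda>n. z n j) \<longlonglongrightarrow> y j"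
  shows "(\<lambda>n. block_form u x r (z n)) \<longlonglongrightarrow> block_form u x r y"
proof (cases "r = 0")
  case False
  then show ?thesis
    unfolding block_form_def using assms by (intro tendsto_intros) (auto intro: less_trans)
qed (simp add: block_form_def)

lemma block_form_measurable: "block_form u x r \<in> borel_measurable (PiM {..<r} (\<lambda>_. borel))"
proof -
  have "(\<lambda>z. z j) \<in> borel_measurable (PiM {..<r} (\<lambda>_. borel :: real measure))" if "j < r" for j
    using that by (intro measurable_component_singleton) auto
  then show ?thesis
    unfolding block_form_def[abs_def]
    by (intro borel_measurable_add borel_measurable_times borel_measurable_const borel_measurable_power
        borel_measurable_sum borel_measurable_divide) auto
qed

lemma distr_scaled_wiener_increment:
  assumes W: "wiener_process N W" and ab: "0 \<le> a" "a < b"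
  shows "distr N borel (\<lambda>\<omega>. sqrt \<sigma>2 * (W b \<omega> - W a \<omega>)) = normal_distribution 0 ((b - a) * \<sigma>2)"
proof -
  interpret W: wiener_process N W by (rule W)
  have [measurable]: "W a \<in> borel_measurable N" "W b \<in> borel_measurable N"
    using ab by (auto intro!: W.W_meas)
  have v: "0 \<le> (b - a) * \<sigma>2" using ab \<sigma>2_nonneg by simp
  show ?thesis
  proof (rule Levy_uniqueness)
    show "real_distribution (normal_distribution 0 ((b - a) * \<sigma>2))"
      by (rule real_distribution_normal_distribution[OF v])
    show "char (distr N borel (\<lambda>\<omega>. sqrt \<sigma>2 * (W b \<omega> - W a \<omega>))) = char (normal_distribution 0 ((b - a) * \<sigma>2))"
    proof
      fix t
      have "char (distr N borel (\<lambda>\<omega>. sqrt \<sigma>2 * (W b \<omega> - W a \<omega>))) t = char (distr N borel (\<lambda>\<omega>. W b \<omega> - W a \<omega>)) (t * sqrt \<sigma>2)"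
        unfolding char_def by (subst integral_distr, simp, simp, subst integral_distr) (auto simp: mult.assoc)
      also have "\<dots> = char (normal_distribution 0 ((b - a) * \<sigma>2)) t"
        unfolding W.W_increments_normal[OF ab] char_normal_distribution[OF v]
        using ab \<sigma>2_nonneg by (subst char_normal_distribution) (auto simp: power_mult_distrib mult_ac)
      finally show "char (distr N borel (\<lambda>\<omega>. sqrt \<sigma>2 * (W b \<omega> - W a \<omega>))) t = char (normal_distribution 0 ((b - a) * \<sigma>2)) t" .
    qed
  qed (intro W.real_distribution_distr, measurable)
qed

text \<open>For fixed \<open>r\<close> the block forms converge, since their arguments are independent and converge separately.
  The block forms approximate the functional of the walk uniformly in large \<open>n\<close>, and that of
  the Wiener process as \<open>r\<close> grows (Riemann sums). Exchanging the two limits in the characteristic function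
  gives the claim.\<close>
theorem quad_weak_conv:
  assumes W: "wiener_process N W"
  shows "weak_conv_m (\<lambda>n. distr M borel (quad u x n))
    (distr N borel (\<lambda>\<omega>. \<sigma>2 * (u * (W 1 \<omega>)\<^sup>2 + x * (LINT t:{0..1}|lborel. (W t \<omega>)\<^sup>2))))"
proof -
  interpret W: wiener_process N W by (rule W)
  define Y where "Y r j \<omega> = sqrt \<sigma>2 * (W (real (Suc j) / real r) \<omega> - W (real j / real r) \<omega>)" for r j \<omega>
  define Q where "Q \<omega> = \<sigma>2 * (u * (W 1 \<omega>)\<^sup>2 + x * W.sq_int \<omega>)" for \<omega>
  have Y_meas[measurable]: "Y r j \<in> borel_measurable N" for r j
    unfolding Y_def[abs_def] by measurable
  have Q_meas[measurable]: "Q \<in> borel_measurable N"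
    unfolding Q_def[abs_def] by measurable
  have Z_meas[measurable]: "block_increment r n j \<in> borel_measurable M" for r n j
    unfolding block_increment_def[abs_def] by measurable
  have FZ_meas[measurable]: "(\<lambda>\<omega>. block_form u x r (\<lambda>j. block_increment r n j \<omega>)) \<in> borel_measurable M" for r n
    unfolding block_form_def by measurable
  have FY_meas[measurable]: "(\<lambda>\<omega>. block_form u x r (\<lambda>j. Y r j \<omega>)) \<in> borel_measurable N" for r
    unfolding block_form_def by measurable

  have Y_form: "AE \<omega> in N. (\<lambda>r. block_form u x r (\<lambda>j. Y r j \<omega>)) \<longlonglongrightarrow> Q \<omega>"
    using W.W_zero
  proof (rule AE_mp, intro AE_I2 impI)
    fix \<omega> assume \<omega>: "\<omega> \<in> space N" and W0: "W 0 \<omega> = 0"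
    have tele: "(\<Sum>i<j. Y r i \<omega>) = sqrt \<sigma>2 * W (real j / real r) \<omega>" for r j
      unfolding Y_def sum_distrib_left[symmetric]
      by (subst sum_lessThan_telescope) (simp add: W0)
    have "block_form u x r (\<lambda>j. Y r j \<omega>) = \<sigma>2 * (u * (W 1 \<omega>)\<^sup>2 + x * ((\<Sum>j<r. (W (real j / real r) \<omega>)\<^sup>2) / real r))" if "r > 0" for r
      unfolding block_form_def tele using that \<sigma>2_nonneg
      by (simp add: power_mult_distrib sum_distrib_left[symmetric] algebra_simps)
    then have "\<forall>\<^sub>F r in sequentially. \<sigma>2 * (u * (W 1 \<omega>)\<^sup>2 + x * ((\<Sum>j<r. (W (real j / real r) \<omega>)\<^sup>2) / real r)) = block_form u x r (\<lambda>j. Y r j \<omega>)"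
      by (intro eventually_sequentiallyI[of 1]) simp
    moreover have "(\<lambda>r. \<sigma>2 * (u * (W 1 \<omega>)\<^sup>2 + x * ((\<Sum>j<r. (W (real j / real r) \<omega>)\<^sup>2) / real r))) \<longlonglongrightarrow> Q \<omega>"
      unfolding Q_def by (intro tendsto_intros W.riemann_sum_sq_int \<omega>)
    ultimately show "(\<lambda>r. block_form u x r (\<lambda>j. Y r j \<omega>)) \<longlonglongrightarrow> Q \<omega>"
      by (rule Lim_transform_eventually[rotated])
  qed

  have main: "weak_conv_m (\<lambda>n. distr M borel (quad u x n)) (distr N borel Q)"
  proof (rule levy_continuity)
    fix t :: real
    define \<phi> where "\<phi> n = (CLINT \<omega>|M. iexp (t * quad u x n \<omega>))" for n
    define \<psi> where "\<psi> = (CLINT \<omega>|N. iexp (t * Q \<omega>))"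
    define \<phi>' where "\<phi>' r n = (CLINT \<omega>|M. iexp (t * block_form u x r (\<lambda>j. block_increment r n j \<omega>)))" for r n
    define \<psi>' where "\<psi>' r = (CLINT \<omega>|N. iexp (t * block_form u x r (\<lambda>j. Y r j \<omega>)))" for r
    have fdd: "\<phi>' r \<longlonglongrightarrow> \<psi>' r" if r: "r > 0" for r
    proof -
      let ?f = "\<lambda>z. iexp (t * block_form u x r z)"
      have "(\<lambda>n. CLINT \<omega>|M. ?f (\<lambda>j\<in>{..<r}. block_increment r n j \<omega>)) \<longlonglongrightarrow> (CLINT \<omega>|N. ?f (\<lambda>j\<in>{..<r}. Y r j \<omega>))"
      proof (rule indep_weak_conv_expectation[OF prob_space_axioms W.prob_space_axioms, where B=1])
        show "indep_vars (\<lambda>_. borel) (block_increment r n) {..<r}" for n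
          unfolding block_increment_def[abs_def]
          by (rule block_variable_indep[OF block_mono])
        have "W.indep_vars (\<lambda>_. borel) (\<lambda>i \<omega>. W (real (Suc i) / real r) \<omega> - W (real i / real r) \<omega>) {..<r}"
          using r W.W_increments_indep[of "\<lambda>i. real i / real r" r] by (simp add: divide_strict_right_mono)
        then show "W.indep_vars (\<lambda>_. borel) (Y r) {..<r}"
          unfolding Y_def[abs_def] by (rule W.indep_vars_compose2) simp
        show "weak_conv_m (\<lambda>n. distr M borel (block_increment r n j)) (distr N borel (Y r j))" if "j < r" for j
        proof -
          have "distr N borel (Y r j) = normal_distribution 0 ((real (Suc j) / real r - real j / real r) * \<sigma>2)"
            unfolding Y_def[abs_def]
            by (rule distr_scaled_wiener_increment[OF W]) (use r in \<open>auto simp: divide_strict_right_mono\<close>)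
          also have "real (Suc j) / real r - real j / real r = 1 / real r"
            using r by (simp add: field_simps)
          finally show ?thesis
            using block_increment_weak_conv[OF r, of j] by (simp add: block_increment_def[abs_def])
        qed
        show "?f \<in> borel_measurable (PiM {..<r} (\<lambda>_. borel))"
          using block_form_measurable[of u x r] by measurable
        show "(\<lambda>n. ?f (z n)) \<longlonglongrightarrow> ?f y" if "\<And>j. j < r \<Longrightarrow> (\<lambda>n. z n j) \<longlonglongrightarrow> y j" for z y
          by (intro tendsto_intros block_form_tendsto that)
      qed (use r in auto)
      moreover have "block_form u x r (\<lambda>j\<in>{..<r}. z j) = block_form u x r z" for z
        by (rule block_form_cong) simp
      ultimately show ?thesis
        unfolding \<phi>'_def[abs_def] \<psi>'_def by (simp only:)
    qed
    have "\<psi>' \<longlonglongrightarrow> \<psi>"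
      unfolding \<psi>'_def[abs_def] \<psi>_def
    proof (rule integral_dominated_convergence[where w="\<lambda>_. 1"])
      show "AE \<omega> in N. (\<lambda>r. iexp (t * block_form u x r (\<lambda>j. Y r j \<omega>))) \<longlonglongrightarrow> iexp (t * Q \<omega>)"
        using Y_form by eventually_elim (intro tendsto_intros)
    qed (auto simp del: of_real_mult)
    have "\<phi> \<longlonglongrightarrow> \<psi>"
    proof (rule LIMSEQ_I)
      fix \<epsilon> :: real assume \<epsilon>: "\<epsilon> > 0"
      have "(\<lambda>r. \<bar>t\<bar> * (\<bar>x\<bar> * \<sigma>2 * (5 / 2) / sqrt (real r))) \<longlonglongrightarrow> 0"
        by real_asymp
      then have "\<forall>\<^sub>F r in sequentially. \<bar>t\<bar> * (\<bar>x\<bar> * \<sigma>2 * (5 / 2) / sqrt (real r)) < \<epsilon> / 3"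
        using \<epsilon> by (intro order_tendstoD(2)) auto
      moreover have "\<forall>\<^sub>F r in sequentially. norm (\<psi>' r - \<psi>) < \<epsilon> / 3"
        using tendstoD[OF \<open>\<psi>' \<longlonglongrightarrow> \<psi>\<close>, of "\<epsilon> / 3"] \<epsilon> by (simp add: dist_norm)
      ultimately have "\<forall>\<^sub>F r in sequentially. r > 0 \<and> \<bar>t\<bar> * (\<bar>x\<bar> * \<sigma>2 * (5 / 2) / sqrt (real r)) < \<epsilon> / 3 \<and> norm (\<psi>' r - \<psi>) < \<epsilon> / 3"
        using eventually_gt_at_top[of 0] by eventually_elim auto
      then obtain r where r: "r > 0" "\<bar>t\<bar> * (\<bar>x\<bar> * \<sigma>2 * (5 / 2) / sqrt (real r)) < \<epsilon> / 3" "norm (\<psi>' r - \<psi>) < \<epsilon> / 3"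
        by (auto simp: eventually_sequentially)
      have "(\<lambda>n. \<bar>t\<bar> * approx_bound x r n) \<longlonglongrightarrow> \<bar>t\<bar> * (\<bar>x\<bar> * \<sigma>2 * (5 / 2) / sqrt (real r))"
        by (intro tendsto_intros approx_bound_tendsto r)
      then have "\<forall>\<^sub>F n in sequentially. \<bar>t\<bar> * approx_bound x r n < \<epsilon> / 3"
        using r(2) by (rule order_tendstoD(2))
      moreover have "\<forall>\<^sub>F n in sequentially. norm (\<phi>' r n - \<psi>' r) < \<epsilon> / 3"
        using tendstoD[OF fdd[OF r(1)], of "\<epsilon> / 3"] \<epsilon> by (simp add: dist_norm)
      ultimately have "\<forall>\<^sub>F n in sequentially. norm (\<phi> n - \<psi>) < \<epsilon>"
        using eventually_gt_at_top[of 0]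
      proof eventually_elim
        case (elim n)
        have "norm (\<phi> n - \<phi>' r n) \<le> \<bar>t\<bar> * expectation (\<lambda>\<omega>. \<bar>quad u x n \<omega> - block_form u x r (\<lambda>j. block_increment r n j \<omega>)\<bar>)"
          unfolding \<phi>_def \<phi>'_def
          by (rule norm_char_diff_le) (use quad_block_approx(1)[OF r(1) elim(3)] in auto)
        also have "\<dots> \<le> \<bar>t\<bar> * approx_bound x r n"
          by (intro mult_left_mono quad_block_approx(2)[OF r(1) elim(3)]) simp
        finally have "norm (\<phi> n - \<phi>' r n) < \<epsilon> / 3" using elim(1) by simp
        moreover have "\<phi> n - \<psi> = (\<phi> n - \<phi>' r n) + (\<phi>' r n - \<psi>' r) + (\<psi>' r - \<psi>)" by simp
        ultimately show ?case
          using elim(2) r(3) norm_triangle_ineq[of "(\<phi> n - \<phi>' r n) + (\<phi>' r n - \<psi>' r)" "\<psi>' r - \<psi>"]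
            norm_triangle_ineq[of "\<phi> n - \<phi>' r n" "\<phi>' r n - \<psi>' r"] by (simp only:)
      qed
      then show "\<exists>no. \<forall>n\<ge>no. norm (\<phi> n - \<psi>) < \<epsilon>"
        by (simp only: eventually_sequentially)
    qed
    moreover have "char (distr M borel (quad u x n)) t = \<phi> n" for n
      unfolding char_def \<phi>_def by (subst integral_distr) auto
    moreover have "char (distr N borel Q) t = \<psi>"
      unfolding char_def \<psi>_def by (subst integral_distr) auto
    ultimately show "(\<lambda>n. char (distr M borel (quad u x n)) t) \<longlonglongrightarrow> char (distr N borel Q) t"
      by (simp only:)
  qed auto
  then show ?thesis by (simp only: Q_def[abs_def])
qed

end

section \<open>The Ito integral of the Wiener process against itself\<close>

lemma (in prob_space) integrable_mult_of_square_integrable: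
  fixes f g :: "'a \<Rightarrow> real"
  assumes "f \<in> borel_measurable M" "g \<in> borel_measurable M"
    and "integrable M (\<lambda>\<omega>. (f \<omega>)\<^sup>2)" "integrable M (\<lambda>\<omega>. (g \<omega>)\<^sup>2)"
  shows "integrable M (\<lambda>\<omega>. f \<omega> * g \<omega>)"
proof (rule Bochner_Integration.integrable_bound)
  show "integrable M (\<lambda>\<omega>. (f \<omega>)\<^sup>2 + (g \<omega>)\<^sup>2)" using assms by simp
  have "\<bar>a * b\<bar> \<le> a\<^sup>2 + b\<^sup>2" for a b :: real
  proof -
    have "2 * \<bar>a * b\<bar> \<le> a\<^sup>2 + b\<^sup>2"
      using zero_le_power2[of "\<bar>a\<bar> - \<bar>b\<bar>"] by (simp add: power2_diff abs_mult)
    then show ?thesis using abs_ge_zero[of "a * b"] by linarith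
  qed
  then show "AE \<omega> in M. norm (f \<omega> * g \<omega>) \<le> norm ((f \<omega>)\<^sup>2 + (g \<omega>)\<^sup>2)"
    by (intro AE_I2) (auto intro: order_trans[OF _ abs_ge_self])
qed (use assms in measurable)

lemma (in prob_space) square_integrable_diff:
  fixes f g :: "'a \<Rightarrow> real"
  assumes "f \<in> borel_measurable M" "g \<in> borel_measurable M"
    and "integrable M (\<lambda>\<omega>. (f \<omega>)\<^sup>2)" "integrable M (\<lambda>\<omega>. (g \<omega>)\<^sup>2)"
  shows "integrable M (\<lambda>\<omega>. (f \<omega> - g \<omega>)\<^sup>2)"
  using integrable_mult_of_square_integrable[OF assms] assms(3,4)
  by (simp add: power2_diff mult.assoc)

context wiener_process
begin

abbreviation F :: "real \<Rightarrow> 'b measure" where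
  "F \<equiv> natural_filtration N W"

lemma F_generators: "(\<Union>s\<in>{0..t}. {W s -` A \<inter> space N | A. A \<in> sets borel}) \<subseteq> Pow (space N)"
  by auto

lemma space_F: "space (F t) = space N"
  unfolding natural_filtration_def by (rule space_measure_of[OF F_generators])

lemma sets_F: "sets (F t) = sigma_sets (space N) (\<Union>s\<in>{0..t}. {W s -` A \<inter> space N | A. A \<in> sets borel})"
  unfolding natural_filtration_def by (rule sets_measure_of[OF F_generators])

lemma subalgebra_F: "subalgebra N (F t)"
  unfolding subalgebra_def space_F sets_F
proof (intro conjI refl sets.sigma_sets_subset subsetI)
  fix B assume "B \<in> (\<Union>s\<in>{0..t}. {W s -` A \<inter> space N | A. A \<in> sets borel})"
  then show "B \<in> events" using measurable_sets[OF W_measurable] by auto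
qed

lemma adapted_measurable: "X \<in> borel_measurable (F t) \<Longrightarrow> X \<in> borel_measurable N"
  by (rule measurable_from_subalg[OF subalgebra_F])

lemma W_adapted: "0 \<le> s \<Longrightarrow> s \<le> t \<Longrightarrow> W s \<in> borel_measurable (F t)"
  unfolding measurable_def space_F sets_F by (auto intro!: sigma_sets.Basic bexI[of _ s], blast)

lemma adapted_mono:
  assumes "s \<le> t" "X \<in> borel_measurable (F s)"
  shows "X \<in> borel_measurable (F t)"
proof (rule measurable_from_subalg[OF _ assms(2)])
  show "subalgebra (F t) (F s)"
    unfolding subalgebra_def space_F sets_F using assms(1)
    by (intro conjI refl sigma_sets_mono' UN_mono) auto
qed

text \<open>The values of \<open>W\<close> at finitely many times in \<open>{0..a}\<close> are sums of increments over the intervals between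
  consecutive times, and these are independent of the increment over \<open>{a..b}\<close>. Since \<open>W 0 = 0\<close>
  holds almost surely only, the events are compared up to null sets.\<close>
lemma cylinder_indep_increment:
  assumes ab: "0 \<le> a" "a < b" and K: "finite K" "K \<subseteq> {0..a}" and A: "\<And>s. s \<in> K \<Longrightarrow> A s \<in> sets borel"
    and B: "B \<in> sets borel"
  shows "prob ({\<omega>\<in>space N. \<forall>s\<in>K. W s \<omega> \<in> A s} \<inter> {\<omega>\<in>space N. W b \<omega> - W a \<omega> \<in> B})
    = prob {\<omega>\<in>space N. \<forall>s\<in>K. W s \<omega> \<in> A s} * prob {\<omega>\<in>space N. W b \<omega> - W a \<omega> \<in> B}"
proof -
  \<comment> \<open>The times \<open>0\<close>, those in \<open>K\<close>, and \<open>a\<close>, in increasing order; \<open>\<tau>\<close> appends \<open>b\<close> to them. The last of the \<open>m\<close> increments is the one over \<open>{a..b}\<close>.\<close>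
  define L where "L = sorted_list_of_set (insert 0 (insert a K))"
  define m where "m = length L"
  have setL: "set L = insert 0 (insert a K)" unfolding L_def by (rule set_sorted_list_of_set) (use K in simp)
  have sL: "sorted L" "distinct L"
    unfolding L_def by (rule sorted_sorted_list_of_set, rule distinct_sorted_list_of_set)
  then have sortedL: "sorted_wrt (<) L" by (simp add: strict_sorted_iff)
  have m: "m > 0" using setL by (cases L) (auto simp: m_def)
  have rangeL: "0 \<le> L ! i \<and> L ! i \<le> a" if "i < m" for i
    using that K ab setL nth_mem[of i L] by (auto simp: m_def)
  define \<tau> where "\<tau> i = (if i < m then L ! i else b)" for i
  have \<tau>0: "\<tau> 0 = 0"
  proof -
    obtain k where "k < m" "L ! k = 0" using setL by (metis insertI1 in_set_conv_nth m_def)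
    then have "L ! 0 \<le> 0" using sorted_nth_mono[OF sL(1), of 0 k] by (simp add: m_def)
    then show ?thesis using rangeL[OF m] m by (simp add: \<tau>_def)
  qed
  have \<tau>a: "\<tau> (m - 1) = a"
  proof -
    obtain k where "k < m" "L ! k = a" using setL by (metis insertI1 insertI2 in_set_conv_nth m_def)
    then have "a \<le> L ! (m - 1)" using sorted_nth_mono[OF sL(1), of k "m - 1"] by (simp add: m_def)
    then show ?thesis using rangeL[of "m - 1"] m by (simp add: \<tau>_def)
  qed
  have \<tau>b: "\<tau> m = b" by (simp add: \<tau>_def)
  have \<tau>_less: "\<tau> i < \<tau> (Suc i)" if "i < m" for i
  proof (cases "Suc i < m")
    case True
    then show ?thesis using sorted_wrt_nth_less[OF sortedL, of i "Suc i"] by (simp add: \<tau>_def m_def)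
  next
    case False
    then show ?thesis using that rangeL[of i] ab by (simp add: \<tau>_def)
  qed
  define D where "D i \<omega> = W (\<tau> (Suc i)) \<omega> - W (\<tau> i) \<omega>" for i \<omega>
  have indepD: "indep_vars (\<lambda>_. borel) D {..<m}"
    unfolding D_def[abs_def] by (rule W_increments_indep) (use \<tau>0 \<tau>_less in auto)
  have Dm: "D i \<in> borel_measurable N" if "i < m" for i
    using indepD that by (auto simp: indep_vars_def2)
  let ?I = "{..<m - 1}" and ?J = "{m - 1}"
  have pair: "indep_var (PiM ?I (\<lambda>_. borel)) (\<lambda>\<omega>. restrict (\<lambda>i. D i \<omega>) ?I) (PiM ?J (\<lambda>_. borel)) (\<lambda>\<omega>. restrict (\<lambda>i. D i \<omega>) ?J)"
    by (rule indep_var_restrict[OF indepD]) (use m in auto)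
  define P where "P v \<longleftrightarrow> (\<forall>k\<in>{k. k < m \<and> L ! k \<in> K}. (\<Sum>i<k. v i) \<in> A (L ! k))" for v :: "nat \<Rightarrow> real"
  define GA where "GA = {v \<in> space (PiM ?I (\<lambda>_. borel)). P v}"
  define GB where "GB = {v \<in> space (PiM ?J (\<lambda>_. borel)). v (m - 1) \<in> B}"
  have GA: "GA \<in> sets (PiM ?I (\<lambda>_. borel))"
    unfolding GA_def P_def
  proof (intro sets.sets_Collect_finite_All)
    fix k assume k: "k \<in> {k. k < m \<and> L ! k \<in> K}"
    have "(\<lambda>v. \<Sum>i<k. v i :: real) \<in> borel_measurable (PiM ?I (\<lambda>_. borel))"
      using k by (intro borel_measurable_sum measurable_component_singleton) auto
    then show "{v \<in> space (PiM ?I (\<lambda>_. borel)). (\<Sum>i<k. v i) \<in> A (L ! k)} \<in> sets (PiM ?I (\<lambda>_. borel))"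
      using A k by (auto simp: measurable_def vimage_def Int_def conj_commute intro!: sets.sets_Collect)
  qed auto
  have GB: "GB \<in> sets (PiM ?J (\<lambda>_. borel))"
    unfolding GB_def using B by measurable
  have evA: "(\<lambda>\<omega>. restrict (\<lambda>i. D i \<omega>) ?I) -` GA \<inter> space N = {\<omega>\<in>space N. P (\<lambda>i. D i \<omega>)}"
  proof -
    have "P (restrict (\<lambda>i. D i \<omega>) ?I) = P (\<lambda>i. D i \<omega>)" for \<omega>
    proof -
      have "(\<Sum>i<k. restrict (\<lambda>i. D i \<omega>) ?I i) = (\<Sum>i<k. D i \<omega>)" if "k < m" for k
        using that by (intro sum.cong) auto
      then show ?thesis unfolding P_def by (intro ball_cong refl) auto
    qed
    then show ?thesis by (auto simp: GA_def space_PiM)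
  qed
  have evB: "(\<lambda>\<omega>. restrict (\<lambda>i. D i \<omega>) ?J) -` GB \<inter> space N = {\<omega>\<in>space N. W b \<omega> - W a \<omega> \<in> B}"
    using m by (auto simp: GB_def space_PiM D_def \<tau>a[simplified] \<tau>b)
  have prod: "prob ({\<omega>\<in>space N. P (\<lambda>i. D i \<omega>)} \<inter> {\<omega>\<in>space N. W b \<omega> - W a \<omega> \<in> B})
     = prob {\<omega>\<in>space N. P (\<lambda>i. D i \<omega>)} * prob {\<omega>\<in>space N. W b \<omega> - W a \<omega> \<in> B}"
  proof -
    have "(\<lambda>\<omega>. (f \<omega>, g \<omega>)) -` (GA \<times> GB) \<inter> space N = (f -` GA \<inter> space N) \<inter> (g -` GB \<inter> space N)" for f g
      by auto
    from this[of "\<lambda>\<omega>. restrict (\<lambda>i. D i \<omega>) ?I" "\<lambda>\<omega>. restrict (\<lambda>i. D i \<omega>) ?J"] show ?thesis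
      using indep_varD[OF pair GA GB] by (simp only: evA evB)
  qed
  have setsP: "{\<omega>\<in>space N. P (\<lambda>i. D i \<omega>)} \<in> events"
    using measurable_sets[OF indep_var_rv1[OF pair] GA] evA by simp
  have setsB: "{\<omega>\<in>space N. W b \<omega> - W a \<omega> \<in> B} \<in> events"
    using measurable_sets[OF indep_var_rv2[OF pair] GB] evB by simp
  have setsK: "{\<omega>\<in>space N. \<forall>s\<in>K. W s \<omega> \<in> A s} \<in> events"
  proof (intro sets.sets_Collect_finite_All K)
    fix s assume "s \<in> K"
    then show "{\<omega> \<in> space N. W s \<omega> \<in> A s} \<in> events"
      using measurable_sets[OF W_measurable[of s] A] K by (auto simp: vimage_def Int_def conj_commute)
  qed
  have ae: "AE \<omega> in N. (\<forall>s\<in>K. W s \<omega> \<in> A s) \<longleftrightarrow> P (\<lambda>i. D i \<omega>)"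
    using W_zero
  proof eventually_elim
    case (elim \<omega>)
    have "(\<Sum>i<k. D i \<omega>) = W (L ! k) \<omega>" if "k < m" for k
      unfolding D_def using that elim \<tau>0 by (subst sum_lessThan_telescope) (simp add: \<tau>_def)
    then have "P (\<lambda>i. D i \<omega>) \<longleftrightarrow> (\<forall>k\<in>{k. k < m \<and> L ! k \<in> K}. W (L ! k) \<omega> \<in> A (L ! k))"
      unfolding P_def by (intro ball_cong refl) auto
    also have "\<dots> \<longleftrightarrow> (\<forall>s\<in>K. W s \<omega> \<in> A s)"
    proof
      assume *: "\<forall>k\<in>{k. k < m \<and> L ! k \<in> K}. W (L ! k) \<omega> \<in> A (L ! k)"
      show "\<forall>s\<in>K. W s \<omega> \<in> A s"
      proof
        fix s assume "s \<in> K"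
        then obtain k where "k < m" "L ! k = s" using setL by (metis insertI2 in_set_conv_nth m_def)
        with * \<open>s \<in> K\<close> show "W s \<omega> \<in> A s" by auto
      qed
    qed auto
    finally show ?case by simp
  qed
  have "prob {\<omega>\<in>space N. \<forall>s\<in>K. W s \<omega> \<in> A s} = prob {\<omega>\<in>space N. P (\<lambda>i. D i \<omega>)}"
    using ae by (intro finite_measure_eq_AE setsK setsP) auto
  moreover have "prob ({\<omega>\<in>space N. \<forall>s\<in>K. W s \<omega> \<in> A s} \<inter> {\<omega>\<in>space N. W b \<omega> - W a \<omega> \<in> B})
      = prob ({\<omega>\<in>space N. P (\<lambda>i. D i \<omega>)} \<inter> {\<omega>\<in>space N. W b \<omega> - W a \<omega> \<in> B})"
    using ae by (intro finite_measure_eq_AE sets.Int setsK setsP setsB) auto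
  ultimately show ?thesis using prod by simp
qed

text \<open>The cylinder events form a generator of the natural filtration that is stable under intersections.\<close>
lemma adapted_indep_increment:
  assumes ab: "0 \<le> a" "a < b" and X: "X \<in> borel_measurable (F a)"
  shows "indep_var borel X borel (\<lambda>\<omega>. W b \<omega> - W a \<omega>)"
proof -
  define G where "G = {{\<omega>\<in>space N. \<forall>s\<in>K. W s \<omega> \<in> A s} | K A. finite K \<and> K \<subseteq> {0..a} \<and> (\<forall>s. A s \<in> sets borel)}"
  define H where "H = {(\<lambda>\<omega>. W b \<omega> - W a \<omega>) -` B \<inter> space N | B. B \<in> sets borel}"
  have [measurable]: "W a \<in> borel_measurable N" "W b \<in> borel_measurable N"
    using ab by (auto intro: W_measurable)
  have H_events: "H \<subseteq> events"
    unfolding H_def by (auto intro!: measurable_sets[of _ _ borel])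
  have G_events: "G \<subseteq> events"
  proof
    fix g assume "g \<in> G"
    then obtain K A where g: "g = {\<omega>\<in>space N. \<forall>s\<in>K. W s \<omega> \<in> A s}" "finite K" "K \<subseteq> {0..a}" "\<And>s. A s \<in> sets borel"
      unfolding G_def by blast
    show "g \<in> events" unfolding g(1)
    proof (intro sets.sets_Collect_finite_All g(2))
      fix s assume "s \<in> K"
      then show "{\<omega> \<in> space N. W s \<omega> \<in> A s} \<in> events"
        using measurable_sets[OF W_measurable[of s] g(4)] g(3) by (auto simp: vimage_def Int_def conj_commute)
    qed
  qed
  have "indep_set G H"
  proof (rule indep_setI[OF G_events H_events])
    fix g h assume "g \<in> G" "h \<in> H"
    then obtain K A B where "g = {\<omega>\<in>space N. \<forall>s\<in>K. W s \<omega> \<in> A s}" "finite K" "K \<subseteq> {0..a}" "\<And>s. A s \<in> sets borel"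
      and "h = {\<omega>\<in>space N. W b \<omega> - W a \<omega> \<in> B}" "B \<in> sets borel"
      unfolding G_def H_def by (auto simp: vimage_def Int_def conj_commute)
    then show "prob (g \<inter> h) = prob g * prob h"
      using cylinder_indep_increment[OF ab, of K A B] by simp
  qed
  moreover have "Int_stable G"
  proof (rule Int_stableI)
    fix g g' assume "g \<in> G" "g' \<in> G"
    obtain K A where g: "g = {\<omega>\<in>space N. \<forall>s\<in>K. W s \<omega> \<in> A s}" "finite K" "K \<subseteq> {0..a}" "\<And>s. A s \<in> sets borel"
      using \<open>g \<in> G\<close> unfolding G_def by blast
    obtain K' A' where g': "g' = {\<omega>\<in>space N. \<forall>s\<in>K'. W s \<omega> \<in> A' s}" "finite K'" "K' \<subseteq> {0..a}" "\<And>s. A' s \<in> sets borel"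
      using \<open>g' \<in> G\<close> unfolding G_def by blast
    let ?A = "\<lambda>s. (if s \<in> K then A s else UNIV) \<inter> (if s \<in> K' then A' s else UNIV)"
    have "g \<inter> g' = {\<omega>\<in>space N. \<forall>s\<in>K \<union> K'. W s \<omega> \<in> ?A s}"
      unfolding g(1) g'(1) by auto
    moreover have "\<forall>s. ?A s \<in> sets borel" using g(4) g'(4) by auto
    moreover have "finite (K \<union> K')" "K \<union> K' \<subseteq> {0..a}" using g g' by auto
    ultimately show "g \<inter> g' \<in> G"
      unfolding G_def by (intro CollectI exI[of _ "K \<union> K'"] exI[of _ ?A] conjI)
  qed
  moreover have "Int_stable H"
  proof (rule Int_stableI)
    fix h h' assume "h \<in> H" "h' \<in> H"
    then obtain B B' where h: "h = (\<lambda>\<omega>. W b \<omega> - W a \<omega>) -` B \<inter> space N" "B \<in> sets borel"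
      "h' = (\<lambda>\<omega>. W b \<omega> - W a \<omega>) -` B' \<inter> space N" "B' \<in> sets borel"
      unfolding H_def by blast
    then have "h \<inter> h' = (\<lambda>\<omega>. W b \<omega> - W a \<omega>) -` (B \<inter> B') \<inter> space N" "B \<inter> B' \<in> sets borel" by auto
    then show "h \<inter> h' \<in> H" unfolding H_def by blast
  qed
  ultimately have GH: "indep_set (sigma_sets (space N) G) (sigma_sets (space N) H)"
    by (rule indep_set_sigma_sets)
  have F_sub: "sets (F a) \<subseteq> sigma_sets (space N) G"
    unfolding sets_F
  proof (rule sigma_sets_mono', rule subsetI)
    fix g assume "g \<in> (\<Union>s\<in>{0..a}. {W s -` A \<inter> space N | A. A \<in> sets borel})"
    then obtain s A where s: "s \<in> {0..a}" "A \<in> sets borel" "g = W s -` A \<inter> space N" by blast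
    then have "g = {\<omega>\<in>space N. \<forall>s\<in>{s}. W s \<omega> \<in> (\<lambda>_. A) s}" by auto
    then show "g \<in> G"
      unfolding G_def using s by (intro CollectI exI[of _ "{s}"] exI[of _ "\<lambda>_. A"]) simp
  qed
  have "{X -` A \<inter> space N | A. A \<in> sets borel} \<subseteq> sets (F a)"
  proof (intro subsetI)
    fix B assume "B \<in> {X -` A \<inter> space N | A. A \<in> sets borel}"
    then obtain A where "A \<in> sets borel" "B = X -` A \<inter> space N" by blast
    then show "B \<in> sets (F a)" using measurable_sets[OF X, of A] by (simp only: space_F)
  qed
  then have "sigma_sets (space (F a)) {X -` A \<inter> space N | A. A \<in> sets borel} \<subseteq> sets (F a)"
    by (rule sets.sigma_sets_subset)
  then have XG: "sigma_sets (space N) {X -` A \<inter> space N | A. A \<in> sets borel} \<subseteq> sigma_sets (space N) G"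
    unfolding space_F using F_sub by (rule order_trans)
  have "indep_set (sigma_sets (space N) {X -` A \<inter> space N | A. A \<in> sets borel}) (sigma_sets (space N) H)"
    unfolding indep_sets2_eq
  proof (intro conjI ballI)
    fix g h assume "g \<in> sigma_sets (space N) {X -` A \<inter> space N | A. A \<in> sets borel}" "h \<in> sigma_sets (space N) H"
    then show "prob (g \<inter> h) = prob g * prob h"
      using XG by (intro indep_setD[OF GH]) auto
  qed (use indep_setD_ev1[OF GH] indep_setD_ev2[OF GH] XG in auto)
  then show ?thesis
    unfolding indep_var_eq H_def
    using adapted_measurable[OF X] borel_measurable_diff[OF \<open>W b \<in> borel_measurable N\<close> \<open>W a \<in> borel_measurable N\<close>]
    by (intro conjI)
qed

lemma
  assumes ab: "0 \<le> a" "a < b" and X: "X \<in> borel_measurable (F a)" "integrable N X"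
    and \<phi>[measurable]: "\<phi> \<in> borel_measurable borel" and int: "integrable N (\<lambda>\<omega>. \<phi> (W b \<omega> - W a \<omega>))"
  shows adapted_increment_integrable: "integrable N (\<lambda>\<omega>. X \<omega> * (\<phi> (W b \<omega> - W a \<omega>) :: real))"
    and adapted_increment_expectation: "expectation (\<lambda>\<omega>. X \<omega> * \<phi> (W b \<omega> - W a \<omega>)) = expectation X * expectation (\<lambda>\<omega>. \<phi> (W b \<omega> - W a \<omega>))"
proof -
  have "indep_var borel ((\<lambda>x. x) \<circ> X) borel (\<phi> \<circ> (\<lambda>\<omega>. W b \<omega> - W a \<omega>))"
    by (rule indep_var_compose[OF adapted_indep_increment[OF ab X(1)]]) auto
  then have i: "indep_var borel X borel (\<lambda>\<omega>. \<phi> (W b \<omega> - W a \<omega>))" by (simp add: comp_def)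
  show "integrable N (\<lambda>\<omega>. X \<omega> * \<phi> (W b \<omega> - W a \<omega>))"
    "expectation (\<lambda>\<omega>. X \<omega> * \<phi> (W b \<omega> - W a \<omega>)) = expectation X * expectation (\<lambda>\<omega>. \<phi> (W b \<omega> - W a \<omega>))"
    using indep_var_integrable[OF i X(2) int] indep_var_lebesgue_integral[OF i X(2) int] by auto
qed

lemma increment_moment:
  assumes ab: "0 \<le> a" "a < b"
  shows "integrable N (\<lambda>\<omega>. (W b \<omega> - W a \<omega>) ^ k)"
    and "expectation (\<lambda>\<omega>. (W b \<omega> - W a \<omega>) ^ k) = (if even k then fact k / ((2 / (b - a)) ^ (k div 2) * fact (k div 2)) else 0)"
proof -
  have [measurable]: "W a \<in> borel_measurable N" "W b \<in> borel_measurable N"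
    using ab by (auto intro: W_measurable)
  let ?\<delta> = "normal_density 0 (sqrt (b - a))" and ?c = "if even k then fact k / ((2 / (b - a)) ^ (k div 2) * fact (k div 2)) else 0"
  have law: "distr N borel (\<lambda>\<omega>. W b \<omega> - W a \<omega>) = density lborel (\<lambda>x. ennreal (?\<delta> x))"
    using W_increments_normal[OF ab] ab by (simp add: normal_distribution_def)
  have "has_bochner_integral lborel (\<lambda>x. ?\<delta> x * x ^ k) ?c"
  proof (cases "even k")
    case True
    then show ?thesis using normal_moment_even[of "sqrt (b - a)" 0 "k div 2"] ab by simp
  next
    case False
    then show ?thesis using normal_moment_odd[of "sqrt (b - a)" 0 "k div 2"] ab
      by (simp only: diff_zero odd_two_times_div_two_succ if_False) simp
  qed
  then have "integrable lborel (\<lambda>x. ?\<delta> x * x ^ k)" "(LINT x|lborel. ?\<delta> x * x ^ k) = ?c"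
    by (auto simp: has_bochner_integral_iff)
  moreover have "integrable N (\<lambda>\<omega>. (W b \<omega> - W a \<omega>) ^ k) = integrable lborel (\<lambda>x. ?\<delta> x *\<^sub>R x ^ k)"
  proof -
    have "integrable N (\<lambda>\<omega>. (W b \<omega> - W a \<omega>) ^ k) = integrable (distr N borel (\<lambda>\<omega>. W b \<omega> - W a \<omega>)) (\<lambda>x. x ^ k)"
      by (rule integrable_distr_eq[symmetric]) measurable
    also have "\<dots> = integrable lborel (\<lambda>x. ?\<delta> x *\<^sub>R x ^ k)"
      unfolding law by (rule integrable_density) auto
    finally show ?thesis .
  qed
  moreover have "expectation (\<lambda>\<omega>. (W b \<omega> - W a \<omega>) ^ k) = (LINT x|lborel. ?\<delta> x *\<^sub>R x ^ k)"
  proof -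
    have "expectation (\<lambda>\<omega>. (W b \<omega> - W a \<omega>) ^ k) = (LINT x|distr N borel (\<lambda>\<omega>. W b \<omega> - W a \<omega>). x ^ k)"
      by (rule integral_distr[symmetric]) measurable
    also have "\<dots> = (LINT x|lborel. ?\<delta> x *\<^sub>R x ^ k)"
      unfolding law by (rule integral_density) auto
    finally show ?thesis .
  qed
  ultimately show "integrable N (\<lambda>\<omega>. (W b \<omega> - W a \<omega>) ^ k)" "expectation (\<lambda>\<omega>. (W b \<omega> - W a \<omega>) ^ k) = ?c"
    by (simp_all only: real_scaleR_def)
qed

lemma increment_moments:
  assumes ab: "0 \<le> a" "a < b"
  shows "expectation (\<lambda>\<omega>. W b \<omega> - W a \<omega>) = 0"
    and "expectation (\<lambda>\<omega>. (W b \<omega> - W a \<omega>)\<^sup>2) = b - a"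
    and "expectation (\<lambda>\<omega>. (W b \<omega> - W a \<omega>) ^ 3) = 0"
    and "expectation (\<lambda>\<omega>. (W b \<omega> - W a \<omega>) ^ 4) = 3 * (b - a)\<^sup>2"
proof -
  note m = increment_moment(2)[OF ab]
  show "expectation (\<lambda>\<omega>. W b \<omega> - W a \<omega>) = 0" using m[of 1] by simp
  show "expectation (\<lambda>\<omega>. (W b \<omega> - W a \<omega>)\<^sup>2) = b - a" using m[of 2] ab by simp
  show "expectation (\<lambda>\<omega>. (W b \<omega> - W a \<omega>) ^ 3) = 0" using m[of 3] by simp
  show "expectation (\<lambda>\<omega>. (W b \<omega> - W a \<omega>) ^ 4) = 3 * (b - a)\<^sup>2"
    using m[of 4] ab by (simp add: power_divide fact_numeral)
qed

lemma W_square_integrable: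
  assumes "0 \<le> t"
  shows "integrable N (\<lambda>\<omega>. (W t \<omega>)\<^sup>2)"
proof -
  have [measurable]: "W t \<in> borel_measurable N" "W 0 \<in> borel_measurable N"
    using assms by (auto intro: W_measurable)
  have "integrable N (\<lambda>\<omega>. (W t \<omega> - W 0 \<omega>)\<^sup>2)"
    using increment_moment(1)[of 0 t 2] assms by (cases "t = 0") auto
  moreover have "AE \<omega> in N. (W t \<omega> - W 0 \<omega>)\<^sup>2 = (W t \<omega>)\<^sup>2"
    using W_zero by eventually_elim simp
  ultimately show ?thesis
    by (subst integrable_cong_AE[where g="\<lambda>\<omega>. (W t \<omega> - W 0 \<omega>)\<^sup>2"]) (auto elim: AE_mp)
qed

definition ito_W :: "'b \<Rightarrow> real" where
  "ito_W \<omega> = ((W 1 \<omega>)\<^sup>2 - 1) / 2"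

text \<open>On an interval \<open>{a..b}\<close>, the contribution \<open>h * (W b - W a)\<close> to the elementary integral exceeds the contribution
  \<open>((W b)\<^sup>2 - (W a)\<^sup>2 - (b - a)) / 2\<close> to \<open>((W 1)\<^sup>2 - 1) / 2\<close> by this amount.\<close>
definition step_error :: "real \<Rightarrow> real \<Rightarrow> ('b \<Rightarrow> real) \<Rightarrow> 'b \<Rightarrow> real" where
  "step_error a b h \<omega> = (h \<omega> - W a \<omega>) * (W b \<omega> - W a \<omega>) - ((W b \<omega> - W a \<omega>)\<^sup>2 - (b - a)) / 2"

lemma
  assumes ab: "0 \<le> a" "a < b" and h: "h \<in> borel_measurable (F a)" "integrable N (\<lambda>\<omega>. (h \<omega>)\<^sup>2)"
  shows gap_adapted: "(\<lambda>\<omega>. h \<omega> - W a \<omega>) \<in> borel_measurable (F a)"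
    and gap_square_integrable: "integrable N (\<lambda>\<omega>. (h \<omega> - W a \<omega>)\<^sup>2)"
    and gap_integrable: "integrable N (\<lambda>\<omega>. h \<omega> - W a \<omega>)"
proof -
  show gm: "(\<lambda>\<omega>. h \<omega> - W a \<omega>) \<in> borel_measurable (F a)"
    using h W_adapted[OF ab(1) order_refl] by (intro borel_measurable_diff)
  show g2: "integrable N (\<lambda>\<omega>. (h \<omega> - W a \<omega>)\<^sup>2)"
    by (rule square_integrable_diff[OF adapted_measurable[OF h(1)] W_measurable[OF ab(1)] h(2) W_square_integrable[OF ab(1)]])
  show "integrable N (\<lambda>\<omega>. h \<omega> - W a \<omega>)"
    by (rule square_integrable_imp_integrable[OF adapted_measurable[OF gm] g2])
qed

lemma
  assumes ab: "0 \<le> a" "a < b" and h: "h \<in> borel_measurable (F a)" "integrable N (\<lambda>\<omega>. (h \<omega>)\<^sup>2)"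
  shows step_error_adapted: "step_error a b h \<in> borel_measurable (F b)"
    and step_error_square_integrable: "integrable N (\<lambda>\<omega>. (step_error a b h \<omega>)\<^sup>2)"
    and step_error_second_moment: "expectation (\<lambda>\<omega>. (step_error a b h \<omega>)\<^sup>2)
      = expectation (\<lambda>\<omega>. (h \<omega> - W a \<omega>)\<^sup>2) * (b - a) + (b - a)\<^sup>2 / 2"
    and step_error_orthogonal: "\<And>Y. Y \<in> borel_measurable (F a) \<Longrightarrow> integrable N (\<lambda>\<omega>. (Y \<omega>)\<^sup>2) \<Longrightarrow>
       expectation (\<lambda>\<omega>. Y \<omega> * step_error a b h \<omega>) = 0"
proof -
  define g where "g \<omega> = h \<omega> - W a \<omega>" for \<omega>
  define D where "D \<omega> = W b \<omega> - W a \<omega>" for \<omega>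
  define d where "d = b - a"
  note g = gap_adapted[OF ab h, folded g_def] gap_square_integrable[OF ab h, folded g_def] gap_integrable[OF ab h, folded g_def]
  have gN: "g \<in> borel_measurable N" using adapted_measurable[OF g(1)] .
  have g2F: "(\<lambda>\<omega>. (g \<omega>)\<^sup>2) \<in> borel_measurable (F a)" using g(1) by measurable
  have D_int: "integrable N (\<lambda>\<omega>. (D \<omega>) ^ k)" for k
    unfolding D_def by (rule increment_moment(1)[OF ab])
  have D_mom: "expectation D = 0" "expectation (\<lambda>\<omega>. (D \<omega>)\<^sup>2) = d" "expectation (\<lambda>\<omega>. (D \<omega>) ^ 3) = 0" "expectation (\<lambda>\<omega>. (D \<omega>) ^ 4) = 3 * d\<^sup>2"
    using increment_moments[OF ab] by (simp_all add: D_def[abs_def] d_def)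
  have prod: "integrable N (\<lambda>\<omega>. X \<omega> * (D \<omega>) ^ k)" "expectation (\<lambda>\<omega>. X \<omega> * (D \<omega>) ^ k) = expectation X * expectation (\<lambda>\<omega>. (D \<omega>) ^ k)"
    if "X \<in> borel_measurable (F a)" "integrable N X" for X k
    using adapted_increment_integrable[OF ab that, of "\<lambda>x. x ^ k"] adapted_increment_expectation[OF ab that, of "\<lambda>x. x ^ k"]
      D_int[of k] by (simp_all add: D_def)
  have err: "step_error a b h \<omega> = g \<omega> * D \<omega> - ((D \<omega>)\<^sup>2 - d) / 2" for \<omega>
    by (simp add: step_error_def g_def D_def d_def)
  have DF: "D \<in> borel_measurable (F b)"
    unfolding D_def[abs_def] using ab W_adapted by (intro borel_measurable_diff) auto
  have gF: "g \<in> borel_measurable (F b)"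
    using adapted_mono[OF less_imp_le[OF ab(2)] g(1)] .
  show adapted: "step_error a b h \<in> borel_measurable (F b)"
    unfolding err[abs_def] using DF gF by measurable
  have sq: "(step_error a b h \<omega>)\<^sup>2 = (g \<omega>)\<^sup>2 * (D \<omega>) ^ 2 - g \<omega> * (D \<omega>) ^ 3 + d * (g \<omega> * (D \<omega>) ^ 1) + ((D \<omega>) ^ 4 - 2 * d * (D \<omega>) ^ 2 + d\<^sup>2) / 4" for \<omega>
    unfolding err by (simp add: power2_eq_square power3_eq_cube power4_eq_xxxx field_simps)
  show "integrable N (\<lambda>\<omega>. (step_error a b h \<omega>)\<^sup>2)"
    unfolding sq
    by (intro Bochner_Integration.integrable_add Bochner_Integration.integrable_diff integrable_mult_right integrable_divide
        prod(1) g2F g D_int integrable_const)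
  have "expectation (\<lambda>\<omega>. (step_error a b h \<omega>)\<^sup>2)
    = expectation (\<lambda>\<omega>. (g \<omega>)\<^sup>2 * (D \<omega>) ^ 2) - expectation (\<lambda>\<omega>. g \<omega> * (D \<omega>) ^ 3) + d * expectation (\<lambda>\<omega>. g \<omega> * (D \<omega>) ^ 1)
      + (expectation (\<lambda>\<omega>. (D \<omega>) ^ 4) - 2 * d * expectation (\<lambda>\<omega>. (D \<omega>) ^ 2) + d\<^sup>2) / 4"
  proof -
    have lin: "expectation (\<lambda>\<omega>. x1 \<omega> - x2 \<omega> + d * x3 \<omega> + (x4 \<omega> - 2 * d * x5 \<omega> + d\<^sup>2) / 4)
      = expectation x1 - expectation x2 + d * expectation x3 + (expectation x4 - 2 * d * expectation x5 + d\<^sup>2) / 4"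
      if "integrable N x1" "integrable N x2" "integrable N x3" "integrable N x4" "integrable N x5" for x1 x2 x3 x4 x5 :: "'b \<Rightarrow> real"
      using that by (simp add: prob_space)
    show ?thesis unfolding sq by (intro lin prod(1) g2F g D_int)
  qed
  also have "\<dots> = expectation (\<lambda>\<omega>. (g \<omega>)\<^sup>2) * d + (3 * d\<^sup>2 - 2 * d * d + d\<^sup>2) / 4"
    unfolding prod(2)[OF g2F g(2)] prod(2)[OF g(1,3)] using D_mom by simp
  also have "\<dots> = expectation (\<lambda>\<omega>. (g \<omega>)\<^sup>2) * d + d\<^sup>2 / 2"
    by (simp add: power2_eq_square)
  finally show "expectation (\<lambda>\<omega>. (step_error a b h \<omega>)\<^sup>2) = expectation (\<lambda>\<omega>. (h \<omega> - W a \<omega>)\<^sup>2) * (b - a) + (b - a)\<^sup>2 / 2"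
    by (simp add: g_def d_def)
  fix Y :: "'b \<Rightarrow> real" assume Y: "Y \<in> borel_measurable (F a)" "integrable N (\<lambda>\<omega>. (Y \<omega>)\<^sup>2)"
  have YN: "Y \<in> borel_measurable N" by (rule adapted_measurable[OF Y(1)])
  have Yi: "integrable N Y" by (rule square_integrable_imp_integrable[OF YN Y(2)])
  have Yg: "integrable N (\<lambda>\<omega>. Y \<omega> * g \<omega>)" "(\<lambda>\<omega>. Y \<omega> * g \<omega>) \<in> borel_measurable (F a)"
    using integrable_mult_of_square_integrable[OF YN gN Y(2) g(2)] Y(1) g(1) by auto
  have "expectation (\<lambda>\<omega>. Y \<omega> * step_error a b h \<omega>) = expectation (\<lambda>\<omega>. (Y \<omega> * g \<omega>) * (D \<omega>) ^ 1 - (Y \<omega> * (D \<omega>) ^ 2 - d * Y \<omega>) / 2)"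
    unfolding err by (simp add: field_simps power2_eq_square)
  also have "\<dots> = expectation (\<lambda>\<omega>. (Y \<omega> * g \<omega>) * (D \<omega>) ^ 1) - (expectation (\<lambda>\<omega>. Y \<omega> * (D \<omega>) ^ 2) - d * expectation Y) / 2"
    using prod(1)[OF Yg(2,1), of 1] prod(1)[OF Y(1) Yi, of 2] Yi by simp
  also have "\<dots> = 0"
    unfolding prod(2)[OF Yg(2,1)] prod(2)[OF Y(1) Yi] using D_mom by simp
  finally show "expectation (\<lambda>\<omega>. Y \<omega> * step_error a b h \<omega>) = 0" .
qed

text \<open>By continuity of paths, \<open>W\<close> is the limit of its values at the grid points just below \<open>t\<close>.\<close>
lemma W_jointly_measurable:
  "(\<lambda>(t, \<omega>). W (max 0 t) \<omega>) \<in> borel_measurable (borel \<Otimes>\<^sub>M N)"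
proof (rule borel_measurable_LIMSEQ_real)
  fix k :: nat
  show "(\<lambda>(t, \<omega>). W (real (nat \<lfloor>t * real (Suc k)\<rfloor>) / real (Suc k)) \<omega>) \<in> borel_measurable (borel \<Otimes>\<^sub>M N)"
  proof -
    have "(\<lambda>p. W (real i / real (Suc k)) (snd p)) \<in> borel_measurable (borel \<Otimes>\<^sub>M N)" for i
      by (rule measurable_compose[OF measurable_snd W_measurable]) simp
    moreover have "(\<lambda>p. nat \<lfloor>fst p * real (Suc k)\<rfloor>) \<in> measurable (borel \<Otimes>\<^sub>M N) (count_space UNIV)"
      by measurable
    ultimately show ?thesis
      using measurable_compose_countable[of "\<lambda>i p. W (real i / real (Suc k)) (snd p)" "borel \<Otimes>\<^sub>M N" borel "\<lambda>p. nat \<lfloor>fst p * real (Suc k)\<rfloor>"]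
      by (simp add: case_prod_beta')
  qed
next
  fix p :: "real \<times> 'b" assume "p \<in> space (borel \<Otimes>\<^sub>M N)"
  then obtain t \<omega> where p: "p = (t, \<omega>)" "\<omega> \<in> space N" by (auto simp: space_pair_measure)
  define s where "s k = real (nat \<lfloor>t * real (Suc k)\<rfloor>) / real (Suc k)" for k
  have "s \<longlonglongrightarrow> max 0 t"
  proof (rule tendsto_sandwich)
    show "\<forall>\<^sub>F k in sequentially. max 0 t - 1 / real (Suc k) \<le> s k"
    proof (rule always_eventually, rule allI)
      fix k
      have "max 0 t * real (Suc k) - 1 \<le> real (nat \<lfloor>t * real (Suc k)\<rfloor>)"
      proof (cases "t \<ge> 0")
        case True
        have "real_of_int \<lfloor>t * real (Suc k)\<rfloor> \<le> real (nat \<lfloor>t * real (Suc k)\<rfloor>)" by simp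
        then show ?thesis using True floor_correct[of "t * real (Suc k)"] by (simp only: max_absorb2) linarith
      qed (simp add: max_def)
      then show "max 0 t - 1 / real (Suc k) \<le> s k"
        using divide_right_mono[of "max 0 t * real (Suc k) - 1" "real (nat \<lfloor>t * real (Suc k)\<rfloor>)" "real (Suc k)"]
        unfolding s_def by (simp only: diff_divide_distrib) simp
    qed
    show "\<forall>\<^sub>F k in sequentially. s k \<le> max 0 t"
    proof (rule always_eventually, rule allI)
      fix k
      have "real (nat \<lfloor>t * real (Suc k)\<rfloor>) \<le> max 0 t * real (Suc k)"
      proof (cases "t \<ge> 0")
        case True
        then have "0 \<le> t * real (Suc k)" by simp
        then have "real (nat \<lfloor>t * real (Suc k)\<rfloor>) = real_of_int \<lfloor>t * real (Suc k)\<rfloor>" by simp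
        then show ?thesis using True of_int_floor_le[of "t * real (Suc k)"] by (simp only: max_absorb2)
      next
        case False
        then have "t * real (Suc k) \<le> 0" by (simp add: mult_nonpos_nonneg)
        from floor_mono[OF this] have "nat \<lfloor>t * real (Suc k)\<rfloor> = 0" by (simp only: floor_zero nat_0_iff)
        then show ?thesis using False by (simp add: max_def)
      qed
      then show "s k \<le> max 0 t"
        unfolding s_def by (simp add: divide_le_eq)
    qed
    show "(\<lambda>k. max 0 t - 1 / real (Suc k)) \<longlonglongrightarrow> max 0 t"
      by real_asymp
  qed simp
  moreover have "s k \<ge> 0" for k by (simp add: s_def)
  ultimately have "(\<lambda>k. W (s k) \<omega>) \<longlonglongrightarrow> W (max 0 t) \<omega>"
    by (intro continuous_on_tendsto_compose[OF W_continuous[OF p(2)]]) auto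
  then show "(\<lambda>k. (\<lambda>(t, \<omega>). W (real (nat \<lfloor>t * real (Suc k)\<rfloor>) / real (Suc k)) \<omega>) p) \<longlonglongrightarrow> (\<lambda>(t, \<omega>). W (max 0 t) \<omega>) p"
    by (simp add: p s_def)
qed

lemma gap_second_moment:
  assumes ab: "0 \<le> a" "a < b" and h: "h \<in> borel_measurable (F a)" "integrable N (\<lambda>\<omega>. (h \<omega>)\<^sup>2)"
  shows "(\<integral>\<^sup>+ \<omega>. ennreal ((W b \<omega> - h \<omega>)\<^sup>2) \<partial>N) = ennreal (expectation (\<lambda>\<omega>. (h \<omega> - W a \<omega>)\<^sup>2) + (b - a))"
proof -
  define g where "g \<omega> = h \<omega> - W a \<omega>" for \<omega>
  note g = gap_adapted[OF ab h, folded g_def] gap_square_integrable[OF ab h, folded g_def] gap_integrable[OF ab h, folded g_def]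
  have D2: "integrable N (\<lambda>\<omega>. (W b \<omega> - W a \<omega>)\<^sup>2)" and D1: "integrable N (\<lambda>\<omega>. W b \<omega> - W a \<omega>)"
    using increment_moment(1)[OF ab, of 2] increment_moment(1)[OF ab, of 1] by simp_all
  have gD: "integrable N (\<lambda>\<omega>. g \<omega> * (W b \<omega> - W a \<omega>))" "expectation (\<lambda>\<omega>. g \<omega> * (W b \<omega> - W a \<omega>)) = 0"
    using adapted_increment_integrable[OF ab g(1,3), of "\<lambda>x. x"] adapted_increment_expectation[OF ab g(1,3), of "\<lambda>x. x"]
      D1 increment_moments(1)[OF ab] by simp_all
  have eq: "(W b \<omega> - h \<omega>)\<^sup>2 = (g \<omega>)\<^sup>2 - 2 * (g \<omega> * (W b \<omega> - W a \<omega>)) + (W b \<omega> - W a \<omega>)\<^sup>2" for \<omega>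
    unfolding g_def by (simp add: power2_eq_square algebra_simps)
  have int: "integrable N (\<lambda>\<omega>. (W b \<omega> - h \<omega>)\<^sup>2)"
    unfolding eq by (intro Bochner_Integration.integrable_add Bochner_Integration.integrable_diff integrable_mult_right g gD D2)
  have "expectation (\<lambda>\<omega>. (W b \<omega> - h \<omega>)\<^sup>2) = expectation (\<lambda>\<omega>. (g \<omega>)\<^sup>2) + (b - a)"
    unfolding eq using g gD D2 increment_moments(2)[OF ab] by simp
  then show ?thesis
    using nn_integral_eq_integral[OF int] by (simp add: g_def)
qed

text \<open>The common value of the two squared distances in the isometry, which is a sum over the
  intervals of the partition.\<close>
definition isometry_value :: "nat \<Rightarrow> (nat \<Rightarrow> real) \<Rightarrow> (nat \<Rightarrow> 'b \<Rightarrow> real) \<Rightarrow> real" where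
  "isometry_value m \<tau> h = (\<Sum>i<m. expectation (\<lambda>\<omega>. (h i \<omega> - W (\<tau> i) \<omega>)\<^sup>2) * (\<tau> (Suc i) - \<tau> i) + (\<tau> (Suc i) - \<tau> i)\<^sup>2 / 2)"

lemma partition_mono:
  assumes "\<forall>i<m. \<tau> i < \<tau> (Suc i)" "i \<le> j" "j \<le> m"
  shows "\<tau> i \<le> (\<tau> j :: real)"
  using assms(2,3)
proof (induction j rule: dec_induct)
  case (step j)
  then show ?case using assms(1) by (meson Suc_le_lessD less_imp_le order_trans)
qed simp

context
  fixes m :: nat and \<tau> :: "nat \<Rightarrow> real" and h :: "nat \<Rightarrow> 'b \<Rightarrow> real"
  assumes simple: "simple_integrand N W 1 m \<tau> h"
begin

lemma
  shows \<tau>_0: "\<tau> 0 = 0" and \<tau>_m: "\<tau> m = 1" and \<tau>_less: "\<And>i. i < m \<Longrightarrow> \<tau> i < \<tau> (Suc i)"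
    and h_adapted: "\<And>i. i < m \<Longrightarrow> h i \<in> borel_measurable (F (\<tau> i))"
    and h_sq: "\<And>i. i < m \<Longrightarrow> integrable N (\<lambda>\<omega>. (h i \<omega>)\<^sup>2)"
  using simple by (auto simp: simple_integrand_def)

lemma \<tau>_mono: "i \<le> j \<Longrightarrow> j \<le> m \<Longrightarrow> \<tau> i \<le> \<tau> j"
  by (rule partition_mono) (use \<tau>_less in auto)

lemma \<tau>_nonneg: "i \<le> m \<Longrightarrow> 0 \<le> \<tau> i"
  using \<tau>_mono[of 0 i] by (simp add: \<tau>_0)

text \<open>One half of the isometry: errors over different intervals are orthogonal, since each has conditional
  mean zero given the past.\<close>
lemma ito_error_second_moment:
  "(\<integral>\<^sup>+ \<omega>. ennreal ((ito_W \<omega> - simple_ito_integral W m \<tau> h \<omega>)\<^sup>2) \<partial>N) = ennreal (isometry_value m \<tau> h)"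
proof -
  define E where "E i = step_error (\<tau> i) (\<tau> (Suc i)) (h i)" for i
  note E = step_error_adapted[OF \<tau>_nonneg \<tau>_less h_adapted h_sq, folded E_def]
    step_error_square_integrable[OF \<tau>_nonneg \<tau>_less h_adapted h_sq, folded E_def]
    step_error_second_moment[OF \<tau>_nonneg \<tau>_less h_adapted h_sq, folded E_def]
    step_error_orthogonal[OF \<tau>_nonneg \<tau>_less h_adapted h_sq, folded E_def]
  have EN: "E i \<in> borel_measurable N" if "i < m" for i
    by (rule adapted_measurable[OF E(1)]) (use that in auto)
  have Eint: "integrable N (\<lambda>\<omega>. E i \<omega> * E j \<omega>)" if "i < m" "j < m" for i j
    using integrable_mult_of_square_integrable[OF EN EN E(2) E(2)] that by simp
  have orth_less: "expectation (\<lambda>\<omega>. E i \<omega> * E j \<omega>) = 0" if "i < j" "j < m" for i j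
  proof -
    have "E i \<in> borel_measurable (F (\<tau> j))"
      using E(1)[of i] that by (intro adapted_mono[OF \<tau>_mono[of "Suc i" j]]) auto
    then show ?thesis using E(4)[of j] E(2)[of i] that by simp
  qed
  have orth: "expectation (\<lambda>\<omega>. E i \<omega> * E j \<omega>) = 0" if "i \<noteq> j" "i < m" "j < m" for i j
    using orth_less[of i j] orth_less[of j i] that by (cases "i < j") (auto simp: mult.commute)
  have square: "(\<Sum>i<m. E i \<omega>)\<^sup>2 = (\<Sum>i<m. \<Sum>j<m. E i \<omega> * E j \<omega>)" for \<omega>
    by (simp add: power2_eq_square sum_product)
  have int: "integrable N (\<lambda>\<omega>. (\<Sum>i<m. E i \<omega>)\<^sup>2)"
    unfolding square by (intro Bochner_Integration.integrable_sum Eint) auto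
  have "expectation (\<lambda>\<omega>. (\<Sum>i<m. E i \<omega>)\<^sup>2) = (\<Sum>i<m. \<Sum>j<m. expectation (\<lambda>\<omega>. E i \<omega> * E j \<omega>))"
    unfolding square
    by (subst Bochner_Integration.integral_sum, intro Bochner_Integration.integrable_sum Eint, simp, simp,
        intro sum.cong refl Bochner_Integration.integral_sum Eint, simp, simp)
  also have "\<dots> = (\<Sum>i<m. \<Sum>j<m. if j = i then expectation (\<lambda>\<omega>. (E i \<omega>)\<^sup>2) else 0)"
    by (intro sum.cong refl) (auto simp: orth power2_eq_square)
  also have "\<dots> = (\<Sum>i<m. expectation (\<lambda>\<omega>. (E i \<omega>)\<^sup>2))"
    by (intro sum.cong refl) simp
  also have "\<dots> = isometry_value m \<tau> h"
    unfolding isometry_value_def by (intro sum.cong refl E(3)) auto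
  finally have val: "expectation (\<lambda>\<omega>. (\<Sum>i<m. E i \<omega>)\<^sup>2) = isometry_value m \<tau> h" .
  have "AE \<omega> in N. (ito_W \<omega> - simple_ito_integral W m \<tau> h \<omega>)\<^sup>2 = (\<Sum>i<m. E i \<omega>)\<^sup>2"
    using W_zero
  proof eventually_elim
    case (elim \<omega>)
    have "(\<Sum>i<m. (W (\<tau> (Suc i)) \<omega>)\<^sup>2 - (W (\<tau> i) \<omega>)\<^sup>2) = (W 1 \<omega>)\<^sup>2"
      by (subst sum_lessThan_telescope) (simp add: \<tau>_0 \<tau>_m elim)
    moreover have "(\<Sum>i<m. \<tau> (Suc i) - \<tau> i) = 1"
      by (subst sum_lessThan_telescope) (simp add: \<tau>_0 \<tau>_m)
    ultimately have J: "ito_W \<omega> = ((\<Sum>i<m. (W (\<tau> (Suc i)) \<omega>)\<^sup>2 - (W (\<tau> i) \<omega>)\<^sup>2) - (\<Sum>i<m. \<tau> (Suc i) - \<tau> i)) / 2"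
      by (simp only: ito_W_def)
    have "simple_ito_integral W m \<tau> h \<omega> - ito_W \<omega> = (\<Sum>i<m. E i \<omega>)"
      unfolding simple_ito_integral_def J diff_divide_distrib sum_divide_distrib sum_subtractf[symmetric]
      by (intro sum.cong refl) (simp add: E_def step_error_def power2_eq_square field_simps)
    then show ?case by (metis power2_commute)
  qed
  then have "(\<integral>\<^sup>+ \<omega>. ennreal ((ito_W \<omega> - simple_ito_integral W m \<tau> h \<omega>)\<^sup>2) \<partial>N) = (\<integral>\<^sup>+ \<omega>. ennreal ((\<Sum>i<m. E i \<omega>)\<^sup>2) \<partial>N)"
    by (intro nn_integral_cong_AE) auto
  also have "\<dots> = ennreal (isometry_value m \<tau> h)"
    using nn_integral_eq_integral[OF int] val by simp
  finally show ?thesis .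
qed

lemma partition_cell:
  assumes "0 < t" "t \<le> 1"
  obtains i where "i < m" "\<tau> i < t" "t \<le> \<tau> (Suc i)"
proof -
  have "\<exists>i<k. \<tau> i < t \<and> t \<le> \<tau> (Suc i)" if "t \<le> \<tau> k" for k
    using that
  proof (induction k)
    case 0
    then show ?case using assms by (simp add: \<tau>_0)
  next
    case (Suc k)
    then show ?case by (cases "t \<le> \<tau> k") (auto simp: less_Suc_eq)
  qed
  from this[of m] show thesis using assms that by (auto simp: \<tau>_m)
qed

lemma cell_unique:
  assumes "i < m" "\<tau> i < t" "t \<le> \<tau> (Suc i)" "j < m"
  shows "t \<in> {\<tau> j<..\<tau> (Suc j)} \<longleftrightarrow> j = i"
  using assms \<tau>_mono[of "Suc i" j] \<tau>_mono[of "Suc j" i] by (cases i j rule: linorder_cases) auto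

lemma sum_cell:
  assumes "i < m" "\<tau> i < t" "t \<le> \<tau> (Suc i)"
  shows "(\<Sum>j<m. c j * indicator {\<tau> j<..\<tau> (Suc j)} t) = (c i :: 'z :: semiring_1)"
proof -
  have "(\<Sum>j<m. c j * indicator {\<tau> j<..\<tau> (Suc j)} t) = (\<Sum>j<m. if j = i then c j else 0)"
    using cell_unique[OF assms] by (intro sum.cong refl) (auto simp: indicator_def)
  then show ?thesis using assms(1) by simp
qed

text \<open>The other half of the isometry: for \<open>t\<close> in the interval that starts at \<open>a\<close>, the second moment of \<open>W t - h\<close> is
  that of \<open>h - W a\<close> plus \<open>t - a\<close>; integrate over \<open>t\<close>.\<close>
lemma process_error_second_moment:
  "(\<integral>\<^sup>+ \<omega>. (\<integral>\<^sup>+ t\<in>{0..1}. ennreal ((W t \<omega> - simple_process m \<tau> h t \<omega>)\<^sup>2) \<partial>lborel) \<partial>N) = ennreal (isometry_value m \<tau> h)"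
proof -
  interpret P: pair_sigma_finite lborel N ..
  let ?f = "\<lambda>t \<omega>. ennreal ((W (max 0 t) \<omega> - simple_process m \<tau> h t \<omega>)\<^sup>2) * indicator {0..1} t"
  let ?c = "\<lambda>i. expectation (\<lambda>\<omega>. (h i \<omega> - W (\<tau> i) \<omega>)\<^sup>2)"
  have hN: "h i \<in> borel_measurable N" if "i < m" for i
    by (rule adapted_measurable[OF h_adapted[OF that]])
  have [measurable]: "(\<lambda>p. W (max 0 (fst p)) (snd p)) \<in> borel_measurable (lborel \<Otimes>\<^sub>M N)"
    using W_jointly_measurable by (simp add: case_prod_beta' cong: measurable_cong_sets)
  have [measurable]: "(\<lambda>p. simple_process m \<tau> h (fst p) (snd p)) \<in> borel_measurable (lborel \<Otimes>\<^sub>M N)"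
    unfolding simple_process_def
    by (intro borel_measurable_sum borel_measurable_times measurable_compose[OF measurable_snd hN]
        measurable_compose[OF measurable_fst borel_measurable_indicator]) auto
  have meas: "case_prod ?f \<in> borel_measurable (lborel \<Otimes>\<^sub>M N)"
    unfolding case_prod_beta' by measurable
  have "(\<integral>\<^sup>+ \<omega>. (\<integral>\<^sup>+ t\<in>{0..1}. ennreal ((W t \<omega> - simple_process m \<tau> h t \<omega>)\<^sup>2) \<partial>lborel) \<partial>N) = (\<integral>\<^sup>+ \<omega>. (\<integral>\<^sup>+ t. ?f t \<omega> \<partial>lborel) \<partial>N)"
    by (intro nn_integral_cong) (auto simp: indicator_def max_def)
  also have "\<dots> = (\<integral>\<^sup>+ t. (\<integral>\<^sup>+ \<omega>. ?f t \<omega> \<partial>N) \<partial>lborel)"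
    by (rule P.Fubini'[OF meas])
  also have "\<dots> = (\<integral>\<^sup>+ t. (\<Sum>i<m. ennreal (?c i + (t - \<tau> i)) * indicator {\<tau> i..\<tau> (Suc i)} t) \<partial>lborel)"
  proof (rule nn_integral_cong_AE)
    have "AE t in lborel. \<forall>i\<in>{..m}. t \<noteq> \<tau> i"
      by (rule AE_finite_allI) (auto intro: AE_lborel_singleton)
    then show "AE t in lborel. (\<integral>\<^sup>+ \<omega>. ?f t \<omega> \<partial>N) = (\<Sum>i<m. ennreal (?c i + (t - \<tau> i)) * indicator {\<tau> i..\<tau> (Suc i)} t)"
    proof eventually_elim
      case (elim t)
      have half_open: "(\<Sum>i<m. ennreal (?c i + (t - \<tau> i)) * indicator {\<tau> i..\<tau> (Suc i)} t)
        = (\<Sum>i<m. ennreal (?c i + (t - \<tau> i)) * indicator {\<tau> i<..\<tau> (Suc i)} t)"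
        using elim by (intro sum.cong refl) (auto simp: indicator_def)
      show ?case
      proof (cases "0 < t \<and> t \<le> 1")
        case True
        then obtain i where i: "i < m" "\<tau> i < t" "t \<le> \<tau> (Suc i)" using partition_cell[of t] by blast
        have "simple_process m \<tau> h t \<omega> = h i \<omega>" for \<omega>
          unfolding simple_process_def by (rule sum_cell[OF i])
        then have "(\<integral>\<^sup>+ \<omega>. ?f t \<omega> \<partial>N) = (\<integral>\<^sup>+ \<omega>. ennreal ((W t \<omega> - h i \<omega>)\<^sup>2) \<partial>N)"
          using True by simp
        also have "\<dots> = ennreal (?c i + (t - \<tau> i))"
          by (rule gap_second_moment[OF \<tau>_nonneg i(2) h_adapted[OF i(1)] h_sq[OF i(1)]]) (use i in simp)
        finally show ?thesis unfolding half_open sum_cell[OF i] .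
      next
        case False
        have "t \<noteq> 0" using elim \<tau>_0 by auto
        with False have t: "t < 0 \<or> 1 < t" by auto
        have "indicator {\<tau> i<..\<tau> (Suc i)} t = (0 :: ennreal)" if "i < m" for i
          using t \<tau>_nonneg[of i] \<tau>_mono[of "Suc i" m] that by (auto simp: indicator_def \<tau>_m)
        then have "(\<Sum>i<m. ennreal (?c i + (t - \<tau> i)) * indicator {\<tau> i<..\<tau> (Suc i)} t) = 0"
          by (intro sum.neutral) auto
        moreover have "(\<integral>\<^sup>+ \<omega>. ?f t \<omega> \<partial>N) = 0" using t by auto
        ultimately show ?thesis unfolding half_open by simp
      qed
    qed
  qed
  also have "\<dots> = (\<Sum>i<m. (\<integral>\<^sup>+ t. ennreal (?c i + (t - \<tau> i)) * indicator {\<tau> i..\<tau> (Suc i)} t \<partial>lborel))"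
    by (rule nn_integral_sum) measurable
  also have "\<dots> = (\<Sum>i<m. ennreal (?c i * (\<tau> (Suc i) - \<tau> i) + (\<tau> (Suc i) - \<tau> i)\<^sup>2 / 2))"
  proof (intro sum.cong refl)
    fix i assume "i \<in> {..<m}"
    then have i: "i < m" by simp
    have c: "?c i \<ge> 0" by simp
    have "(\<integral>\<^sup>+ t. ennreal (?c i + (t - \<tau> i)) * indicator {\<tau> i..\<tau> (Suc i)} t \<partial>lborel)
      = ennreal ((?c i * \<tau> (Suc i) + (\<tau> (Suc i) - \<tau> i)\<^sup>2 / 2) - (?c i * \<tau> i + (\<tau> i - \<tau> i)\<^sup>2 / 2))"
    proof (rule nn_integral_FTC_Icc)
      show "\<tau> i \<le> \<tau> (Suc i)" using \<tau>_less[OF i] by simp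
      fix t assume t: "t \<in> {\<tau> i..\<tau> (Suc i)}"
      show "0 \<le> ?c i + (t - \<tau> i)" using c t by (intro add_nonneg_nonneg) auto
      show "((\<lambda>t. ?c i * t + (t - \<tau> i)\<^sup>2 / 2) has_real_derivative ?c i + (t - \<tau> i)) (at t)"
        by (auto intro!: derivative_eq_intros)
    qed simp
    also have "(?c i * \<tau> (Suc i) + (\<tau> (Suc i) - \<tau> i)\<^sup>2 / 2) - (?c i * \<tau> i + (\<tau> i - \<tau> i)\<^sup>2 / 2) = ?c i * (\<tau> (Suc i) - \<tau> i) + (\<tau> (Suc i) - \<tau> i)\<^sup>2 / 2"
      by (simp add: algebra_simps)
    finally show "(\<integral>\<^sup>+ t. ennreal (?c i + (t - \<tau> i)) * indicator {\<tau> i..\<tau> (Suc i)} t \<partial>lborel) = ennreal (?c i * (\<tau> (Suc i) - \<tau> i) + (\<tau> (Suc i) - \<tau> i)\<^sup>2 / 2)" .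
  qed
  also have "\<dots> = ennreal (isometry_value m \<tau> h)"
    unfolding isometry_value_def using \<tau>_less by (intro sum_ennreal add_nonneg_nonneg mult_nonneg_nonneg) (auto simp: less_imp_le)
  finally show ?thesis .
qed

end

lemma W_restrict_measurable: "(\<lambda>(t, \<omega>). W t \<omega>) \<in> borel_measurable (restrict_space lborel {0..T} \<Otimes>\<^sub>M N)"
proof -
  let ?R = "restrict_space lborel {0..T} \<Otimes>\<^sub>M N"
  have "(\<lambda>p. p) \<in> measurable ?R (borel \<Otimes>\<^sub>M N)"
  proof (rule measurable_pair)
    have "fst \<in> measurable ?R (restrict_space lborel {0..T})" by measurable
    moreover have "(\<lambda>x. x) \<in> measurable (restrict_space lborel {0..T}) borel"
      by (rule measurable_restrict_space1) simp
    ultimately show "fst \<circ> (\<lambda>p. p) \<in> measurable ?R borel"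
      using measurable_compose by (fastforce simp: comp_def)
    show "snd \<circ> (\<lambda>p. p) \<in> measurable ?R N" by (simp add: comp_def)
  qed
  then have "(\<lambda>p. (\<lambda>(t, \<omega>). W (max 0 t) \<omega>) p) \<in> borel_measurable ?R"
    using W_jointly_measurable by (rule measurable_compose)
  then show ?thesis
    by (subst measurable_cong[where g="\<lambda>p. (\<lambda>(t, \<omega>). W (max 0 t) \<omega>) p"]) (auto simp: space_pair_measure space_restrict_space)
qed

lemma ito_W_measurable[measurable]: "ito_W \<in> borel_measurable N"
  unfolding ito_W_def[abs_def] using W_measurable[of 1] by simp

text \<open>For the integrand that equals \<open>W\<close> at the left endpoint of each of \<open>r + 1\<close> equal intervals, both distances of
  the isometry have square \<open>1 / (2 * (r + 1))\<close>.\<close>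
lemma is_ito_integral_ito_W: "is_ito_integral N W 1 W ito_W"
proof -
  define \<tau> where "\<tau> r i = real i / real (Suc r)" for r i
  have simple: "simple_integrand N W 1 (Suc r) (\<tau> r) (\<lambda>i. W (\<tau> r i))" for r
    unfolding simple_integrand_def \<tau>_def
    by (auto simp: divide_strict_right_mono intro!: W_adapted W_square_integrable)
  have val: "isometry_value (Suc r) (\<tau> r) (\<lambda>i. W (\<tau> r i)) = 1 / (2 * real (Suc r))" for r
  proof -
    have "\<tau> r (Suc i) - \<tau> r i = 1 / real (Suc r)" for i
      by (simp add: \<tau>_def field_simps)
    then have "isometry_value (Suc r) (\<tau> r) (\<lambda>i. W (\<tau> r i)) = (\<Sum>i<Suc r. (1 / real (Suc r))\<^sup>2 / 2)"
      unfolding isometry_value_def by simp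
    also have "\<dots> = real (Suc r) * ((1 / real (Suc r))\<^sup>2 / 2)"
      by (simp only: sum_constant card_lessThan)
    also have "\<dots> = 1 / (2 * real (Suc r))"
      by (simp add: power2_eq_square divide_simps)
    finally show ?thesis .
  qed
  have lim: "(\<lambda>r. ennreal (1 / (2 * real (Suc r)))) \<longlonglongrightarrow> 0"
  proof -
    have "(\<lambda>r. 1 / (2 * real (Suc r))) \<longlonglongrightarrow> 0" by real_asymp
    from tendsto_ennrealI[OF this] show ?thesis by simp
  qed
  show ?thesis
    unfolding is_ito_integral_def
    by (intro conjI ito_W_measurable W_restrict_measurable exI[of _ Suc] exI[of _ \<tau>] exI[of _ "\<lambda>r i. W (\<tau> r i)"] allI simple)
       (simp_all only: process_error_second_moment[OF simple] ito_error_second_moment[OF simple] val lim)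
qed

text \<open>Whatever simple integrands approximate \<open>W\<close>, by the isometry their elementary integrals also converge to
  \<open>ito_W\<close>.\<close>
lemma ito_integral_W_unique:
  assumes I: "is_ito_integral N W 1 W I"
  shows "AE \<omega> in N. I \<omega> = ito_W \<omega>"
proof -
  have [measurable]: "I \<in> borel_measurable N" using I by (simp add: is_ito_integral_def)
  obtain m \<tau> h where simple: "\<And>r::nat. simple_integrand N W 1 (m r) (\<tau> r) (h r)"
    and H: "(\<lambda>r. \<integral>\<^sup>+ \<omega>. (\<integral>\<^sup>+ t\<in>{0..1}. ennreal ((W t \<omega> - simple_process (m r) (\<tau> r) (h r) t \<omega>)\<^sup>2) \<partial>lborel) \<partial>N) \<longlonglongrightarrow> 0"
    and S: "(\<lambda>r. \<integral>\<^sup>+ \<omega>. ennreal ((I \<omega> - simple_ito_integral W (m r) (\<tau> r) (h r) \<omega>)\<^sup>2) \<partial>N) \<longlonglongrightarrow> 0"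
    using I unfolding is_ito_integral_def by blast
  let ?S = "\<lambda>r. simple_ito_integral W (m r) (\<tau> r) (h r)"
  have Sm: "?S r \<in> borel_measurable N" for r
  proof -
    have "\<tau> r i \<ge> 0" if "i \<le> m r" for i
      using \<tau>_nonneg[OF simple that] .
    then show ?thesis
      unfolding simple_ito_integral_def[abs_def]
      by (intro borel_measurable_sum borel_measurable_times borel_measurable_diff W_measurable adapted_measurable[OF h_adapted[OF simple]]) auto
  qed
  have J: "(\<lambda>r. \<integral>\<^sup>+ \<omega>. ennreal ((ito_W \<omega> - ?S r \<omega>)\<^sup>2) \<partial>N) \<longlonglongrightarrow> 0"
    using H by (simp only: process_error_second_moment[OF simple] ito_error_second_moment[OF simple])
  have bound: "(\<integral>\<^sup>+ \<omega>. ennreal ((I \<omega> - ito_W \<omega>)\<^sup>2) \<partial>N)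
    \<le> 2 * (\<integral>\<^sup>+ \<omega>. ennreal ((I \<omega> - ?S r \<omega>)\<^sup>2) \<partial>N) + 2 * (\<integral>\<^sup>+ \<omega>. ennreal ((ito_W \<omega> - ?S r \<omega>)\<^sup>2) \<partial>N)" for r
  proof -
    have "(x - y)\<^sup>2 \<le> 2 * (x - z)\<^sup>2 + 2 * (y - z)\<^sup>2" for x y z :: real
      using zero_le_power2[of "(x - z) + (y - z)"] by (simp add: power2_eq_square algebra_simps)
    then have "ennreal ((x - y)\<^sup>2) \<le> ennreal (2 * (x - z)\<^sup>2 + 2 * (y - z)\<^sup>2)" for x y z :: real
      by (rule ennreal_leI)
    then have "ennreal ((x - y)\<^sup>2) \<le> 2 * ennreal ((x - z)\<^sup>2) + 2 * ennreal ((y - z)\<^sup>2)" for x y z :: real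
      by (simp add: ennreal_mult)
    then have "(\<integral>\<^sup>+ \<omega>. ennreal ((I \<omega> - ito_W \<omega>)\<^sup>2) \<partial>N)
      \<le> (\<integral>\<^sup>+ \<omega>. 2 * ennreal ((I \<omega> - ?S r \<omega>)\<^sup>2) + 2 * ennreal ((ito_W \<omega> - ?S r \<omega>)\<^sup>2) \<partial>N)"
      by (intro nn_integral_mono) auto
    also have "\<dots> = 2 * (\<integral>\<^sup>+ \<omega>. ennreal ((I \<omega> - ?S r \<omega>)\<^sup>2) \<partial>N) + 2 * (\<integral>\<^sup>+ \<omega>. ennreal ((ito_W \<omega> - ?S r \<omega>)\<^sup>2) \<partial>N)"
      using Sm[of r] by (subst nn_integral_add) (auto simp: nn_integral_cmult)
    finally show ?thesis .
  qed
  have "(\<lambda>r. 2 * (\<integral>\<^sup>+ \<omega>. ennreal ((I \<omega> - ?S r \<omega>)\<^sup>2) \<partial>N) + 2 * (\<integral>\<^sup>+ \<omega>. ennreal ((ito_W \<omega> - ?S r \<omega>)\<^sup>2) \<partial>N)) \<longlonglongrightarrow> 2 * 0 + 2 * 0"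
    by (intro tendsto_add ennreal_tendsto_cmult S J) auto
  then have "(\<integral>\<^sup>+ \<omega>. ennreal ((I \<omega> - ito_W \<omega>)\<^sup>2) \<partial>N) \<le> 2 * 0 + 2 * 0"
    by (rule LIMSEQ_le_const) (use bound in auto)
  then have "(\<integral>\<^sup>+ \<omega>. ennreal ((I \<omega> - ito_W \<omega>)\<^sup>2) \<partial>N) = 0" by simp
  then have "AE \<omega> in N. ennreal ((I \<omega> - ito_W \<omega>)\<^sup>2) = 0"
    by (subst (asm) nn_integral_0_iff_AE) auto
  then show ?thesis
    by eventually_elim (simp add: ennreal_eq_0_iff)
qed

theorem ito_integral_W:
  "ito_integral N W 1 W \<in> borel_measurable N"
  "AE \<omega> in N. ito_integral N W 1 W \<omega> = ((W 1 \<omega>)\<^sup>2 - 1) / 2"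
proof -
  have I: "is_ito_integral N W 1 W (ito_integral N W 1 W)"
    unfolding ito_integral_def by (rule someI[where P="is_ito_integral N W 1 W", OF is_ito_integral_ito_W])
  then show "ito_integral N W 1 W \<in> borel_measurable N" by (simp add: is_ito_integral_def)
  show "AE \<omega> in N. ito_integral N W 1 W \<omega> = ((W 1 \<omega>)\<^sup>2 - 1) / 2"
    using ito_integral_W_unique[OF I] by (simp add: ito_W_def)
qed

end

section \<open>Asymptotics of the regression sums\<close>

lemma (in prob_space) bounded_in_prob_cmult:
  assumes "bounded_in_prob M Y"
  shows "bounded_in_prob M (\<lambda>n \<omega>. c * Y n \<omega>)"
  by (rule bounded_in_prob_mult[OF bounded_in_prob_of_conv_prob[of "\<lambda>_ _. c" c] assms]) simp

text \<open>A limit law on the positive half-line keeps the sequence away from zero: test with continuous functions below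
  the indicator of \<open>{1 / K<..}\<close> that increase to the indicator of \<open>{0<..}\<close>.\<close>
lemma (in prob_space) eventually_inverse_bounded:
  fixes Y :: "nat \<Rightarrow> 'a \<Rightarrow> real"
  assumes [measurable]: "\<And>n. Y n \<in> borel_measurable M"
    and \<nu>: "real_distribution \<nu>"
    and Y: "weak_conv_m (\<lambda>n. distr M borel (Y n)) \<nu>"
    and pos: "AE y in \<nu>. y > 0"
  shows "bounded_in_prob M (\<lambda>n \<omega>. 1 / Y n \<omega>)" and "\<forall>\<^sub>F p in in_prob M. Y (fst p) (snd p) > 0"
proof -
  have key: "\<exists>K>0. \<forall>\<^sub>F n in sequentially. \<exists>A\<in>events. prob A \<ge> 1 - \<delta> \<and> (\<forall>\<omega>\<in>A. Y n \<omega> > 1 / K)" if d: "\<delta> > 0" for \<delta>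
  proof -
    \<comment> \<open>The test functions vanish on \<open>{..1 / (K + 1)}\<close> and increase to the indicator of \<open>{0<..}\<close>.\<close>
    define f where "f K y = min 1 (max 0 (real (Suc K) * y - 1))" for K :: nat and y :: real
    interpret \<nu>: real_distribution \<nu> by (rule \<nu>)
    have cont: "isCont (f K) y" for K y
      unfolding f_def by (intro continuous_intros)
    have bnd: "norm (f K y) \<le> 1" for K y
      by (auto simp: f_def)
    have [measurable]: "f K \<in> borel_measurable borel" for K
      unfolding f_def by measurable
    have lim: "(\<lambda>K. f K y) \<longlonglongrightarrow> 1" if "y > 0" for y
    proof (rule tendsto_eventually)
      obtain K0 :: nat where K0: "2 / y \<le> real K0" using real_arch_simple by blast
      show "\<forall>\<^sub>F K in sequentially. f K y = 1"
      proof (rule eventually_sequentiallyI[of K0])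
        fix K assume "K0 \<le> K"
        with K0 have "2 / y \<le> real (Suc K)" by simp
        then have "2 \<le> real (Suc K) * y" using that by (simp add: divide_le_eq)
        then show "f K y = 1" by (simp add: f_def)
      qed
    qed
    have "(\<lambda>K. integral\<^sup>L \<nu> (f K)) \<longlonglongrightarrow> (LINT y|\<nu>. 1)"
    proof (rule integral_dominated_convergence[where w="\<lambda>_. 1"])
      show "AE y in \<nu>. (\<lambda>K. f K y) \<longlonglongrightarrow> 1"
        using pos by eventually_elim (rule lim)
    qed (use bnd in auto)
    then have "\<forall>\<^sub>F K in sequentially. integral\<^sup>L \<nu> (f K) > 1 - \<delta>"
      using d \<nu>.prob_space by (intro order_tendstoD(1)) auto
    then obtain K where "integral\<^sup>L \<nu> (f K) > 1 - \<delta>"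
      by (auto simp: eventually_sequentially)
    moreover have "(\<lambda>n. integral\<^sup>L (distr M borel (Y n)) (f K)) \<longlonglongrightarrow> integral\<^sup>L \<nu> (f K)"
      by (rule weak_conv_imp_integral_bdd_continuous_conv[OF _ \<nu> Y cont bnd]) auto
    ultimately have "\<forall>\<^sub>F n in sequentially. integral\<^sup>L (distr M borel (Y n)) (f K) > 1 - \<delta>"
      by (intro order_tendstoD(1)) auto
    then have "\<forall>\<^sub>F n in sequentially. \<exists>A\<in>events. prob A \<ge> 1 - \<delta> \<and> (\<forall>\<omega>\<in>A. Y n \<omega> > 1 / real (Suc K))"
    proof eventually_elim
      case (elim n)
      let ?A = "{\<omega>\<in>space M. Y n \<omega> > 1 / real (Suc K)}"
      have le: "f K y \<le> indicator {1 / real (Suc K)<..} y" for y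
        by (auto simp: f_def indicator_def not_less field_simps)
      have "integral\<^sup>L (distr M borel (Y n)) (f K) = expectation (\<lambda>\<omega>. f K (Y n \<omega>))"
        by (simp add: integral_distr)
      also have "\<dots> \<le> expectation (indicator ?A)"
      proof (rule integral_mono)
        show "integrable M (\<lambda>\<omega>. f K (Y n \<omega>))"
          by (rule integrable_const_bound[of _ 1]) (use bnd in auto)
        show "f K (Y n \<omega>) \<le> indicator ?A \<omega>" if "\<omega> \<in> space M" for \<omega>
          using le[of "Y n \<omega>"] that by (simp add: indicator_def)
      qed (auto simp: less_top[symmetric])
      also have "\<dots> = prob ?A" by simp
      finally show ?case using elim by (intro bexI[of _ ?A]) auto
    qed
    then show ?thesis by (intro exI[of _ "real (Suc K)"]) auto
  qed
  show "bounded_in_prob M (\<lambda>n \<omega>. 1 / Y n \<omega>)"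
    unfolding bounded_in_prob_def
  proof (intro allI impI)
    fix \<delta> :: real assume "\<delta> > 0"
    then obtain K where K: "K > 0" "\<forall>\<^sub>F n in sequentially. \<exists>A\<in>events. prob A \<ge> 1 - \<delta> \<and> (\<forall>\<omega>\<in>A. Y n \<omega> > 1 / K)"
      using key by blast
    have inv: "\<bar>1 / y\<bar> \<le> K" if "y > 1 / K" for y :: real
    proof -
      have "y > 0" using that K(1) less_trans[of 0 "1 / K" y] by simp
      then show ?thesis using that K(1) by (simp add: field_simps)
    qed
    show "\<exists>K. \<forall>\<^sub>F n in sequentially. \<exists>A\<in>events. prob A \<ge> 1 - \<delta> \<and> (\<forall>\<omega>\<in>A. \<bar>1 / Y n \<omega>\<bar> \<le> K)"
      using K(2) inv by (intro exI[of _ K]) (auto elim!: eventually_mono)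
  qed
  show "\<forall>\<^sub>F p in in_prob M. Y (fst p) (snd p) > 0"
    unfolding eventually_in_prob
  proof (intro allI impI)
    fix \<delta> :: real assume "\<delta> > 0"
    then obtain K where K: "K > 0" and ev: "\<forall>\<^sub>F n in sequentially. \<exists>A\<in>events. prob A \<ge> 1 - \<delta> \<and> (\<forall>\<omega>\<in>A. Y n \<omega> > 1 / K)"
      using key by blast
    have "y > 0" if "y > 1 / K" for y :: real
      using that K less_trans[of 0 "1 / K" y] by simp
    then show "\<forall>\<^sub>F n in sequentially. \<exists>A\<in>events. prob A \<ge> 1 - \<delta> \<and> (\<forall>\<omega>\<in>A. Y (fst (n, \<omega>)) (snd (n, \<omega>)) > 0)"
      using ev by (auto elim!: eventually_mono)
  qed
qed

lemma sqrt_mult_sqrt_left: "0 \<le> a \<Longrightarrow> sqrt a * (sqrt a * x) = a * x"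
  by (simp flip: mult.assoc)

context signed_walk
begin

lemma expectation_abs_T_le:
  assumes "i \<le> n" "n > 0"
  shows "expectation (\<lambda>\<omega>. \<bar>T i \<omega>\<bar>) \<le> (\<sigma>2 + 1) / 2 * sqrt n"
proof -
  have "expectation (\<lambda>\<omega>. \<bar>T i \<omega>\<bar>) \<le> (1 / sqrt n * (\<sigma>2 * i) + 1 / (1 / sqrt n)) / 2"
    using expectation_abs_le_L2[OF T_meas T_second_moment(1), of "1 / sqrt n" i] assms by (simp add: T_second_moment)
  also have "\<dots> \<le> (1 / sqrt n * (\<sigma>2 * n) + 1 / (1 / sqrt n)) / 2"
    using assms \<sigma>2_nonneg by (intro divide_right_mono add_mono mult_left_mono) auto
  also have "\<dots> = (\<sigma>2 + 1) / 2 * sqrt n"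
    using assms by (simp add: field_simps sqrt_mult_sqrt_left)
  finally show ?thesis .
qed

text \<open>Since \<open>T i\<close> is of order \<open>sqrt n\<close> in \<open>L\<^sup>1\<close> for all \<open>i \<le> n\<close>, sums of \<open>n\<close> terms are of order \<open>n * sqrt n\<close>.\<close>
lemma weighted_walk_sum_L1:
  assumes w: "\<And>i. i < n \<Longrightarrow> \<bar>w i\<bar> \<le> c" and n: "n > 0"
  shows "integrable M (\<lambda>\<omega>. \<Sum>i<n. w i * T i \<omega>)"
    and "expectation (\<lambda>\<omega>. \<bar>\<Sum>i<n. w i * T i \<omega>\<bar>) \<le> c * ((\<sigma>2 + 1) / 2) * (n * sqrt n)"
proof -
  show int: "integrable M (\<lambda>\<omega>. \<Sum>i<n. w i * T i \<omega>)"
    by (intro Bochner_Integration.integrable_sum integrable_mult_right T_integrable)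
  have "expectation (\<lambda>\<omega>. \<bar>\<Sum>i<n. w i * T i \<omega>\<bar>) \<le> expectation (\<lambda>\<omega>. \<Sum>i<n. c * \<bar>T i \<omega>\<bar>)"
  proof (rule integral_mono)
    fix \<omega>
    show "\<bar>\<Sum>i<n. w i * T i \<omega>\<bar> \<le> (\<Sum>i<n. c * \<bar>T i \<omega>\<bar>)"
      using w by (intro order_trans[OF sum_abs] sum_mono) (auto simp: abs_mult intro!: mult_right_mono)
    show "integrable M (\<lambda>\<omega>. \<Sum>i<n. c * \<bar>T i \<omega>\<bar>)"
      by (intro Bochner_Integration.integrable_sum integrable_mult_right integrable_abs T_integrable)
  qed (rule integrable_abs[OF int])
  also have "\<dots> = (\<Sum>i<n. c * expectation (\<lambda>\<omega>. \<bar>T i \<omega>\<bar>))"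
    using T_integrable by simp
  also have "\<dots> \<le> (\<Sum>i<n. c * ((\<sigma>2 + 1) / 2 * sqrt n))"
    using w[OF n] by (intro sum_mono mult_left_mono expectation_abs_T_le) (auto intro: order_trans[OF abs_ge_zero] n)
  also have "\<dots> = c * ((\<sigma>2 + 1) / 2) * (n * sqrt n)" by simp
  finally show "expectation (\<lambda>\<omega>. \<bar>\<Sum>i<n. w i * T i \<omega>\<bar>) \<le> c * ((\<sigma>2 + 1) / 2) * (n * sqrt n)" .
qed

lemma conv_prob_T_sum: "conv_prob M (\<lambda>n \<omega>. (\<Sum>i<n. T i \<omega>) / (real n)\<^sup>2) 0"
proof (rule conv_prob_of_L1_bound)
  fix n :: nat
  show "integrable M (\<lambda>\<omega>. (\<Sum>i<n. T i \<omega>) / (real n)\<^sup>2)"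
    by (intro integrable_divide Bochner_Integration.integrable_sum T_integrable)
  show "expectation (\<lambda>\<omega>. \<bar>(\<Sum>i<n. T i \<omega>) / (real n)\<^sup>2\<bar>) \<le> (\<sigma>2 + 1) / 2 / sqrt n"
  proof (cases "n = 0")
    case False
    have "expectation (\<lambda>\<omega>. \<bar>(\<Sum>i<n. T i \<omega>) / (real n)\<^sup>2\<bar>) = expectation (\<lambda>\<omega>. \<bar>\<Sum>i<n. 1 * T i \<omega>\<bar>) / (real n)\<^sup>2"
      by (simp add: abs_divide)
    also have "\<dots> \<le> 1 * ((\<sigma>2 + 1) / 2) * (n * sqrt n) / (real n)\<^sup>2"
      using False by (intro divide_right_mono weighted_walk_sum_L1(2)) auto
    also have "\<dots> = (\<sigma>2 + 1) / 2 / sqrt n"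
      using False by (simp add: power2_eq_square field_simps sqrt_mult_sqrt_left)
    finally show ?thesis .
  qed simp
  show "(\<lambda>n. (\<sigma>2 + 1) / 2 / sqrt (real n)) \<longlonglongrightarrow> 0" by real_asymp
qed

lemma conv_prob_T_moment_sum: "conv_prob M (\<lambda>n \<omega>. (\<Sum>i<n. real i * T i \<omega>) / (real n) ^ 3) 0"
proof (rule conv_prob_of_L1_bound)
  fix n :: nat
  show "integrable M (\<lambda>\<omega>. (\<Sum>i<n. real i * T i \<omega>) / (real n) ^ 3)"
    by (intro integrable_divide Bochner_Integration.integrable_sum integrable_mult_right T_integrable)
  show "expectation (\<lambda>\<omega>. \<bar>(\<Sum>i<n. real i * T i \<omega>) / (real n) ^ 3\<bar>) \<le> (\<sigma>2 + 1) / 2 / sqrt n"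
  proof (cases "n = 0")
    case False
    have "expectation (\<lambda>\<omega>. \<bar>(\<Sum>i<n. real i * T i \<omega>) / (real n) ^ 3\<bar>) = expectation (\<lambda>\<omega>. \<bar>\<Sum>i<n. real i * T i \<omega>\<bar>) / (real n) ^ 3"
      by (simp add: abs_divide)
    also have "\<dots> \<le> real n * ((\<sigma>2 + 1) / 2) * (n * sqrt n) / (real n) ^ 3"
      using False by (intro divide_right_mono weighted_walk_sum_L1(2)) auto
    also have "\<dots> = (\<sigma>2 + 1) / 2 / sqrt n"
      using False by (simp add: power3_eq_cube field_simps sqrt_mult_sqrt_left)
    finally show ?thesis .
  qed simp
  show "(\<lambda>n. (\<sigma>2 + 1) / 2 / sqrt (real n)) \<longlonglongrightarrow> 0" by real_asymp
qed

lemma conv_prob_T_sq_sum: "conv_prob M (\<lambda>n \<omega>. (\<Sum>i<n. (T i \<omega>)\<^sup>2) / (real n) ^ 3) 0"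
proof (rule conv_prob_of_L1_bound)
  fix n :: nat
  show "integrable M (\<lambda>\<omega>. (\<Sum>i<n. (T i \<omega>)\<^sup>2) / (real n) ^ 3)"
    by (intro integrable_divide Bochner_Integration.integrable_sum T_second_moment)
  show "expectation (\<lambda>\<omega>. \<bar>(\<Sum>i<n. (T i \<omega>)\<^sup>2) / (real n) ^ 3\<bar>) \<le> \<sigma>2 / n"
  proof (cases "n = 0")
    case False
    have "expectation (\<lambda>\<omega>. \<bar>(\<Sum>i<n. (T i \<omega>)\<^sup>2) / (real n) ^ 3\<bar>) = (\<Sum>i<n. \<sigma>2 * real i) / (real n) ^ 3"
      using T_second_moment by (simp add: abs_divide sum_nonneg)
    also have "\<dots> \<le> (\<Sum>i<n. \<sigma>2 * real n) / (real n) ^ 3"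
      using \<sigma>2_nonneg by (intro divide_right_mono sum_mono mult_left_mono) auto
    also have "\<dots> = \<sigma>2 / n"
      using False by (simp add: power3_eq_cube field_simps)
    finally show ?thesis .
  qed simp
  show "(\<lambda>n. \<sigma>2 / real n) \<longlonglongrightarrow> 0" by real_asymp
qed

lemma bounded_in_prob_T: "bounded_in_prob M (\<lambda>n \<omega>. T n \<omega> / sqrt n)"
  by (rule bounded_in_prob_of_L2[where B=\<sigma>2])
     (use T_second_moment \<sigma>2_nonneg in \<open>auto simp: power_divide\<close>)

lemma conv_prob_T: "conv_prob M (\<lambda>n \<omega>. T n \<omega> / n) 0"
proof -
  have "conv_prob M (\<lambda>n \<omega>. T n \<omega> / sqrt n * (1 / sqrt n)) 0"
    by (intro conv_prob_mult_bounded[OF bounded_in_prob_T] conv_prob_const_seq) real_asymp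
  then show ?thesis by simp
qed

end

context centered_iid
begin

sublocale plain: signed_walk M e \<sigma>2 "\<lambda>_. 1"
  by unfold_locales simp

sublocale alt: signed_walk M e \<sigma>2 "\<lambda>i. (- 1) ^ i"
  by unfold_locales (simp add: power_mult[symmetric] power2_eq_square flip: power_mult_distrib)

lemma conv_prob_mean_square: "conv_prob M (\<lambda>n \<omega>. (\<Sum>i<n. (e i \<omega>)\<^sup>2) / n) \<sigma>2"
proof -
  have int: "integrable M (\<lambda>\<omega>. (\<Sum>i<n. (e i \<omega>)\<^sup>2) / n - \<sigma>2)" for n :: nat
    by (intro Bochner_Integration.integrable_diff integrable_divide Bochner_Integration.integrable_sum int2 integrable_const)
  have id: "distr M borel (\<lambda>\<omega>. (e i \<omega>)\<^sup>2) = distr M borel (\<lambda>\<omega>. (e 0 \<omega>)\<^sup>2)" for i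
  proof -
    have "distr M borel (\<lambda>\<omega>. (e i \<omega>)\<^sup>2) = distr (distr M borel (e i)) borel (\<lambda>x. x\<^sup>2)" for i
      by (subst distr_distr) (auto simp: comp_def)
    then show ?thesis by (metis ident)
  qed
  have "(\<lambda>n. expectation (\<lambda>\<omega>. \<bar>(\<Sum>i<n. (e i \<omega>)\<^sup>2) / n - expectation (\<lambda>\<omega>. (e 0 \<omega>)\<^sup>2)\<bar>)) \<longlonglongrightarrow> 0"
    by (rule weak_law_of_large_numbers[OF indep_vars_compose2[OF indep] id int2]) simp
  then have "conv_prob M (\<lambda>n \<omega>. (\<Sum>i<n. (e i \<omega>)\<^sup>2) / n - \<sigma>2) 0"
    by (intro conv_prob_of_L1[OF int]) (simp only: \<sigma>2[symmetric])
  then show ?thesis by (simp add: LIM_zero_iff)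
qed

end

lemma conv_prob_cong:
  assumes "conv_prob M Y c" "\<And>n \<omega>. Y n \<omega> = Z n \<omega>" "c = c'"
  shows "conv_prob M Z c'"
  using assms by simp

locale inar_regression = centered_iid +
  fixes \<mu> :: real
  assumes \<mu>_pos: "\<mu> > 0"
begin

abbreviation "S \<equiv> plain.T"
abbreviation "A \<equiv> alt.T"

definition v :: "nat \<Rightarrow> 'a \<Rightarrow> real" where
  "v i \<omega> = real i * \<mu> + S i \<omega>"

text \<open>The difference of two successive values of the process satisfies \<open>D (i + 1) = - D i + \<mu> + e i\<close>. Subtracting
  the fixed point \<open>\<mu> / 2\<close> removes the constant from this recursion.\<close>
definition d :: "nat \<Rightarrow> 'a \<Rightarrow> real" where
  "d i \<omega> = (- 1) ^ Suc i * (A i \<omega> + \<mu> / 2)"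

text \<open>Up to null terms, all linear statistics that occur are combinations of \<open>P\<close> and \<open>R3\<close>.\<close>
definition P :: "nat \<Rightarrow> 'a \<Rightarrow> real" where
  "P n \<omega> = (\<Sum>i<n. real i * e i \<omega>) / (n * sqrt n)"

text \<open>The entries of the Gram matrix and of the right-hand side, scaled to order one under the scalings
  \<open>n * sqrt n\<close>, \<open>n\<close> and \<open>sqrt n\<close> of the coefficients of \<open>v\<close>, \<open>d\<close> and \<open>1\<close>.\<close>
definition G11 where "G11 n \<omega> = (\<Sum>i<n. (v i \<omega>)\<^sup>2) / (real n) ^ 3"
definition G12 where "G12 n \<omega> = (\<Sum>i<n. v i \<omega> * d i \<omega>) / ((real n)\<^sup>2 * sqrt n)"
definition G13 where "G13 n \<omega> = (\<Sum>i<n. v i \<omega>) / (real n)\<^sup>2"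
definition G22 where "G22 n \<omega> = (\<Sum>i<n. (d i \<omega>)\<^sup>2) / (real n)\<^sup>2"
definition G23 where "G23 n \<omega> = (\<Sum>i<n. d i \<omega>) / (n * sqrt n)"
definition R1 where "R1 n \<omega> = (\<Sum>i<n. v i \<omega> * e i \<omega>) / (n * sqrt n)"
definition R2 where "R2 n \<omega> = (\<Sum>i<n. d i \<omega> * e i \<omega>) / n"
definition R3 where "R3 n \<omega> = S n \<omega> / sqrt n"

lemma v_measurable[measurable]: "v i \<in> borel_measurable M"
  unfolding v_def[abs_def] by measurable

lemma d_measurable[measurable]: "d i \<in> borel_measurable M"
  unfolding d_def[abs_def] by measurable

lemma v_0: "v 0 \<omega> = 0" by (simp add: v_def plain.T_def)
lemma v_Suc: "v (Suc i) \<omega> = v i \<omega> + \<mu> + e i \<omega>" by (simp add: v_def plain.T_def algebra_simps)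
lemma d_0: "d 0 \<omega> = - \<mu> / 2" by (simp add: d_def alt.T_def)

lemma minus_one_power_sq: "(- 1) ^ i * ((- 1) ^ i * x) = (x :: real)"
  by (simp flip: mult.assoc power_add)

lemma d_Suc: "d (Suc i) \<omega> = - d i \<omega> + e i \<omega>"
  by (simp add: d_def alt.T_def algebra_simps minus_one_power_sq)

lemma d_sq: "(d i \<omega>)\<^sup>2 = (A i \<omega>)\<^sup>2 + \<mu> * A i \<omega> + \<mu>\<^sup>2 / 4"
proof -
  have "(d i \<omega>)\<^sup>2 = (A i \<omega> + \<mu> / 2)\<^sup>2"
    by (simp add: d_def power_mult_distrib flip: power_mult)
  then show ?thesis by (simp add: power2_eq_square algebra_simps)
qed

text \<open>These four closed forms follow by induction from the recursions of \<open>v\<close> and \<open>d\<close>. They are summations by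
  parts: each right-hand side consists of boundary terms and of sums of smaller order or simpler form.\<close>
lemma sum_d: "(\<Sum>i<n. d i \<omega>) = (- \<mu> / 2 - d n \<omega> + S n \<omega>) / 2"
  by (induction n) (auto simp: d_0 d_Suc plain.T_def)

lemma sum_ve: "(\<Sum>i<n. v i \<omega> * e i \<omega>) = \<mu> * (\<Sum>i<n. real i * e i \<omega>) + ((S n \<omega>)\<^sup>2 - (\<Sum>i<n. (e i \<omega>)\<^sup>2)) / 2"
  by (induction n) (auto simp: v_def plain.T_def power2_eq_square field_simps)

lemma sum_de: "(\<Sum>i<n. d i \<omega> * e i \<omega>) = - ((d n \<omega>)\<^sup>2 - \<mu>\<^sup>2 / 4 - (\<Sum>i<n. (e i \<omega>)\<^sup>2)) / 2"
  by (induction n) (auto simp: d_0 d_Suc power2_eq_square algebra_simps)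

lemma sum_vd: "(\<Sum>i<n. v i \<omega> * d i \<omega>)
  = (- v n \<omega> * d n \<omega> - \<mu> * (\<Sum>i<n. d i \<omega>) - (\<Sum>i<n. d i \<omega> * e i \<omega>) + \<mu> * S n \<omega>
     + (\<Sum>i<n. (e i \<omega>)\<^sup>2) + (\<Sum>i<n. v i \<omega> * e i \<omega>)) / 2"
  by (induction n) (auto simp: v_0 v_Suc d_Suc plain.T_def power2_eq_square algebra_simps)

lemma conv_prob_d: "conv_prob M (\<lambda>n \<omega>. d n \<omega> / n) 0"
proof -
  have lim: "conv_prob M (\<lambda>n \<omega>. \<bar>A n \<omega> / n + \<mu> / 2 * (1 / n)\<bar>) \<bar>0 + \<mu> / 2 * 0\<bar>"
    by (intro tendsto_intros alt.conv_prob_T conv_prob_const_seq lim_1_over_n)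
  have eq: "\<bar>A n \<omega> / n + \<mu> / 2 * (1 / n)\<bar> = \<bar>d n \<omega> / n\<bar>" for n \<omega>
  proof -
    have "\<bar>d n \<omega>\<bar> = \<bar>A n \<omega> + \<mu> / 2\<bar>" by (simp add: d_def abs_mult power_abs)
    moreover have "A n \<omega> / n + \<mu> / 2 * (1 / n) = (A n \<omega> + \<mu> / 2) / n" by (simp add: add_divide_distrib)
    ultimately show ?thesis by (simp only: abs_divide)
  qed
  have "conv_prob M (\<lambda>n \<omega>. \<bar>d n \<omega> / n\<bar>) 0"
    by (rule conv_prob_cong[OF lim eq]) simp
  then show ?thesis by (rule tendsto_rabs_zero_cancel)
qed

lemma conv_prob_v: "conv_prob M (\<lambda>n \<omega>. v n \<omega> / n) \<mu>"
proof -
  have "conv_prob M (\<lambda>n \<omega>. (real n / real n) * \<mu> + S n \<omega> / n) (1 * \<mu> + 0)"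
    by (intro tendsto_intros plain.conv_prob_T conv_prob_const_seq) real_asymp
  moreover have "(real n / real n) * \<mu> + S n \<omega> / n = v n \<omega> / n" for n \<omega>
    by (simp add: v_def add_divide_distrib)
  ultimately show ?thesis by (simp only: mult_1 add_0_right)
qed

lemma conv_prob_mean_square_div:
  assumes "f \<longlonglongrightarrow> 0"
  shows "conv_prob M (\<lambda>n \<omega>. (\<Sum>i<n. (e i \<omega>)\<^sup>2) / n * f n) 0"
proof -
  have "conv_prob M (\<lambda>n \<omega>. (\<Sum>i<n. (e i \<omega>)\<^sup>2) / n * f n) (\<sigma>2 * 0)"
    by (intro tendsto_intros conv_prob_mean_square conv_prob_const_seq assms)
  then show ?thesis by simp
qed

lemma P_eq_weighted_sum: "P n \<omega> = (\<Sum>i<n. (real i / (n * sqrt n)) * e i \<omega>)"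
  by (simp add: P_def sum_divide_distrib)

lemma P_measurable[measurable]: "P n \<in> borel_measurable M"
  unfolding P_def[abs_def] by measurable

lemma bounded_in_prob_P: "bounded_in_prob M P"
proof (rule bounded_in_prob_of_L2[where B=\<sigma>2])
  fix n
  show "integrable M (\<lambda>\<omega>. (P n \<omega>)\<^sup>2)"
    unfolding P_eq_weighted_sum by (rule weighted_sum_second_moment) simp
  have "(\<Sum>i<n. (real i / (n * sqrt n))\<^sup>2) \<le> (\<Sum>i<n. 1 / n)"
  proof (rule sum_mono)
    fix i assume i: "i \<in> {..<n}"
    then have "(real i / (n * sqrt n))\<^sup>2 = (real i)\<^sup>2 / (real n)\<^sup>2 * (1 / n)"
      by (simp add: power_divide power_mult_distrib)
    also have "\<dots> \<le> 1 * (1 / n)"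
      using i by (intro mult_right_mono) (auto simp: divide_le_eq_1 power_mono)
    finally show "(real i / (n * sqrt n))\<^sup>2 \<le> 1 / n" by simp
  qed
  also have "\<dots> \<le> 1" by simp
  finally have "\<sigma>2 * (\<Sum>i<n. (real i / (n * sqrt n))\<^sup>2) \<le> \<sigma>2 * 1"
    using \<sigma>2_nonneg by (intro mult_left_mono)
  then show "expectation (\<lambda>\<omega>. (P n \<omega>)\<^sup>2) \<le> \<sigma>2"
    unfolding P_eq_weighted_sum by (subst weighted_sum_second_moment) auto
qed measurable

lemma bounded_in_prob_R3: "bounded_in_prob M R3"
  unfolding R3_def[abs_def] by (rule plain.bounded_in_prob_T)

lemma conv_prob_R1: "conv_prob M (\<lambda>n \<omega>. R1 n \<omega> - \<mu> * P n \<omega>) 0"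
proof -
  have "conv_prob M (\<lambda>n \<omega>. ((R3 n \<omega> * R3 n \<omega>) * (1 / sqrt n) - (\<Sum>i<n. (e i \<omega>)\<^sup>2) / n * (1 / sqrt n)) / 2) ((0 - 0) / 2)"
    by (intro tendsto_intros conv_prob_mult_bounded[OF bounded_in_prob_mult] bounded_in_prob_R3 conv_prob_mean_square_div conv_prob_const_seq) (simp | real_asymp)+
  moreover have "((R3 n \<omega> * R3 n \<omega>) * (1 / sqrt n) - (\<Sum>i<n. (e i \<omega>)\<^sup>2) / n * (1 / sqrt n)) / 2 = R1 n \<omega> - \<mu> * P n \<omega>" for n \<omega>
    unfolding R1_def P_def R3_def sum_ve
    by (simp add: add_divide_distrib diff_divide_distrib power2_eq_square)
  ultimately show ?thesis by (rule conv_prob_cong) simp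
qed

lemma conv_prob_G13: "conv_prob M G13 (\<mu> / 2)"
proof -
  have lim: "(\<lambda>n. (\<Sum>i<n. real i) / (real n)\<^sup>2) \<longlonglongrightarrow> 1 / 2"
  proof -
    have "(\<Sum>i<n. real i) = real n * (real n - 1) / 2" for n
      by (induction n) (auto simp: field_simps)
    then show ?thesis
      by (simp only:) real_asymp
  qed
  have "conv_prob M (\<lambda>n \<omega>. \<mu> * ((\<Sum>i<n. real i) / (real n)\<^sup>2) + (\<Sum>i<n. S i \<omega>) / (real n)\<^sup>2) (\<mu> * (1 / 2) + 0)"
    by (intro tendsto_add tendsto_mult tendsto_const plain.conv_prob_T_sum conv_prob_const_seq[OF lim])
  moreover have "\<mu> * ((\<Sum>i<n. real i) / (real n)\<^sup>2) + (\<Sum>i<n. S i \<omega>) / (real n)\<^sup>2 = G13 n \<omega>" for n \<omega>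
    by (simp add: G13_def v_def sum.distrib add_divide_distrib sum_distrib_left mult.commute)
  ultimately show ?thesis by (rule conv_prob_cong) simp
qed

lemma conv_prob_G11: "conv_prob M G11 (\<mu>\<^sup>2 / 3)"
proof -
  have lim: "(\<lambda>n. (\<Sum>i<n. (real i)\<^sup>2) / (real n) ^ 3) \<longlonglongrightarrow> 1 / 3"
  proof -
    have "(\<Sum>i<n. (real i)\<^sup>2) = real n * (real n - 1) * (2 * real n - 1) / 6" for n
      by (induction n) (auto simp: field_simps power2_eq_square)
    then show ?thesis
      by (simp only:) real_asymp
  qed
  have "conv_prob M (\<lambda>n \<omega>. \<mu>\<^sup>2 * ((\<Sum>i<n. (real i)\<^sup>2) / (real n) ^ 3) + 2 * \<mu> * ((\<Sum>i<n. real i * S i \<omega>) / (real n) ^ 3)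
      + (\<Sum>i<n. (S i \<omega>)\<^sup>2) / (real n) ^ 3) (\<mu>\<^sup>2 * (1 / 3) + 2 * \<mu> * 0 + 0)"
    by (intro tendsto_add tendsto_mult tendsto_const plain.conv_prob_T_moment_sum plain.conv_prob_T_sq_sum conv_prob_const_seq[OF lim])
  moreover have "\<mu>\<^sup>2 * ((\<Sum>i<n. (real i)\<^sup>2) / (real n) ^ 3) + 2 * \<mu> * ((\<Sum>i<n. real i * S i \<omega>) / (real n) ^ 3)
      + (\<Sum>i<n. (S i \<omega>)\<^sup>2) / (real n) ^ 3 = G11 n \<omega>" for n \<omega>
  proof -
    have "(\<Sum>i<n. (v i \<omega>)\<^sup>2) = \<mu>\<^sup>2 * (\<Sum>i<n. (real i)\<^sup>2) + 2 * \<mu> * (\<Sum>i<n. real i * S i \<omega>) + (\<Sum>i<n. (S i \<omega>)\<^sup>2)"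
      unfolding sum_distrib_left sum.distrib[symmetric]
      by (intro sum.cong refl) (simp add: v_def power2_eq_square algebra_simps)
    then show ?thesis by (simp add: G11_def add_divide_distrib)
  qed
  ultimately show ?thesis by (rule conv_prob_cong) simp
qed

lemma conv_prob_G23: "conv_prob M G23 0"
proof -
  have "conv_prob M (\<lambda>n \<omega>. (- \<mu> / 2 * (1 / (n * sqrt n)) - d n \<omega> / n * (1 / sqrt n) + S n \<omega> / n * (1 / sqrt n)) / 2)
      ((- \<mu> / 2 * 0 - 0 * 0 + 0 * 0) / 2)"
    by (intro tendsto_intros conv_prob_d plain.conv_prob_T conv_prob_const_seq) (simp | real_asymp)+
  then show ?thesis
    by (rule conv_prob_cong) (auto simp: G23_def sum_d add_divide_distrib diff_divide_distrib)
qed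

lemma conv_prob_R2: "conv_prob M (\<lambda>n \<omega>. R2 n \<omega> - (alt.quad (- 1 / 2) 0 n \<omega> + \<sigma>2 / 2)) 0"
proof -
  have "conv_prob M (\<lambda>n \<omega>. - \<mu> / 2 * (A n \<omega> / n) + ((\<Sum>i<n. (e i \<omega>)\<^sup>2) / n - \<sigma>2) / 2) (- \<mu> / 2 * 0 + (\<sigma>2 - \<sigma>2) / 2)"
    by (intro tendsto_intros alt.conv_prob_T conv_prob_mean_square) simp
  then show ?thesis
    by (rule conv_prob_cong) (auto simp: R2_def sum_de d_sq alt.quad_def add_divide_distrib diff_divide_distrib)
qed

lemma conv_prob_G22: "conv_prob M (\<lambda>n \<omega>. G22 n \<omega> - alt.quad 0 1 n \<omega>) 0"
proof -
  have "conv_prob M (\<lambda>n \<omega>. \<mu> * ((\<Sum>i<n. A i \<omega>) / (real n)\<^sup>2) + \<mu>\<^sup>2 / 4 * (real n / (real n)\<^sup>2)) (\<mu> * 0 + \<mu>\<^sup>2 / 4 * 0)"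
    by (intro tendsto_intros alt.conv_prob_T_sum conv_prob_const_seq) real_asymp
  moreover have "\<mu> * ((\<Sum>i<n. A i \<omega>) / (real n)\<^sup>2) + \<mu>\<^sup>2 / 4 * (real n / (real n)\<^sup>2) = G22 n \<omega> - alt.quad 0 1 n \<omega>" for n \<omega>
    by (simp add: G22_def d_sq alt.quad_def sum.distrib sum_distrib_left[symmetric] add_divide_distrib)
  ultimately show ?thesis by (rule conv_prob_cong) simp
qed

lemma bounded_in_prob_R2: "bounded_in_prob M R2"
proof -
  have "bounded_in_prob M (\<lambda>n \<omega>. (R2 n \<omega> - (alt.quad (- 1 / 2) 0 n \<omega> + \<sigma>2 / 2)) + ((- 1 / 2) * (A n \<omega> / sqrt n * (A n \<omega> / sqrt n)) + \<sigma>2 / 2))"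
    by (intro bounded_in_prob_add bounded_in_prob_of_conv_prob[OF conv_prob_R2] bounded_in_prob_cmult bounded_in_prob_mult
        alt.bounded_in_prob_T bounded_in_prob_of_conv_prob[of "\<lambda>_ _. \<sigma>2 / 2" "\<sigma>2 / 2"]) simp
  then show ?thesis
    by (simp add: alt.quad_def power2_eq_square)
qed

text \<open>Divide the closed form of \<open>\<Sum>i<n. v i * d i\<close> by \<open>n\<^sup>2 * sqrt n\<close>; each of its terms is of order at most
  \<open>n * sqrt n\<close> in probability.\<close>
lemma conv_prob_G12: "conv_prob M G12 0"
proof -
  let ?Q = "\<lambda>n \<omega>. (\<Sum>i<n. (e i \<omega>)\<^sup>2) / n"
  have R1: "bounded_in_prob M R1"
    using bounded_in_prob_add[OF bounded_in_prob_of_conv_prob[OF conv_prob_R1] bounded_in_prob_cmult[OF bounded_in_prob_P, of \<mu>]] by simp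
  have "conv_prob M (\<lambda>n \<omega>. (- ((v n \<omega> / n) * (d n \<omega> / n) * (1 / sqrt n)) - \<mu> * (G23 n \<omega> * (1 / n)) - R2 n \<omega> * (1 / (n * sqrt n))
     + \<mu> * (R3 n \<omega> * (1 / (real n)\<^sup>2)) + ?Q n \<omega> * (1 / (n * sqrt n)) + R1 n \<omega> * (1 / n)) / 2)
     ((- (\<mu> * 0 * 0) - \<mu> * (0 * 0) - 0 + \<mu> * 0 + 0 + 0) / 2)"
    by (intro tendsto_intros conv_prob_v conv_prob_d conv_prob_G23 conv_prob_mult_bounded[OF bounded_in_prob_R2]
        conv_prob_mult_bounded[OF bounded_in_prob_R3] conv_prob_mult_bounded[OF R1] conv_prob_mean_square_div conv_prob_const_seq lim_1_over_n)
      (simp | real_asymp)+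
  moreover have "(- ((v n \<omega> / n) * (d n \<omega> / n) * (1 / sqrt n)) - \<mu> * (G23 n \<omega> * (1 / n)) - R2 n \<omega> * (1 / (n * sqrt n))
     + \<mu> * (R3 n \<omega> * (1 / (real n)\<^sup>2)) + ?Q n \<omega> * (1 / (n * sqrt n)) + R1 n \<omega> * (1 / n)) / 2 = G12 n \<omega>" for n \<omega>
    unfolding G12_def sum_vd G23_def R1_def R2_def R3_def
    by (simp add: add_divide_distrib diff_divide_distrib power2_eq_square mult_ac)
  ultimately show ?thesis by (rule conv_prob_cong) simp
qed

end

section \<open>Asymptotic solution of the normal equations\<close>

context wiener_process
begin

lemma W_1_nonzero: "AE \<omega> in N. W 1 \<omega> \<noteq> 0"
proof -
  have [measurable]: "W 0 \<in> borel_measurable N" "W 1 \<in> borel_measurable N"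
    by (auto intro: W_measurable)
  have law: "distr N borel (\<lambda>\<omega>. W 1 \<omega> - W 0 \<omega>) = density lborel (\<lambda>x. ennreal (normal_density 0 (sqrt (1 - 0)) x))"
    by (subst W_increments_normal) (auto simp: normal_distribution_def)
  have "AE x in distr N borel (\<lambda>\<omega>. W 1 \<omega> - W 0 \<omega>). x \<noteq> 0"
    unfolding law using AE_lborel_singleton[of "0::real"]
    by (subst AE_density) (auto elim: eventually_mono)
  then have "AE \<omega> in N. W 1 \<omega> - W 0 \<omega> \<noteq> 0"
    by (subst (asm) AE_distr_iff) auto
  with W_zero show ?thesis by eventually_elim simp
qed

lemma sq_int_nonneg: "sq_int \<omega> \<ge> 0"
  unfolding set_lebesgue_integral_def by (rule integral_nonneg_AE) auto

text \<open>A path with vanishing integral of squares would be zero at time one by continuity, but \<open>W 1\<close> has a density.\<close>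
lemma sq_int_pos: "AE \<omega> in N. sq_int \<omega> > 0"
proof -
  have "AE \<omega> in N. \<omega> \<in> space N" by simp
  with W_1_nonzero show ?thesis
  proof eventually_elim
    case (elim \<omega>)
    have cont: "continuous_on {0..1} (\<lambda>t. (W t \<omega>)\<^sup>2)"
      by (intro continuous_intros W_continuous_unit elim)
    have "sq_int \<omega> \<noteq> 0"
    proof
      assume "sq_int \<omega> = 0"
      then have "integral {0..1} (\<lambda>t. (W t \<omega>)\<^sup>2) = 0" by (simp add: sq_int_eq[OF elim(2)])
      then have "((\<lambda>t. (W t \<omega>)\<^sup>2) has_integral 0) (cbox 0 1)"
        using integrable_integral[OF integrable_continuous_real[OF cont]] by simp
      then have "(W 1 \<omega>)\<^sup>2 = 0"
        by (rule has_integral_0_cbox_imp_0[rotated 2]) (use cont in auto)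
      then show False using elim(1) by simp
    qed
    then show ?case using sq_int_nonneg[of \<omega>] by simp
  qed
qed

text \<open>The limit of \<open>n * \<alpha>_hat\<close>.\<close>
definition ratio :: "'b \<Rightarrow> real" where
  "ratio \<omega> = - (((W 1 \<omega>)\<^sup>2 - 1) / 2) / sq_int \<omega>"

lemma ratio_measurable[measurable]: "ratio \<in> borel_measurable N"
  unfolding ratio_def[abs_def] using W_measurable[of 1] by measurable

end

context inar_regression
begin

context
  fixes p q s :: "nat \<Rightarrow> 'a \<Rightarrow> real"
  assumes normal: "\<forall>\<^sub>F n in sequentially. AE \<omega> in M.
      p n \<omega> * (\<Sum>i<n. (v i \<omega>)\<^sup>2) + q n \<omega> * (\<Sum>i<n. v i \<omega> * d i \<omega>) + s n \<omega> * (\<Sum>i<n. v i \<omega>) = (\<Sum>i<n. v i \<omega> * e i \<omega>) \<and>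
      p n \<omega> * (\<Sum>i<n. v i \<omega> * d i \<omega>) + q n \<omega> * (\<Sum>i<n. (d i \<omega>)\<^sup>2) + s n \<omega> * (\<Sum>i<n. d i \<omega>) = (\<Sum>i<n. d i \<omega> * e i \<omega>) \<and>
      p n \<omega> * (\<Sum>i<n. v i \<omega>) + q n \<omega> * (\<Sum>i<n. d i \<omega>) + s n \<omega> * real n = S n \<omega>"
begin

definition "\<theta>1 n \<omega> = real n * sqrt n * p n \<omega>"
definition "\<theta>2 n \<omega> = real n * q n \<omega>"
definition "\<theta>3 n \<omega> = sqrt n * s n \<omega>"

lemma scaled_normal_equations:
  "\<forall>\<^sub>F x in in_prob M.
     G11 (fst x) (snd x) * \<theta>1 (fst x) (snd x) + G12 (fst x) (snd x) * \<theta>2 (fst x) (snd x) + G13 (fst x) (snd x) * \<theta>3 (fst x) (snd x) = R1 (fst x) (snd x) \<and>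
     G12 (fst x) (snd x) * \<theta>1 (fst x) (snd x) + G22 (fst x) (snd x) * \<theta>2 (fst x) (snd x) + G23 (fst x) (snd x) * \<theta>3 (fst x) (snd x) = R2 (fst x) (snd x) \<and>
     G13 (fst x) (snd x) * \<theta>1 (fst x) (snd x) + G23 (fst x) (snd x) * \<theta>2 (fst x) (snd x) + \<theta>3 (fst x) (snd x) = R3 (fst x) (snd x)"
proof (rule eventually_in_prob_AE_seq)
  show "\<forall>\<^sub>F n in sequentially. AE \<omega> in M.
     G11 n \<omega> * \<theta>1 n \<omega> + G12 n \<omega> * \<theta>2 n \<omega> + G13 n \<omega> * \<theta>3 n \<omega> = R1 n \<omega> \<and>
     G12 n \<omega> * \<theta>1 n \<omega> + G22 n \<omega> * \<theta>2 n \<omega> + G23 n \<omega> * \<theta>3 n \<omega> = R2 n \<omega> \<and>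
     G13 n \<omega> * \<theta>1 n \<omega> + G23 n \<omega> * \<theta>2 n \<omega> + \<theta>3 n \<omega> = R3 n \<omega>"
    using normal eventually_gt_at_top[of 0]
  proof eventually_elim
    case (elim n)
    from elim(1) show ?case
    proof eventually_elim
      case (elim \<omega>)
      define r where "r = sqrt n"
      have r: "r > 0" "real n = r * r" using \<open>0 < n\<close> by (simp_all add: r_def)
      show ?case
        unfolding G11_def G12_def G13_def G22_def G23_def R1_def R2_def R3_def \<theta>1_def \<theta>2_def \<theta>3_def
        unfolding elim[THEN conjunct1, symmetric] elim[THEN conjunct2, THEN conjunct1, symmetric] elim[THEN conjunct2, THEN conjunct2, symmetric]
        unfolding r_def[symmetric] r(2) using r(1)
        by (simp add: field_simps power2_eq_square power3_eq_cube)
    qed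
  qed
qed

context
  fixes N :: "'b measure" and W :: "real \<Rightarrow> 'b \<Rightarrow> real"
  assumes W: "wiener_process N W" and \<sigma>2_pos: "\<sigma>2 > 0"
begin

interpretation W: wiener_process N W by (rule W)

lemma G22_measurable[measurable]: "G22 n \<in> borel_measurable M"
  unfolding G22_def[abs_def] by measurable

lemma
  shows bounded_inverse_G22: "bounded_in_prob M (\<lambda>n \<omega>. 1 / G22 n \<omega>)"
    and G22_pos: "\<forall>\<^sub>F x in in_prob M. G22 (fst x) (snd x) > 0"
proof -
  let ?Q = "\<lambda>\<omega>. \<sigma>2 * (0 * (W 1 \<omega>)\<^sup>2 + 1 * W.sq_int \<omega>)"
  have [measurable]: "?Q \<in> borel_measurable N" by measurable
  have law: "real_distribution (distr N borel ?Q)" by simp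
  have conv: "weak_conv_m (\<lambda>n. distr M borel (G22 n)) (distr N borel ?Q)"
    by (rule weak_conv_m_of_conv_prob_diff[OF _ _ law alt.quad_weak_conv[OF W, of 0 1] conv_prob_G22]) auto
  have pos: "AE y in distr N borel ?Q. y > 0"
    using W.sq_int_pos \<sigma>2_pos by (subst AE_distr_iff) auto
  show "bounded_in_prob M (\<lambda>n \<omega>. 1 / G22 n \<omega>)" "\<forall>\<^sub>F x in in_prob M. G22 (fst x) (snd x) > 0"
    using eventually_inverse_bounded[OF G22_measurable law conv pos] by auto
qed

text \<open>The Schur complement \<open>a11, a12, a21, a22\<close> of \<open>G22\<close> in the Gram matrix, its determinant, and the errors
  \<open>\<delta>1\<close>, \<open>\<delta>2\<close> of the right-hand side.\<close>
definition "g n \<omega> = 1 / G22 n \<omega> * G12 n \<omega>"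
definition "g' n \<omega> = 1 / G22 n \<omega> * G23 n \<omega>"
definition "a11 n \<omega> = G11 n \<omega> - g n \<omega> * G12 n \<omega>"
definition "a12 n \<omega> = G13 n \<omega> - g n \<omega> * G23 n \<omega>"
definition "a21 n \<omega> = G13 n \<omega> - g' n \<omega> * G12 n \<omega>"
definition "a22 n \<omega> = 1 - g' n \<omega> * G23 n \<omega>"
definition "D n \<omega> = a11 n \<omega> * a22 n \<omega> - a12 n \<omega> * a21 n \<omega>"
definition "\<delta>1 n \<omega> = (R1 n \<omega> - \<mu> * P n \<omega>) - R2 n \<omega> * g n \<omega>"
definition "\<delta>2 n \<omega> = - (R2 n \<omega> * g' n \<omega>)"

lemma conv_g: "conv_prob M g 0" "conv_prob M g' 0"
  unfolding g_def g'_def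
  by (intro conv_prob_mult_bounded bounded_inverse_G22 conv_prob_G12 conv_prob_G23)+

lemma conv_a: "conv_prob M a11 (\<mu>\<^sup>2 / 3)" "conv_prob M a12 (\<mu> / 2)" "conv_prob M a21 (\<mu> / 2)" "conv_prob M a22 1"
proof -
  have "conv_prob M a11 (\<mu>\<^sup>2 / 3 - 0 * 0)" "conv_prob M a12 (\<mu> / 2 - 0 * 0)" "conv_prob M a21 (\<mu> / 2 - 0 * 0)" "conv_prob M a22 (1 - 0 * 0)"
    unfolding a11_def a12_def a21_def a22_def
    by (intro tendsto_diff tendsto_mult tendsto_const conv_prob_G11 conv_prob_G12 conv_prob_G13 conv_prob_G23 conv_g)+
  then show "conv_prob M a11 (\<mu>\<^sup>2 / 3)" "conv_prob M a12 (\<mu> / 2)" "conv_prob M a21 (\<mu> / 2)" "conv_prob M a22 1"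
    by simp_all
qed

lemma conv_D: "conv_prob M D (\<mu>\<^sup>2 / 12)"
proof -
  have "conv_prob M D (\<mu>\<^sup>2 / 3 * 1 - \<mu> / 2 * (\<mu> / 2))"
    unfolding D_def by (intro tendsto_intros conv_a)
  moreover have "\<mu>\<^sup>2 / 3 * 1 - \<mu> / 2 * (\<mu> / 2) = \<mu>\<^sup>2 / 12" by (simp add: power2_eq_square)
  ultimately show ?thesis by (simp only:)
qed

lemma conv_\<delta>: "conv_prob M \<delta>1 0" "conv_prob M \<delta>2 0"
proof -
  have "conv_prob M \<delta>1 (0 - 0)" "conv_prob M \<delta>2 (- 0)"
    unfolding \<delta>1_def \<delta>2_def
    by (intro tendsto_diff tendsto_minus conv_prob_R1 conv_prob_mult_bounded[OF bounded_in_prob_R2] conv_g)+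
  then show "conv_prob M \<delta>1 0" "conv_prob M \<delta>2 0" by simp_all
qed

text \<open>Eliminating \<open>\<theta>2\<close> from the second equation leaves a system of two equations in \<open>\<theta>1\<close> and \<open>\<theta>3\<close>, solved
  by Cramer's rule.\<close>
lemma eventually_solved:
  "\<forall>\<^sub>F x in in_prob M. case x of (n, \<omega>) \<Rightarrow>
     \<theta>1 n \<omega> = a22 n \<omega> / D n \<omega> * (\<mu> * P n \<omega> + \<delta>1 n \<omega>) - a12 n \<omega> / D n \<omega> * (R3 n \<omega> + \<delta>2 n \<omega>) \<and>
     \<theta>3 n \<omega> = a11 n \<omega> / D n \<omega> * (R3 n \<omega> + \<delta>2 n \<omega>) - a21 n \<omega> / D n \<omega> * (\<mu> * P n \<omega> + \<delta>1 n \<omega>) \<and>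
     G22 n \<omega> * \<theta>2 n \<omega> = R2 n \<omega> - G12 n \<omega> * \<theta>1 n \<omega> - G23 n \<omega> * \<theta>3 n \<omega> \<and> G22 n \<omega> > 0"
proof -
  have "\<mu>\<^sup>2 / 12 > 0" using \<mu>_pos by simp
  from order_tendstoD(1)[OF conv_D this]
  have "\<forall>\<^sub>F x in in_prob M. D (fst x) (snd x) > 0" .
  with scaled_normal_equations G22_pos show ?thesis
  proof eventually_elim
    case (elim x)
    obtain n \<omega> where x: "x = (n, \<omega>)" by (cases x)
    let ?h = "1 / G22 n \<omega>"
    have G: "G22 n \<omega> > 0" and D: "D n \<omega> > 0"
      and E1: "G11 n \<omega> * \<theta>1 n \<omega> + G12 n \<omega> * \<theta>2 n \<omega> + G13 n \<omega> * \<theta>3 n \<omega> = R1 n \<omega>"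
      and E2: "G12 n \<omega> * \<theta>1 n \<omega> + G22 n \<omega> * \<theta>2 n \<omega> + G23 n \<omega> * \<theta>3 n \<omega> = R2 n \<omega>"
      and E3: "G13 n \<omega> * \<theta>1 n \<omega> + G23 n \<omega> * \<theta>2 n \<omega> + \<theta>3 n \<omega> = R3 n \<omega>"
      using elim x by auto
    have \<theta>2: "\<theta>2 n \<omega> = ?h * (R2 n \<omega> - G12 n \<omega> * \<theta>1 n \<omega> - G23 n \<omega> * \<theta>3 n \<omega>)"
      using E2 G by (simp add: field_simps)
    have F1: "a11 n \<omega> * \<theta>1 n \<omega> + a12 n \<omega> * \<theta>3 n \<omega> = \<mu> * P n \<omega> + \<delta>1 n \<omega>"
      using E1 unfolding \<theta>2 a11_def a12_def \<delta>1_def g_def by (simp add: algebra_simps)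
    have F2: "a21 n \<omega> * \<theta>1 n \<omega> + a22 n \<omega> * \<theta>3 n \<omega> = R3 n \<omega> + \<delta>2 n \<omega>"
      using E3 unfolding \<theta>2 a21_def a22_def \<delta>2_def g'_def by (simp add: algebra_simps)
    have "D n \<omega> * \<theta>1 n \<omega> = a22 n \<omega> * (\<mu> * P n \<omega> + \<delta>1 n \<omega>) - a12 n \<omega> * (R3 n \<omega> + \<delta>2 n \<omega>)"
      unfolding F1[symmetric] F2[symmetric] D_def by (simp add: algebra_simps)
    then have "\<theta>1 n \<omega> = (a22 n \<omega> * (\<mu> * P n \<omega> + \<delta>1 n \<omega>) - a12 n \<omega> * (R3 n \<omega> + \<delta>2 n \<omega>)) / D n \<omega>"
      using D by (simp add: eq_divide_eq mult.commute)
    moreover have "D n \<omega> * \<theta>3 n \<omega> = a11 n \<omega> * (R3 n \<omega> + \<delta>2 n \<omega>) - a21 n \<omega> * (\<mu> * P n \<omega> + \<delta>1 n \<omega>)"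
      unfolding F1[symmetric] F2[symmetric] D_def by (simp add: algebra_simps)
    then have "\<theta>3 n \<omega> = (a11 n \<omega> * (R3 n \<omega> + \<delta>2 n \<omega>) - a21 n \<omega> * (\<mu> * P n \<omega> + \<delta>1 n \<omega>)) / D n \<omega>"
      using D by (simp add: eq_divide_eq mult.commute)
    moreover have "G22 n \<omega> * \<theta>2 n \<omega> = R2 n \<omega> - G12 n \<omega> * \<theta>1 n \<omega> - G23 n \<omega> * \<theta>3 n \<omega>"
      using E2 by simp
    ultimately show ?case using G by (simp only: x prod.case diff_divide_distrib times_divide_eq_left simp_thms)
  qed
qed

text \<open>The coefficients come from the inverse of the limit matrix with rows \<open>(\<mu>\<^sup>2 / 3, \<mu> / 2)\<close> and
  \<open>(\<mu> / 2, 1)\<close>, which has determinant \<open>\<mu>\<^sup>2 / 12\<close>. The same holds for \<open>conv_\<theta>3\<close>.\<close>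
lemma conv_\<theta>1: "conv_prob M (\<lambda>n \<omega>. \<theta>1 n \<omega> - (12 / \<mu> * P n \<omega> - 6 / \<mu> * R3 n \<omega>)) 0"
proof -
  have m: "\<mu> \<noteq> 0" "\<mu>\<^sup>2 / 12 \<noteq> 0" using \<mu>_pos by auto
  have k1: "conv_prob M (\<lambda>n \<omega>. (a22 n \<omega> / D n \<omega> - 12 / \<mu>\<^sup>2) * \<mu>) ((1 / (\<mu>\<^sup>2 / 12) - 12 / \<mu>\<^sup>2) * \<mu>)"
    by (intro tendsto_intros conv_a conv_D m)
  have k2: "conv_prob M (\<lambda>n \<omega>. a12 n \<omega> / D n \<omega> - 6 / \<mu>) (\<mu> / 2 / (\<mu>\<^sup>2 / 12) - 6 / \<mu>)"
    by (intro tendsto_intros conv_a conv_D m)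
  have k1': "conv_prob M (\<lambda>n \<omega>. (a22 n \<omega> / D n \<omega> - 12 / \<mu>\<^sup>2) * \<mu>) 0"
    by (rule conv_prob_cong[OF k1]) auto
  have k2': "conv_prob M (\<lambda>n \<omega>. a12 n \<omega> / D n \<omega> - 6 / \<mu>) 0"
    by (rule conv_prob_cong[OF k2]) (use m in \<open>auto simp: power2_eq_square field_simps\<close>)
  have "conv_prob M (\<lambda>n \<omega>. P n \<omega> * ((a22 n \<omega> / D n \<omega> - 12 / \<mu>\<^sup>2) * \<mu>) + a22 n \<omega> / D n \<omega> * \<delta>1 n \<omega>
      - R3 n \<omega> * (a12 n \<omega> / D n \<omega> - 6 / \<mu>) - a12 n \<omega> / D n \<omega> * \<delta>2 n \<omega>)
      (0 + 1 / (\<mu>\<^sup>2 / 12) * 0 - 0 - \<mu> / 2 / (\<mu>\<^sup>2 / 12) * 0)"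
    by (intro tendsto_add tendsto_diff tendsto_mult tendsto_divide conv_prob_mult_bounded[OF bounded_in_prob_P k1']
        conv_prob_mult_bounded[OF bounded_in_prob_R3 k2'] conv_a conv_D conv_\<delta> m)
  then have lim: "conv_prob M (\<lambda>n \<omega>. P n \<omega> * ((a22 n \<omega> / D n \<omega> - 12 / \<mu>\<^sup>2) * \<mu>) + a22 n \<omega> / D n \<omega> * \<delta>1 n \<omega>
      - R3 n \<omega> * (a12 n \<omega> / D n \<omega> - 6 / \<mu>) - a12 n \<omega> / D n \<omega> * \<delta>2 n \<omega>) 0"
    by (rule conv_prob_cong) auto
  show ?thesis
  proof (rule Lim_transform_eventually[OF lim])
    show "\<forall>\<^sub>F x in in_prob M. P (fst x) (snd x) * ((a22 (fst x) (snd x) / D (fst x) (snd x) - 12 / \<mu>\<^sup>2) * \<mu>) + a22 (fst x) (snd x) / D (fst x) (snd x) * \<delta>1 (fst x) (snd x)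
      - R3 (fst x) (snd x) * (a12 (fst x) (snd x) / D (fst x) (snd x) - 6 / \<mu>) - a12 (fst x) (snd x) / D (fst x) (snd x) * \<delta>2 (fst x) (snd x)
      = \<theta>1 (fst x) (snd x) - (12 / \<mu> * P (fst x) (snd x) - 6 / \<mu> * R3 (fst x) (snd x))"
      using eventually_solved
    proof eventually_elim
      case (elim x)
      have "12 / \<mu>\<^sup>2 * \<mu> = 12 / \<mu>" using m by (simp add: power2_eq_square)
      then show ?case using elim by (cases x) (simp add: left_diff_distrib right_diff_distrib distrib_left add_divide_distrib mult_ac)
    qed
  qed
qed

lemma conv_\<theta>3: "conv_prob M (\<lambda>n \<omega>. \<theta>3 n \<omega> - (4 * R3 n \<omega> - 6 * P n \<omega>)) 0"
proof -
  have m: "\<mu> \<noteq> 0" "\<mu>\<^sup>2 / 12 \<noteq> 0" using \<mu>_pos by auto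
  have k1: "conv_prob M (\<lambda>n \<omega>. a11 n \<omega> / D n \<omega> - 4) (\<mu>\<^sup>2 / 3 / (\<mu>\<^sup>2 / 12) - 4)"
    by (intro tendsto_intros conv_a conv_D m)
  have k2: "conv_prob M (\<lambda>n \<omega>. (a21 n \<omega> / D n \<omega> - 6 / \<mu>) * \<mu>) ((\<mu> / 2 / (\<mu>\<^sup>2 / 12) - 6 / \<mu>) * \<mu>)"
    by (intro tendsto_intros conv_a conv_D m)
  have k1': "conv_prob M (\<lambda>n \<omega>. a11 n \<omega> / D n \<omega> - 4) 0"
    by (rule conv_prob_cong[OF k1]) (use m in auto)
  have k2': "conv_prob M (\<lambda>n \<omega>. (a21 n \<omega> / D n \<omega> - 6 / \<mu>) * \<mu>) 0"
    by (rule conv_prob_cong[OF k2]) (use m in \<open>auto simp: power2_eq_square field_simps\<close>)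
  have "conv_prob M (\<lambda>n \<omega>. R3 n \<omega> * (a11 n \<omega> / D n \<omega> - 4) + a11 n \<omega> / D n \<omega> * \<delta>2 n \<omega>
      - P n \<omega> * ((a21 n \<omega> / D n \<omega> - 6 / \<mu>) * \<mu>) - a21 n \<omega> / D n \<omega> * \<delta>1 n \<omega>)
      (0 + \<mu>\<^sup>2 / 3 / (\<mu>\<^sup>2 / 12) * 0 - 0 - \<mu> / 2 / (\<mu>\<^sup>2 / 12) * 0)"
    by (intro tendsto_add tendsto_diff tendsto_mult tendsto_divide conv_prob_mult_bounded[OF bounded_in_prob_P k2']
        conv_prob_mult_bounded[OF bounded_in_prob_R3 k1'] conv_a conv_D conv_\<delta> m)
  then have lim: "conv_prob M (\<lambda>n \<omega>. R3 n \<omega> * (a11 n \<omega> / D n \<omega> - 4) + a11 n \<omega> / D n \<omega> * \<delta>2 n \<omega>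
      - P n \<omega> * ((a21 n \<omega> / D n \<omega> - 6 / \<mu>) * \<mu>) - a21 n \<omega> / D n \<omega> * \<delta>1 n \<omega>) 0"
    by (rule conv_prob_cong) auto
  show ?thesis
  proof (rule Lim_transform_eventually[OF lim])
    show "\<forall>\<^sub>F x in in_prob M. R3 (fst x) (snd x) * (a11 (fst x) (snd x) / D (fst x) (snd x) - 4) + a11 (fst x) (snd x) / D (fst x) (snd x) * \<delta>2 (fst x) (snd x)
      - P (fst x) (snd x) * ((a21 (fst x) (snd x) / D (fst x) (snd x) - 6 / \<mu>) * \<mu>) - a21 (fst x) (snd x) / D (fst x) (snd x) * \<delta>1 (fst x) (snd x)
      = \<theta>3 (fst x) (snd x) - (4 * R3 (fst x) (snd x) - 6 * P (fst x) (snd x))"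
      using eventually_solved
    proof eventually_elim
      case (elim x)
      have "6 / \<mu> * \<mu> = 6" using m by simp
      then show ?case using elim m by (cases x) (simp add: left_diff_distrib right_diff_distrib distrib_left add_divide_distrib mult_ac)
    qed
  qed
qed

lemma bounded_\<theta>1: "bounded_in_prob M \<theta>1"
proof -
  have "bounded_in_prob M (\<lambda>n \<omega>. (\<theta>1 n \<omega> - (12 / \<mu> * P n \<omega> - 6 / \<mu> * R3 n \<omega>)) + (12 / \<mu> * P n \<omega> - 6 / \<mu> * R3 n \<omega>))"
    by (intro bounded_in_prob_add bounded_in_prob_diff bounded_in_prob_cmult bounded_in_prob_P bounded_in_prob_R3
        bounded_in_prob_of_conv_prob[OF conv_\<theta>1])
  then show ?thesis by simp
qed

lemma bounded_\<theta>3: "bounded_in_prob M \<theta>3"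
proof -
  have "bounded_in_prob M (\<lambda>n \<omega>. (\<theta>3 n \<omega> - (4 * R3 n \<omega> - 6 * P n \<omega>)) + (4 * R3 n \<omega> - 6 * P n \<omega>))"
    by (intro bounded_in_prob_add bounded_in_prob_diff bounded_in_prob_cmult bounded_in_prob_P bounded_in_prob_R3
        bounded_in_prob_of_conv_prob[OF conv_\<theta>3])
  then show ?thesis by simp
qed

lemma conv_cross: "conv_prob M (\<lambda>n \<omega>. \<theta>1 n \<omega> * G12 n \<omega> + \<theta>3 n \<omega> * G23 n \<omega>) 0"
  using tendsto_add[OF conv_prob_mult_bounded[OF bounded_\<theta>1 conv_prob_G12] conv_prob_mult_bounded[OF bounded_\<theta>3 conv_prob_G23]]
  by simp

lemma bounded_\<theta>2: "bounded_in_prob M \<theta>2"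
proof (rule bounded_in_prob_cong)
  show "bounded_in_prob M (\<lambda>n \<omega>. 1 / G22 n \<omega> * (R2 n \<omega> - (\<theta>1 n \<omega> * G12 n \<omega> + \<theta>3 n \<omega> * G23 n \<omega>)))"
    by (intro bounded_in_prob_mult bounded_in_prob_diff bounded_inverse_G22 bounded_in_prob_R2 bounded_in_prob_of_conv_prob[OF conv_cross])
  show "\<forall>\<^sub>F x in in_prob M. 1 / G22 (fst x) (snd x) * (R2 (fst x) (snd x) - (\<theta>1 (fst x) (snd x) * G12 (fst x) (snd x) + \<theta>3 (fst x) (snd x) * G23 (fst x) (snd x))) = \<theta>2 (fst x) (snd x)"
    using eventually_solved by eventually_elim (auto simp: divide_eq_eq algebra_simps)
qed

text \<open>As \<open>G22 > 0\<close> with probability tending to one, \<open>\<theta>2 \<le> x\<close> is equivalent to \<open>G22 * (\<theta>2 - x) \<le> 0\<close>. The variable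
  \<open>G22 * (\<theta>2 - x)\<close> is, up to a null term and the constant \<open>\<sigma>2 / 2\<close>, a quadratic functional of the alternating walk.
  The limit law of this functional has no atom at the relevant point precisely because \<open>x\<close> is a continuity
  point of the law of the quotient.\<close>
theorem \<theta>2_weak_conv:
  assumes q_meas[measurable]: "\<And>n. q n \<in> borel_measurable M"
  shows "weak_conv_m (\<lambda>n. distr M borel (\<theta>2 n)) (distr N borel W.ratio)"
  unfolding weak_conv_m_def weak_conv_def
proof (intro allI impI)
  fix x :: real
  assume cont: "isCont (cdf (distr N borel W.ratio)) x"
  have \<theta>2_meas[measurable]: "\<theta>2 n \<in> borel_measurable M" for n
    unfolding \<theta>2_def[abs_def] by measurable
  have [measurable]: "W 1 \<in> borel_measurable N" by (rule W.W_measurable) simp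
  \<comment> \<open>The shift by \<open>\<sigma>2 / 2\<close> turns the limit into a homogeneous quadratic functional of \<open>W\<close>.\<close>
  define C where "C n \<omega> = G22 n \<omega> * (\<theta>2 n \<omega> - x) - \<sigma>2 / 2" for n \<omega>
  have C_meas[measurable]: "C n \<in> borel_measurable M" for n
    unfolding C_def[abs_def] by measurable
  define Q where "Q \<omega> = \<sigma>2 * ((- 1 / 2) * (W 1 \<omega>)\<^sup>2 + (- x) * W.sq_int \<omega>)" for \<omega>
  have Q_meas[measurable]: "Q \<in> borel_measurable N"
    unfolding Q_def[abs_def] by measurable
  have diff: "conv_prob M (\<lambda>n \<omega>. C n \<omega> - alt.quad (- 1 / 2) (- x) n \<omega>) 0"
  proof -
    have "conv_prob M (\<lambda>n \<omega>. (R2 n \<omega> - (alt.quad (- 1 / 2) 0 n \<omega> + \<sigma>2 / 2)) - x * (G22 n \<omega> - alt.quad 0 1 n \<omega>)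
        - (\<theta>1 n \<omega> * G12 n \<omega> + \<theta>3 n \<omega> * G23 n \<omega>)) (0 - x * 0 - 0)"
      by (intro tendsto_diff tendsto_mult tendsto_const conv_prob_R2 conv_prob_G22 conv_cross)
    then have lim: "conv_prob M (\<lambda>n \<omega>. (R2 n \<omega> - (alt.quad (- 1 / 2) 0 n \<omega> + \<sigma>2 / 2)) - x * (G22 n \<omega> - alt.quad 0 1 n \<omega>)
        - (\<theta>1 n \<omega> * G12 n \<omega> + \<theta>3 n \<omega> * G23 n \<omega>)) 0"
      by (rule conv_prob_cong) auto
    have quad: "alt.quad (- 1 / 2) (- x) n \<omega> = alt.quad (- 1 / 2) 0 n \<omega> - x * alt.quad 0 1 n \<omega>" for n \<omega>
      by (simp add: alt.quad_def)
    show ?thesis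
    proof (rule Lim_transform_eventually[OF lim])
      show "\<forall>\<^sub>F y in in_prob M. (R2 (fst y) (snd y) - (alt.quad (- 1 / 2) 0 (fst y) (snd y) + \<sigma>2 / 2)) - x * (G22 (fst y) (snd y) - alt.quad 0 1 (fst y) (snd y))
        - (\<theta>1 (fst y) (snd y) * G12 (fst y) (snd y) + \<theta>3 (fst y) (snd y) * G23 (fst y) (snd y)) = C (fst y) (snd y) - alt.quad (- 1 / 2) (- x) (fst y) (snd y)"
        using eventually_solved
      proof eventually_elim
        case (elim y)
        obtain n \<omega> where y: "y = (n, \<omega>)" by (cases y)
        have "G22 n \<omega> * \<theta>2 n \<omega> = R2 n \<omega> - G12 n \<omega> * \<theta>1 n \<omega> - G23 n \<omega> * \<theta>3 n \<omega>" using elim y by simp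
        then show ?case unfolding y C_def quad by (simp add: algebra_simps)
      qed
    qed
  qed
  have C_conv: "weak_conv_m (\<lambda>n. distr M borel (C n)) (distr N borel Q)"
    unfolding Q_def by (rule weak_conv_m_of_conv_prob_diff[OF alt.quad_meas C_meas _ alt.quad_weak_conv[OF W] diff]) simp
  have iff: "AE \<omega> in N. (Q \<omega> \<le> - \<sigma>2 / 2 \<longleftrightarrow> W.ratio \<omega> \<le> x) \<and> (Q \<omega> = - \<sigma>2 / 2 \<longleftrightarrow> W.ratio \<omega> = x)"
    using W.sq_int_pos
  proof eventually_elim
    case (elim \<omega>)
    let ?B = "W.sq_int \<omega>" and ?J = "((W 1 \<omega>)\<^sup>2 - 1) / 2"
    have "Q \<omega> + \<sigma>2 / 2 = \<sigma>2 * (- ?J - x * ?B)" by (simp add: Q_def field_simps)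
    then have Qs: "Q \<omega> = \<sigma>2 * (- ?J - x * ?B) - \<sigma>2 / 2" by simp
    have "Q \<omega> \<le> - \<sigma>2 / 2 \<longleftrightarrow> - ?J - x * ?B \<le> 0"
      unfolding Qs using \<sigma>2_pos by (simp add: mult_le_0_iff)
    moreover have "W.ratio \<omega> \<le> x \<longleftrightarrow> - ?J - x * ?B \<le> 0"
      by (simp only: W.ratio_def pos_divide_le_eq[OF elim] diff_le_0_iff_le)
    moreover have "Q \<omega> = - \<sigma>2 / 2 \<longleftrightarrow> - ?J - x * ?B = 0"
      unfolding Qs using \<sigma>2_pos by simp
    moreover have "W.ratio \<omega> = x \<longleftrightarrow> - ?J - x * ?B = 0"
      by (simp only: W.ratio_def nonzero_divide_eq_eq[OF less_imp_neq[OF elim, symmetric]] right_minus_eq)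
    ultimately show ?case by blast
  qed
  interpret L: real_distribution "distr N borel W.ratio" by simp
  interpret LQ: real_distribution "distr N borel Q" by simp
  have "measure (distr N borel W.ratio) {x} = 0" using cont L.isCont_cdf by simp
  then have "W.prob {\<omega>\<in>space N. W.ratio \<omega> = x} = 0"
    by (simp add: measure_distr vimage_def Int_def conj_commute)
  moreover have "W.prob {\<omega>\<in>space N. Q \<omega> = - \<sigma>2 / 2} = W.prob {\<omega>\<in>space N. W.ratio \<omega> = x}"
    using iff by (intro W.finite_measure_eq_AE) auto
  ultimately have "measure (distr N borel Q) {- \<sigma>2 / 2} = 0"
    by (simp add: measure_distr vimage_def Int_def conj_commute)
  then have "isCont (cdf (distr N borel Q)) (- \<sigma>2 / 2)" using LQ.isCont_cdf by simp
  then have "(\<lambda>n. cdf (distr M borel (C n)) (- \<sigma>2 / 2)) \<longlonglongrightarrow> cdf (distr N borel Q) (- \<sigma>2 / 2)"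
    using C_conv unfolding weak_conv_m_def weak_conv_def by blast
  moreover have "cdf (distr M borel (C n)) (- \<sigma>2 / 2) = prob {\<omega>\<in>space M. C n \<omega> \<le> - \<sigma>2 / 2}" for n
    by (simp add: cdf_def measure_distr vimage_def Int_def conj_commute)
  moreover have "cdf (distr N borel Q) (- \<sigma>2 / 2) = W.prob {\<omega>\<in>space N. Q \<omega> \<le> - \<sigma>2 / 2}"
    by (simp add: cdf_def measure_distr vimage_def Int_def conj_commute)
  moreover have "W.prob {\<omega>\<in>space N. Q \<omega> \<le> - \<sigma>2 / 2} = W.prob {\<omega>\<in>space N. W.ratio \<omega> \<le> x}"
    using iff by (intro W.finite_measure_eq_AE) auto
  ultimately have C_lim: "(\<lambda>n. prob {\<omega>\<in>space M. C n \<omega> \<le> - \<sigma>2 / 2}) \<longlonglongrightarrow> W.prob {\<omega>\<in>space N. W.ratio \<omega> \<le> x}"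
    by (simp only:)
  have null: "(\<lambda>n. prob {\<omega>\<in>space M. G22 n \<omega> \<le> 0}) \<longlonglongrightarrow> 0"
    by (rule prob_tendsto_0_of_eventually[OF G22_pos]) auto
  have close: "\<bar>prob {\<omega>\<in>space M. \<theta>2 n \<omega> \<le> x} - prob {\<omega>\<in>space M. C n \<omega> \<le> - \<sigma>2 / 2}\<bar> \<le> prob {\<omega>\<in>space M. G22 n \<omega> \<le> 0}" for n
  proof -
    have same: "\<theta>2 n \<omega> \<le> x \<longleftrightarrow> C n \<omega> \<le> - \<sigma>2 / 2" if "G22 n \<omega> > 0" for \<omega>
      using that by (auto simp: C_def mult_le_0_iff)
    have "prob {\<omega>\<in>space M. \<theta>2 n \<omega> \<le> x} \<le> prob ({\<omega>\<in>space M. C n \<omega> \<le> - \<sigma>2 / 2} \<union> {\<omega>\<in>space M. G22 n \<omega> \<le> 0})"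
      using same by (intro finite_measure_mono) (auto simp: not_le[symmetric])
    moreover have "\<dots> \<le> prob {\<omega>\<in>space M. C n \<omega> \<le> - \<sigma>2 / 2} + prob {\<omega>\<in>space M. G22 n \<omega> \<le> 0}"
      by (intro measure_Un_le) auto
    moreover have "prob {\<omega>\<in>space M. C n \<omega> \<le> - \<sigma>2 / 2} \<le> prob ({\<omega>\<in>space M. \<theta>2 n \<omega> \<le> x} \<union> {\<omega>\<in>space M. G22 n \<omega> \<le> 0})"
      using same by (intro finite_measure_mono) (auto simp: not_le[symmetric])
    moreover have "\<dots> \<le> prob {\<omega>\<in>space M. \<theta>2 n \<omega> \<le> x} + prob {\<omega>\<in>space M. G22 n \<omega> \<le> 0}"
      by (intro measure_Un_le) auto
    ultimately show ?thesis by linarith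
  qed
  have "(\<lambda>n. prob {\<omega>\<in>space M. \<theta>2 n \<omega> \<le> x} - prob {\<omega>\<in>space M. C n \<omega> \<le> - \<sigma>2 / 2}) \<longlonglongrightarrow> 0"
    by (rule Lim_null_comparison[OF _ null]) (use close in auto)
  from tendsto_add[OF this C_lim]
  have "(\<lambda>n. prob {\<omega>\<in>space M. \<theta>2 n \<omega> \<le> x}) \<longlonglongrightarrow> W.prob {\<omega>\<in>space N. W.ratio \<omega> \<le> x}" by simp
  then show "(\<lambda>n. cdf (distr M borel (\<theta>2 n)) x) \<longlonglongrightarrow> cdf (distr N borel W.ratio) x"
    by (simp add: cdf_def measure_distr vimage_def Int_def conj_commute)
qed

end

end

end

section \<open>Limit laws of the least squares coefficients\<close>

lemma weak_conv_m_eventually_cong: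
  assumes "weak_conv_m \<nu> L" "\<forall>\<^sub>F n in sequentially. \<nu> n = \<nu>' n"
  shows "weak_conv_m \<nu>' L"
  unfolding weak_conv_m_def weak_conv_def
proof (intro allI impI)
  fix x assume "isCont (cdf L) x"
  then have "(\<lambda>n. cdf (\<nu> n) x) \<longlonglongrightarrow> cdf L x"
    using assms(1) by (simp add: weak_conv_m_def weak_conv_def)
  then show "(\<lambda>n. cdf (\<nu>' n) x) \<longlonglongrightarrow> cdf L x"
    by (rule Lim_transform_eventually) (use assms(2) in \<open>auto elim: eventually_mono\<close>)
qed

lemma least_squares_orthogonality:
  fixes y z :: "'i \<Rightarrow> real"
  assumes min: "\<And>t. (\<Sum>i\<in>I. (y i)\<^sup>2) \<le> (\<Sum>i\<in>I. (y i - t * z i)\<^sup>2)"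
  shows "(\<Sum>i\<in>I. y i * z i) = 0"
proof -
  define C where "C = (\<Sum>i\<in>I. y i * z i)"
  define Z where "Z = (\<Sum>i\<in>I. (z i)\<^sup>2)"
  have Z: "Z \<ge> 0" by (simp add: Z_def sum_nonneg)
  have exp: "(\<Sum>i\<in>I. (y i - t * z i)\<^sup>2) = (\<Sum>i\<in>I. (y i)\<^sup>2) - 2 * t * C + t\<^sup>2 * Z" for t
    unfolding C_def Z_def sum_distrib_left sum_subtractf[symmetric] sum.distrib[symmetric]
    by (intro sum.cong refl) (simp add: power2_eq_square algebra_simps)
  \<comment> \<open>The minimum over \<open>t\<close> is at \<open>C / Z\<close>; adding one to the denominator covers \<open>Z = 0\<close> too.\<close>
  define t where "t = C / (Z + 1)"
  have C: "C = t * (Z + 1)" using Z by (simp add: t_def)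
  have "2 * t * C \<le> t\<^sup>2 * Z" using min[of t] unfolding exp by simp
  then have "t\<^sup>2 * (Z + 2) \<le> 0" unfolding C by (simp add: power2_eq_square algebra_simps)
  then have "t = 0" using Z by (auto simp: mult_le_0_iff)
  then show ?thesis using C by (simp add: C_def)
qed

context inar_regression
begin

definition rss :: "nat \<Rightarrow> 'a \<Rightarrow> real \<Rightarrow> real \<Rightarrow> real \<Rightarrow> real" where
  "rss n \<omega> p q s = (\<Sum>i<n. (e i \<omega> - (p * v i \<omega> + q * d i \<omega> + s))\<^sup>2)"

lemma rss_minimizer_normal_equations:
  assumes min: "\<And>p' q' s'. rss n \<omega> p q s \<le> rss n \<omega> p' q' s'"
  shows "p * (\<Sum>i<n. (v i \<omega>)\<^sup>2) + q * (\<Sum>i<n. v i \<omega> * d i \<omega>) + s * (\<Sum>i<n. v i \<omega>) = (\<Sum>i<n. v i \<omega> * e i \<omega>)"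
    and "p * (\<Sum>i<n. v i \<omega> * d i \<omega>) + q * (\<Sum>i<n. (d i \<omega>)\<^sup>2) + s * (\<Sum>i<n. d i \<omega>) = (\<Sum>i<n. d i \<omega> * e i \<omega>)"
    and "p * (\<Sum>i<n. v i \<omega>) + q * (\<Sum>i<n. d i \<omega>) + s * real n = S n \<omega>"
proof -
  let ?y = "\<lambda>i. e i \<omega> - (p * v i \<omega> + q * d i \<omega> + s)"
  have orth: "(\<Sum>i<n. ?y i * (a * v i \<omega> + b * d i \<omega> + c)) = 0" for a b c
  proof (rule least_squares_orthogonality)
    fix t
    have "(\<Sum>i<n. (?y i - t * (a * v i \<omega> + b * d i \<omega> + c))\<^sup>2) = rss n \<omega> (p + t * a) (q + t * b) (s + t * c)"
      unfolding rss_def by (intro sum.cong refl arg_cong[where f="\<lambda>x. x\<^sup>2"]) (simp add: algebra_simps)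
    then show "(\<Sum>i<n. (?y i)\<^sup>2) \<le> (\<Sum>i<n. (?y i - t * (a * v i \<omega> + b * d i \<omega> + c))\<^sup>2)"
      using min[of "p + t * a" "q + t * b" "s + t * c"] by (simp add: rss_def)
  qed
  show "p * (\<Sum>i<n. (v i \<omega>)\<^sup>2) + q * (\<Sum>i<n. v i \<omega> * d i \<omega>) + s * (\<Sum>i<n. v i \<omega>) = (\<Sum>i<n. v i \<omega> * e i \<omega>)"
    using orth[of 1 0 0] by (simp add: algebra_simps sum.distrib sum_subtractf sum_distrib_left power2_eq_square)
  show "p * (\<Sum>i<n. v i \<omega> * d i \<omega>) + q * (\<Sum>i<n. (d i \<omega>)\<^sup>2) + s * (\<Sum>i<n. d i \<omega>) = (\<Sum>i<n. d i \<omega> * e i \<omega>)"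
    using orth[of 0 1 0] by (simp add: algebra_simps sum.distrib sum_subtractf sum_distrib_left power2_eq_square)
  show "p * (\<Sum>i<n. v i \<omega>) + q * (\<Sum>i<n. d i \<omega>) + s * real n = S n \<omega>"
    using orth[of 0 0 1] by (simp add: algebra_simps sum.distrib sum_subtractf sum_distrib_left plain.T_def)
qed

text \<open>Without noise the minimum is zero, and the first three regressor rows are linearly independent.\<close>
lemma rss_minimizer_noiseless:
  assumes min: "\<And>p' q' s'. rss n \<omega> p q s \<le> rss n \<omega> p' q' s'"
    and e: "\<And>i. e i \<omega> = 0" and n: "n \<ge> 3"
  shows "p = 0 \<and> q = 0 \<and> s = 0"
proof -
  have "rss n \<omega> p q s \<le> 0" using min[of 0 0 0] by (simp add: rss_def e)
  moreover have "rss n \<omega> p q s = (\<Sum>i<n. (p * v i \<omega> + q * d i \<omega> + s)\<^sup>2)"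
    by (simp only: rss_def e diff_0 power2_minus)
  ultimately have "(\<Sum>i<n. (p * v i \<omega> + q * d i \<omega> + s)\<^sup>2) \<le> 0" by simp
  then have "(\<Sum>i<n. (p * v i \<omega> + q * d i \<omega> + s)\<^sup>2) = 0"
    by (intro antisym sum_nonneg) auto
  then have zero: "p * v i \<omega> + q * d i \<omega> + s = 0" if "i < n" for i
    using that by (subst (asm) sum_nonneg_eq_0_iff) auto
  \<comment> \<open>The three rows differ because \<open>v\<close> grows linearly while \<open>d\<close> alternates between \<open>- \<mu> / 2\<close> and \<open>\<mu> / 2\<close>.\<close>
  have vd: "v 0 \<omega> = 0" "v (Suc 0) \<omega> = \<mu>" "v (Suc (Suc 0)) \<omega> = 2 * \<mu>"
      "d 0 \<omega> = - \<mu> / 2" "d (Suc 0) \<omega> = \<mu> / 2" "d (Suc (Suc 0)) \<omega> = - \<mu> / 2"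
    by (simp_all add: v_0 v_Suc d_0 d_Suc e)
  have z: "- (q * \<mu>) / 2 + s = 0" "p * \<mu> + q * \<mu> / 2 + s = 0" "2 * (p * \<mu>) - q * \<mu> / 2 + s = 0"
    using zero[of 0] zero[of "Suc 0"] zero[of "Suc (Suc 0)"] n unfolding vd by (simp_all add: algebra_simps)
  then have "p * \<mu> = 0" "q * \<mu> = 0" by linarith+
  then show ?thesis using z \<mu>_pos by simp
qed

lemma noiseless:
  assumes "\<sigma>2 = 0"
  shows "AE \<omega> in M. \<forall>i. e i \<omega> = 0"
  unfolding AE_all_countable
proof
  fix i
  have "expectation (\<lambda>\<omega>. (e i \<omega>)\<^sup>2) = 0" using variance_e assms by simp
  then have "AE \<omega> in M. (e i \<omega>)\<^sup>2 = 0"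
    by (subst (asm) integral_nonneg_eq_0_iff_AE[OF int2]) auto
  then show "AE \<omega> in M. e i \<omega> = 0" by simp
qed

text \<open>The variance is \<open>\<sigma>2\<close> times the integral of \<open>(a * x + b)\<^sup>2\<close> over the unit interval.\<close>
lemma linear_statistic_weak_conv:
  "weak_conv_m (\<lambda>n. distr M borel (\<lambda>\<omega>. a * P n \<omega> + b * R3 n \<omega>)) (normal_distribution 0 ((a\<^sup>2 / 3 + a * b + b\<^sup>2) * \<sigma>2))"
proof -
  have eq: "a * P n \<omega> + b * R3 n \<omega> = (\<Sum>i<n. (a * (real i / (n * sqrt n)) + b / sqrt n) * e i \<omega>)" for n \<omega>
    unfolding P_eq_weighted_sum R3_def plain.T_def
    by (simp add: distrib_right sum.distrib sum_distrib_left sum_divide_distrib mult.assoc)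
  show ?thesis unfolding eq
  proof (rule weighted_central_limit_theorem)
    have sums: "(\<Sum>i<n. real i) = real n * (real n - 1) / 2"
      "(\<Sum>i<n. (real i)\<^sup>2) = real n * (real n - 1) * (2 * real n - 1) / 6" for n
      by (induction n) (auto simp: field_simps power2_eq_square)
    have sq: "(\<Sum>i<n. (a * (real i / (n * sqrt n)) + b / sqrt n)\<^sup>2)
       = a\<^sup>2 * ((real n * (real n - 1) * (2 * real n - 1) / 6) / real n ^ 3) + 2 * a * b * ((real n * (real n - 1) / 2) / (real n)\<^sup>2) + b\<^sup>2" if n: "n > 0" for n
    proof -
      define r where "r = sqrt n"
      have r: "r > 0" "real n = r\<^sup>2" using n by (simp_all add: r_def)
      have "(a * (real i / (n * sqrt n)) + b / sqrt n)\<^sup>2 = a\<^sup>2 / real n ^ 3 * (real i)\<^sup>2 + 2 * a * b / (real n)\<^sup>2 * real i + b\<^sup>2 / real n" for i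
        unfolding r_def[symmetric] r(2) using r(1) by (simp add: field_simps power2_eq_square power3_eq_cube)
      then have "(\<Sum>i<n. (a * (real i / (n * sqrt n)) + b / sqrt n)\<^sup>2)
        = a\<^sup>2 / real n ^ 3 * (\<Sum>i<n. (real i)\<^sup>2) + 2 * a * b / (real n)\<^sup>2 * (\<Sum>i<n. real i) + (\<Sum>i<n. b\<^sup>2 / real n)"
        by (simp add: sum.distrib sum_distrib_left)
      also have "(\<Sum>i<n. b\<^sup>2 / real n) = b\<^sup>2" using n by simp
      finally show ?thesis unfolding sums by simp
    qed
    have "(\<lambda>n. a\<^sup>2 * ((real n * (real n - 1) * (2 * real n - 1) / 6) / real n ^ 3) + 2 * a * b * ((real n * (real n - 1) / 2) / (real n)\<^sup>2) + b\<^sup>2)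
      \<longlonglongrightarrow> a\<^sup>2 * (1 / 3) + 2 * a * b * (1 / 2) + b\<^sup>2"
      by (intro tendsto_add tendsto_mult tendsto_const) real_asymp+
    then have "(\<lambda>n. \<Sum>i<n. (a * (real i / (n * sqrt n)) + b / sqrt n)\<^sup>2) \<longlonglongrightarrow> a\<^sup>2 * (1 / 3) + 2 * a * b * (1 / 2) + b\<^sup>2"
      by (rule Lim_transform_eventually) (use sq in \<open>auto intro!: eventually_sequentiallyI[of 1]\<close>)
    then show "(\<lambda>n. \<Sum>i<n. (a * (real i / (n * sqrt n)) + b / sqrt n)\<^sup>2) \<longlonglongrightarrow> a\<^sup>2 / 3 + a * b + b\<^sup>2" by simp
    show "\<bar>a * (real i / (n * sqrt n)) + b / sqrt n\<bar> \<le> (\<bar>a\<bar> + \<bar>b\<bar>) / sqrt n" if "i \<in> {..<n}" for n i :: nat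
    proof -
      have "\<bar>a * (real i / (n * sqrt n))\<bar> = \<bar>a\<bar> * (real i / real n) / sqrt n" by (simp add: abs_mult)
      also have "\<dots> \<le> \<bar>a\<bar> * 1 / sqrt n"
        using that by (intro divide_right_mono mult_left_mono) (auto simp: divide_le_eq_1)
      finally have "\<bar>a * (real i / (n * sqrt n))\<bar> \<le> \<bar>a\<bar> / sqrt n" by simp
      moreover have "\<bar>b / sqrt n\<bar> = \<bar>b\<bar> / sqrt n" by simp
      ultimately show ?thesis unfolding add_divide_distrib by linarith
    qed
    show "(\<lambda>n. (\<bar>a\<bar> + \<bar>b\<bar>) / sqrt (real n)) \<longlonglongrightarrow> 0" by real_asymp
  qed simp
qed

context
  fixes p q s :: "nat \<Rightarrow> 'a \<Rightarrow> real"
    and N :: "'b measure" and W :: "real \<Rightarrow> 'b \<Rightarrow> real"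
  assumes min: "\<forall>\<^sub>F n in sequentially. AE \<omega> in M. \<forall>p' q' s'. rss n \<omega> (p n \<omega>) (q n \<omega>) (s n \<omega>) \<le> rss n \<omega> p' q' s'"
    and meas[measurable]: "\<And>n. p n \<in> borel_measurable M" "\<And>n. q n \<in> borel_measurable M" "\<And>n. s n \<in> borel_measurable M"
    and W: "wiener_process N W"
begin

interpretation W: wiener_process N W by (rule W)

lemma normal_equations: "\<forall>\<^sub>F n in sequentially. AE \<omega> in M.
      p n \<omega> * (\<Sum>i<n. (v i \<omega>)\<^sup>2) + q n \<omega> * (\<Sum>i<n. v i \<omega> * d i \<omega>) + s n \<omega> * (\<Sum>i<n. v i \<omega>) = (\<Sum>i<n. v i \<omega> * e i \<omega>) \<and>
      p n \<omega> * (\<Sum>i<n. v i \<omega> * d i \<omega>) + q n \<omega> * (\<Sum>i<n. (d i \<omega>)\<^sup>2) + s n \<omega> * (\<Sum>i<n. d i \<omega>) = (\<Sum>i<n. d i \<omega> * e i \<omega>) \<and>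
      p n \<omega> * (\<Sum>i<n. v i \<omega>) + q n \<omega> * (\<Sum>i<n. d i \<omega>) + s n \<omega> * real n = S n \<omega>"
  using min
proof eventually_elim
  case (elim n)
  then show ?case
    by eventually_elim (intro conjI rss_minimizer_normal_equations; blast)
qed

lemma noiseless_estimates:
  assumes "\<sigma>2 = 0"
  shows "\<forall>\<^sub>F x in in_prob M. p (fst x) (snd x) = 0 \<and> q (fst x) (snd x) = 0 \<and> s (fst x) (snd x) = 0 \<and>
    P (fst x) (snd x) = 0 \<and> R3 (fst x) (snd x) = 0"
proof (rule eventually_in_prob_AE_seq)
  show "\<forall>\<^sub>F n in sequentially. AE \<omega> in M. p n \<omega> = 0 \<and> q n \<omega> = 0 \<and> s n \<omega> = 0 \<and> P n \<omega> = 0 \<and> R3 n \<omega> = 0"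
    using min eventually_ge_at_top[of 3]
  proof eventually_elim
    case (elim n)
    from elim(1) noiseless[OF assms] show ?case
    proof eventually_elim
      case (elim \<omega>)
      have "p n \<omega> = 0 \<and> q n \<omega> = 0 \<and> s n \<omega> = 0"
        by (rule rss_minimizer_noiseless[where n=n and \<omega>=\<omega>]) (use elim \<open>3 \<le> n\<close> in auto)
      then show ?case using elim(2) by (simp add: P_def R3_def plain.T_def)
    qed
  qed
qed

lemma stability_linearization: "conv_prob M (\<lambda>n \<omega>. 2 * (real n * sqrt n * p n \<omega>) - (24 / \<mu> * P n \<omega> + (- 12 / \<mu>) * R3 n \<omega>)) 0"
proof (cases "\<sigma>2 = 0")
  case True
  show ?thesis
    by (rule tendsto_eventually) (use noiseless_estimates[OF True] in eventually_elim, simp)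
next
  case False
  then have pos: "\<sigma>2 > 0" using \<sigma>2_nonneg by simp
  have "conv_prob M (\<lambda>n \<omega>. 2 * (\<theta>1 p n \<omega> - (12 / \<mu> * P n \<omega> - 6 / \<mu> * R3 n \<omega>))) (2 * 0)"
    by (intro tendsto_mult tendsto_const conv_\<theta>1[OF normal_equations W pos])
  then show ?thesis
    by (rule conv_prob_cong) (auto simp: \<theta>1_def[OF normal_equations] algebra_simps)
qed

lemma intercept_linearization: "conv_prob M (\<lambda>n \<omega>. sqrt n * (s n \<omega> - q n \<omega> * (\<mu> / 2)) - ((- 6) * P n \<omega> + 4 * R3 n \<omega>)) 0"
proof (cases "\<sigma>2 = 0")
  case True
  show ?thesis
    by (rule tendsto_eventually) (use noiseless_estimates[OF True] in eventually_elim, simp)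
next
  case False
  then have pos: "\<sigma>2 > 0" using \<sigma>2_nonneg by simp
  have "conv_prob M (\<lambda>n \<omega>. (\<theta>3 s n \<omega> - (4 * R3 n \<omega> - 6 * P n \<omega>)) - \<mu> / 2 * (\<theta>2 q n \<omega> * (1 / sqrt n))) (0 - \<mu> / 2 * 0)"
    by (intro tendsto_diff tendsto_mult tendsto_const conv_\<theta>3[OF normal_equations W pos]
        conv_prob_mult_bounded[OF bounded_\<theta>2[OF normal_equations W pos]] conv_prob_const_seq) real_asymp
  moreover have "(\<theta>3 s n \<omega> - (4 * R3 n \<omega> - 6 * P n \<omega>)) - \<mu> / 2 * (\<theta>2 q n \<omega> * (1 / sqrt n))
      = sqrt n * (s n \<omega> - q n \<omega> * (\<mu> / 2)) - ((- 6) * P n \<omega> + 4 * R3 n \<omega>)" for n \<omega>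
  proof -
    have "real n * q n \<omega> * (1 / sqrt n) = sqrt n * q n \<omega>" by (simp add: real_div_sqrt flip: times_divide_eq_left)
    then show ?thesis by (simp add: \<theta>3_def[OF normal_equations] \<theta>2_def[OF normal_equations] algebra_simps)
  qed
  ultimately show ?thesis by (rule conv_prob_cong) simp
qed

lemma stability_weak_conv:
  "weak_conv_m (\<lambda>n. distr M borel (\<lambda>\<omega>. 2 * (real n * sqrt n * p n \<omega>))) (normal_distribution 0 (48 * \<sigma>2 / \<mu>\<^sup>2))"
proof -
  have var: "((24 / \<mu>)\<^sup>2 / 3 + 24 / \<mu> * (- 12 / \<mu>) + (- 12 / \<mu>)\<^sup>2) * \<sigma>2 = 48 * \<sigma>2 / \<mu>\<^sup>2"
    using \<mu>_pos by (simp add: power2_eq_square field_simps)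
  have lin: "weak_conv_m (\<lambda>n. distr M borel (\<lambda>\<omega>. 24 / \<mu> * P n \<omega> + (- 12 / \<mu>) * R3 n \<omega>)) (normal_distribution 0 (48 * \<sigma>2 / \<mu>\<^sup>2))"
    using linear_statistic_weak_conv[of "24 / \<mu>" "- 12 / \<mu>"] unfolding var .
  show ?thesis
    by (rule weak_conv_m_of_conv_prob_diff[OF _ _ _ lin stability_linearization])
       (auto simp: R3_def \<sigma>2_nonneg intro!: real_distribution_normal_distribution)
qed

lemma intercept_weak_conv:
  "weak_conv_m (\<lambda>n. distr M borel (\<lambda>\<omega>. sqrt n * (s n \<omega> - q n \<omega> * (\<mu> / 2)))) (normal_distribution 0 (4 * \<sigma>2))"
proof -
  have lin: "weak_conv_m (\<lambda>n. distr M borel (\<lambda>\<omega>. (- 6) * P n \<omega> + 4 * R3 n \<omega>)) (normal_distribution 0 (4 * \<sigma>2))"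
    using linear_statistic_weak_conv[of "- 6" 4] by simp
  show ?thesis
    by (rule weak_conv_m_of_conv_prob_diff[OF _ _ _ lin intercept_linearization])
       (auto simp: R3_def \<sigma>2_nonneg intro!: real_distribution_normal_distribution)
qed

text \<open>The pair is \<open>(\<theta>2, - \<theta>2)\<close> plus a null multiple of \<open>(1, 1)\<close>. The test function is merely continuous, so
  tightness of \<open>\<theta>2\<close> is used to remove the null term.\<close>
lemma coefficients_weak_conv:
  assumes pos: "\<sigma>2 > 0" and cont: "continuous_on UNIV (f :: real \<times> real \<Rightarrow> real)" and bnd: "\<And>x. norm (f x) \<le> B"
  shows "(\<lambda>n. expectation (\<lambda>\<omega>. f (real n * (p n \<omega> + q n \<omega>), real n * (p n \<omega> - q n \<omega>))))
    \<longlonglongrightarrow> W.expectation (\<lambda>\<omega>. f (W.ratio \<omega>, - W.ratio \<omega>))"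
proof -
  have fm[measurable]: "f \<in> borel_measurable borel"
    by (rule borel_measurable_continuous_onI[OF cont])
  have f_cont: "continuous_on X (\<lambda>x. f (h x))" if "continuous_on X h" for X :: "'z::topological_space set" and h
    by (rule continuous_on_compose2[OF cont that]) auto
  have \<theta>2: "\<theta>2 q n \<omega> = real n * q n \<omega>" for n \<omega> by (simp add: \<theta>2_def[OF normal_equations])
  have [measurable]: "\<theta>2 q n \<in> borel_measurable M" for n
    unfolding \<theta>2[abs_def] by measurable
  define z where "z n \<omega> = real n * p n \<omega>" for n \<omega>
  have [measurable]: "z n \<in> borel_measurable M" for n
    unfolding z_def[abs_def] by measurable
  have z0: "conv_prob M z 0"
  proof -
    have "conv_prob M (\<lambda>n \<omega>. \<theta>1 p n \<omega> * (1 / sqrt n)) 0"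
      by (intro conv_prob_mult_bounded[OF bounded_\<theta>1[OF normal_equations W pos]] conv_prob_const_seq) real_asymp
    moreover have "\<theta>1 p n \<omega> * (1 / sqrt n) = z n \<omega>" for n \<omega>
      by (simp add: \<theta>1_def[OF normal_equations] z_def)
    ultimately show ?thesis by (rule conv_prob_cong) simp
  qed
  define h where "h y = f (y, - y)" for y
  have h_cont: "isCont h y" for y
  proof -
    have "continuous_on UNIV h" unfolding h_def by (intro f_cont continuous_intros)
    then show ?thesis by (simp add: continuous_on_eq_continuous_at)
  qed
  have "(\<lambda>n. integral\<^sup>L (distr M borel (\<theta>2 q n)) h) \<longlonglongrightarrow> integral\<^sup>L (distr N borel W.ratio) h"
    by (rule weak_conv_imp_integral_bdd_continuous_conv[OF _ _ \<theta>2_weak_conv[OF normal_equations W pos meas(2)] h_cont, of B])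
       (use bnd in \<open>auto simp: h_def\<close>)
  moreover have [measurable]: "h \<in> borel_measurable borel"
    by (rule borel_measurable_continuous_onI) (simp add: continuous_on_eq_continuous_at h_cont)
  ultimately have lim: "(\<lambda>n. expectation (\<lambda>\<omega>. h (\<theta>2 q n \<omega>))) \<longlonglongrightarrow> W.expectation (\<lambda>\<omega>. h (W.ratio \<omega>))"
    by (simp add: integral_distr)
  define g where "g x = f (snd x + fst x, snd x - fst x) - f (fst x, - fst x)" for x :: "real \<times> real"
  have g_cont: "continuous_on UNIV g" unfolding g_def by (intro f_cont continuous_intros)
  have "conv_prob M (\<lambda>n \<omega>. g (\<theta>2 q n \<omega>, z n \<omega>)) 0"
    by (rule conv_prob_continuous_null[OF bounded_\<theta>2[OF normal_equations W pos] z0 g_cont]) (simp add: g_def)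
  then have "(\<lambda>n. expectation (\<lambda>\<omega>. g (\<theta>2 q n \<omega>, z n \<omega>))) \<longlonglongrightarrow> 0"
  proof (rule expectation_tendsto_0_of_conv_prob)
    show "(\<lambda>\<omega>. g (\<theta>2 q n \<omega>, z n \<omega>)) \<in> borel_measurable M" for n
      unfolding g_def by measurable
    show "\<bar>g (\<theta>2 q n \<omega>, z n \<omega>)\<bar> \<le> B + B" for n \<omega>
      unfolding g_def using bnd by (intro order_trans[OF abs_triangle_ineq4] add_mono) auto
  qed
  from tendsto_add[OF this lim]
  have "(\<lambda>n. expectation (\<lambda>\<omega>. g (\<theta>2 q n \<omega>, z n \<omega>)) + expectation (\<lambda>\<omega>. h (\<theta>2 q n \<omega>))) \<longlonglongrightarrow> W.expectation (\<lambda>\<omega>. h (W.ratio \<omega>))"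
    by simp
  moreover have "expectation (\<lambda>\<omega>. g (\<theta>2 q n \<omega>, z n \<omega>)) + expectation (\<lambda>\<omega>. h (\<theta>2 q n \<omega>))
      = expectation (\<lambda>\<omega>. f (real n * (p n \<omega> + q n \<omega>), real n * (p n \<omega> - q n \<omega>)))" for n
  proof -
    have i: "integrable M (\<lambda>\<omega>. f (U \<omega>))" if [measurable]: "U \<in> borel_measurable M" for U
      by (rule integrable_const_bound[of _ B]) (use bnd in auto)
    have "expectation (\<lambda>\<omega>. g (\<theta>2 q n \<omega>, z n \<omega>)) + expectation (\<lambda>\<omega>. h (\<theta>2 q n \<omega>)) = expectation (\<lambda>\<omega>. g (\<theta>2 q n \<omega>, z n \<omega>) + h (\<theta>2 q n \<omega>))"
      unfolding g_def h_def by (intro Bochner_Integration.integral_add[symmetric] Bochner_Integration.integrable_diff i) measurable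
    also have "\<dots> = expectation (\<lambda>\<omega>. f (real n * (p n \<omega> + q n \<omega>), real n * (p n \<omega> - q n \<omega>)))"
      by (simp add: g_def h_def \<theta>2 z_def distrib_left right_diff_distrib)
    finally show ?thesis .
  qed
  ultimately show ?thesis by (simp only: h_def)
qed

end

end

context inar2_process
begin

lemma noise_measurable:
  assumes "i \<in> noise_indices"
  shows "inar2_noise \<epsilon> \<xi> \<eta> i \<in> measurable M (count_space UNIV)"
  using noise_indep assms by (auto simp: indep_vars_def2)

lemma degenerate_thinning:
  assumes "\<alpha> = 0" "\<beta> = 1"
  shows "AE \<omega> in M. \<forall>k\<ge>1. \<forall>j\<ge>1. \<xi> k j \<omega> = 0 \<and> \<eta> k j \<omega> = 1"
proof -
  have "AE \<omega> in M. 1 \<le> k \<longrightarrow> 1 \<le> j \<longrightarrow> \<xi> k j \<omega> = 0 \<and> \<eta> k j \<omega> = 1" for k j :: nat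
  proof (cases "1 \<le> k \<and> 1 \<le> j")
    case True
    have [measurable]: "\<xi> k j \<in> measurable M (count_space UNIV)" "\<eta> k j \<in> measurable M (count_space UNIV)"
      using noise_measurable[of "Thin1 k j"] noise_measurable[of "Thin2 k j"] True by (auto simp: noise_indices_def)
    have "False \<in> set_pmf (bernoulli_pmf 1) \<longleftrightarrow> False" "True \<in> set_pmf (bernoulli_pmf 0) \<longleftrightarrow> False"
      by (simp_all add: set_pmf_iff)
    then have b: "b = True" if "b \<in> set_pmf (bernoulli_pmf 1)" for b
      using that by (cases b) auto
    have b': "b = False" if "b \<in> set_pmf (bernoulli_pmf 0)" for b
      using that \<open>True \<in> set_pmf (bernoulli_pmf 0) \<longleftrightarrow> False\<close> by (cases b) auto
    have "AE x in measure_pmf (map_pmf of_bool (bernoulli_pmf \<alpha>)). x = (0 :: nat)"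
      using b' by (auto simp: assms AE_measure_pmf_iff)
    then have "AE x in distr M (count_space UNIV) (\<xi> k j). x = 0"
      using True by (subst \<xi>_bernoulli) auto
    then have "AE \<omega> in M. \<xi> k j \<omega> = 0" by (subst (asm) AE_distr_iff) auto
    moreover have "AE x in measure_pmf (map_pmf of_bool (bernoulli_pmf \<beta>)). x = (1 :: nat)"
      using b by (auto simp: assms AE_measure_pmf_iff)
    then have "AE x in distr M (count_space UNIV) (\<eta> k j). x = 1"
      using True by (subst \<eta>_bernoulli) auto
    then have "AE \<omega> in M. \<eta> k j \<omega> = 1" by (subst (asm) AE_distr_iff) auto
    ultimately show ?thesis by auto
  qed auto
  then have "AE \<omega> in M. \<forall>k j. 1 \<le> k \<longrightarrow> 1 \<le> j \<longrightarrow> \<xi> k j \<omega> = 0 \<and> \<eta> k j \<omega> = 1"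
    unfolding AE_all_countable by blast
  then show ?thesis by eventually_elim blast
qed

lemma two_step_recursion:
  assumes "\<alpha> = 0" "\<beta> = 1"
  shows "AE \<omega> in M. \<forall>k\<ge>1. X (int k) \<omega> = X (int k - 2) \<omega> + \<epsilon> k \<omega>"
proof -
  have "AE \<omega> in M. \<forall>k\<ge>1. X (int k) \<omega> = (\<Sum>j = 1..X (int k - 1) \<omega>. \<xi> k j \<omega>)
                      + (\<Sum>j = 1..X (int k - 2) \<omega>. \<eta> k j \<omega>) + \<epsilon> k \<omega>"
    unfolding AE_all_countable using recursion by auto
  with degenerate_thinning[OF assms] show ?thesis
    by eventually_elim simp
qed

lemma centered_innovations:
  assumes second_moment: "integrable M (\<lambda>\<omega>. (real (\<epsilon> 1 \<omega>))\<^sup>2)"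
    and \<mu>: "\<mu> = expectation (\<lambda>\<omega>. real (\<epsilon> 1 \<omega>))"
    and \<sigma>2: "\<sigma>2 = variance (\<lambda>\<omega>. real (\<epsilon> 1 \<omega>))"
  shows "centered_iid M (\<lambda>i \<omega>. real (\<epsilon> (Suc i) \<omega>) - \<mu>) \<sigma>2"
proof -
  have m[measurable]: "\<epsilon> (Suc i) \<in> measurable M (count_space UNIV)" for i
    using noise_measurable[of "Innov (Suc i)"] by (auto simp: noise_indices_def)
  have [measurable]: "(\<lambda>\<omega>. real (\<epsilon> (Suc i) \<omega>)) \<in> borel_measurable M" for i by measurable
  have sm: "integrable M (\<lambda>\<omega>. (real (\<epsilon> (Suc 0) \<omega>))\<^sup>2)"
    using second_moment by simp
  have int: "integrable M (\<lambda>\<omega>. real (\<epsilon> (Suc 0) \<omega>))"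
    by (rule square_integrable_imp_integrable[OF _ sm]) measurable
  show ?thesis
  proof
    let ?K = "\<lambda>i. {Innov (Suc i)}"
    have "indep_vars (\<lambda>i. PiM (?K i) (\<lambda>_. count_space UNIV)) (\<lambda>i \<omega>. restrict (\<lambda>x. inar2_noise \<epsilon> \<xi> \<eta> x \<omega>) (?K i)) UNIV"
      by (rule indep_vars_restrict[OF noise_indep]) (auto simp: noise_indices_def disjoint_family_on_def)
    then have "indep_vars (\<lambda>_. borel) (\<lambda>i \<omega>. real (restrict (\<lambda>x. inar2_noise \<epsilon> \<xi> \<eta> x \<omega>) (?K i) (Innov (Suc i))) - \<mu>) UNIV"
    proof (rule indep_vars_compose2)
      fix i :: nat
      have "(\<lambda>x. x (Innov (Suc i))) \<in> measurable (PiM (?K i) (\<lambda>_. count_space UNIV)) (count_space (UNIV :: nat set))"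
        by (rule measurable_component_singleton) simp
      then show "(\<lambda>x. real (x (Innov (Suc i))) - \<mu>) \<in> borel_measurable (PiM (?K i) (\<lambda>_. count_space UNIV))"
        by measurable
    qed
    then show "indep_vars (\<lambda>_. borel) (\<lambda>i \<omega>. real (\<epsilon> (Suc i) \<omega>) - \<mu>) UNIV" by simp
    have "distr M borel (\<lambda>\<omega>. real (\<epsilon> (Suc i) \<omega>) - \<mu>) = distr (distr M (count_space UNIV) (\<epsilon> (Suc i))) borel (\<lambda>x. real x - \<mu>)" for i
      by (subst distr_distr) (auto simp: comp_def)
    moreover have "distr M (count_space UNIV) (\<epsilon> (Suc i)) = distr M (count_space UNIV) (\<epsilon> (Suc 0))" for i
      using \<epsilon>_identical[of "Suc i"] by simp
    ultimately show "distr M borel (\<lambda>\<omega>. real (\<epsilon> (Suc i) \<omega>) - \<mu>) = distr M borel (\<lambda>\<omega>. real (\<epsilon> (Suc 0) \<omega>) - \<mu>)" for i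
      by metis
    show "integrable M (\<lambda>\<omega>. (real (\<epsilon> (Suc 0) \<omega>) - \<mu>)\<^sup>2)"
      using sm int by (simp add: power2_diff mult.assoc)
    show "expectation (\<lambda>\<omega>. real (\<epsilon> (Suc 0) \<omega>) - \<mu>) = 0"
      using int by (simp add: \<mu> prob_space)
    show "\<sigma>2 = expectation (\<lambda>\<omega>. (real (\<epsilon> (Suc 0) \<omega>) - \<mu>)\<^sup>2)"
      by (simp add: \<sigma>2 \<mu>)
  qed
qed

end

lemma inar_coordinates:
  fixes X :: "int \<Rightarrow> 'a \<Rightarrow> nat"
  assumes reg: "inar_regression M (\<lambda>i \<omega>. real (\<epsilon> (Suc i) \<omega>) - \<mu>) \<sigma>2 \<mu>"
    and init: "X 0 \<omega> = 0" "X (-1) \<omega> = 0"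
    and rec: "\<forall>k\<ge>1. X (int k) \<omega> = X (int k - 2) \<omega> + \<epsilon> k \<omega>"
  shows "real (X (int i) \<omega>) + real (X (int i - 1) \<omega>) = inar_regression.v (\<lambda>i \<omega>. real (\<epsilon> (Suc i) \<omega>) - \<mu>) \<mu> i \<omega>"
    and "real (X (int i) \<omega>) - real (X (int i - 1) \<omega>) = \<mu> / 2 + inar_regression.d (\<lambda>i \<omega>. real (\<epsilon> (Suc i) \<omega>) - \<mu>) \<mu> i \<omega>"
proof -
  interpret inar_regression M "\<lambda>i \<omega>. real (\<epsilon> (Suc i) \<omega>) - \<mu>" \<sigma>2 \<mu> by (rule reg)
  have "real (X (int i) \<omega>) + real (X (int i - 1) \<omega>) = v i \<omega> \<and> real (X (int i) \<omega>) - real (X (int i - 1) \<omega>) = \<mu> / 2 + d i \<omega>"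
  proof (induction i)
    case 0
    then show ?case using init by (simp add: v_0 d_0)
  next
    case (Suc i)
    have "X (int (Suc i)) \<omega> = X (int (Suc i) - 2) \<omega> + \<epsilon> (Suc i) \<omega>"
      by (rule rec[rule_format]) simp
    moreover have "int (Suc i) - 2 = int i - 1" by simp
    ultimately have "X (int (Suc i)) \<omega> = X (int i - 1) \<omega> + \<epsilon> (Suc i) \<omega>" by (simp only:)
    then have "real (X (int (Suc i)) \<omega>) = real (X (int i - 1) \<omega>) + real (\<epsilon> (Suc i) \<omega>)" by simp
    moreover have "int (Suc i) - 1 = int i" by simp
    ultimately show ?case using Suc.IH by (simp only: v_Suc d_Suc) linarith
  qed
  then show "real (X (int i) \<omega>) + real (X (int i - 1) \<omega>) = v i \<omega>" "real (X (int i) \<omega>) - real (X (int i - 1) \<omega>) = \<mu> / 2 + d i \<omega>"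
    by auto
qed

text \<open>The change of coordinates from the autoregressive parameters to the coefficients of \<open>v\<close>, \<open>d\<close> and \<open>1\<close>.\<close>
lemma cls_objective_eq_rss:
  fixes X :: "int \<Rightarrow> 'a \<Rightarrow> nat"
  assumes reg: "inar_regression M (\<lambda>i \<omega>. real (\<epsilon> (Suc i) \<omega>) - \<mu>) \<sigma>2 \<mu>"
    and init: "X 0 \<omega> = 0" "X (-1) \<omega> = 0"
    and rec: "\<forall>k\<ge>1. X (int k) \<omega> = X (int k - 2) \<omega> + \<epsilon> k \<omega>"
  shows "cls_objective n (sample X n \<omega>) a b m
    = inar_regression.rss (\<lambda>i \<omega>. real (\<epsilon> (Suc i) \<omega>) - \<mu>) \<mu> n \<omega> ((a + b - 1) / 2) ((a - b + 1) / 2) (m - \<mu> + (a - b + 1) / 2 * (\<mu> / 2))"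
proof -
  interpret inar_regression M "\<lambda>i \<omega>. real (\<epsilon> (Suc i) \<omega>) - \<mu>" \<sigma>2 \<mu> by (rule reg)
  note coord = inar_coordinates[where X=X and \<epsilon>=\<epsilon> and \<omega>=\<omega> and \<mu>=\<mu>, OF assms]
  have ext: "zero_extend (sample X n \<omega>) k = real (X k \<omega>)" if k: "-1 \<le> k" "k \<le> int n" for k
  proof (cases "1 \<le> k")
    case True
    then have "nat k \<in> {1..n}" "int (nat k) = k" using k by auto
    then show ?thesis using True by (simp only: zero_extend_def sample_def restrict_apply if_True)
  next
    case False
    then have "k = 0 \<or> k = -1" using k by auto
    then show ?thesis using init by (auto simp: zero_extend_def)
  qed
  have "cls_objective n (sample X n \<omega>) a b m
    = (\<Sum>i<n. (zero_extend (sample X n \<omega>) (int (Suc i)) - a * zero_extend (sample X n \<omega>) (int (Suc i) - 1)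
                    - b * zero_extend (sample X n \<omega>) (int (Suc i) - 2) - m)\<^sup>2)"
  proof -
    have "(\<Sum>k = 1..n. F k) = (\<Sum>i<n. F (Suc i))" for F :: "nat \<Rightarrow> real"
      by (induction n) auto
    then show ?thesis unfolding cls_objective_def .
  qed
  also have "\<dots> = rss n \<omega> ((a + b - 1) / 2) ((a - b + 1) / 2) (m - \<mu> + (a - b + 1) / 2 * (\<mu> / 2))"
    unfolding rss_def
  proof (intro sum.cong refl arg_cong[where f="\<lambda>x. x\<^sup>2"])
    fix i assume "i \<in> {..<n}"
    then have i: "i < n" by simp
    have "X (int (Suc i)) \<omega> = X (int (Suc i) - 2) \<omega> + \<epsilon> (Suc i) \<omega>"
      by (rule rec[rule_format]) simp
    moreover have "int (Suc i) - 2 = int i - 1" by simp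
    ultimately have next_X: "real (X (int (Suc i)) \<omega>) = real (X (int i - 1) \<omega>) + real (\<epsilon> (Suc i) \<omega>)"
      by (simp only: of_nat_add)
    have z: "zero_extend (sample X n \<omega>) (int (Suc i)) = real (X (int (Suc i)) \<omega>)"
      "zero_extend (sample X n \<omega>) (int (Suc i) - 1) = real (X (int i) \<omega>)"
      "zero_extend (sample X n \<omega>) (int (Suc i) - 2) = real (X (int i - 1) \<omega>)"
      using i by (subst ext; simp add: algebra_simps)+
    have x: "real (X (int i) \<omega>) = (v i \<omega> + (\<mu> / 2 + d i \<omega>)) / 2" "real (X (int i - 1) \<omega>) = (v i \<omega> - (\<mu> / 2 + d i \<omega>)) / 2"
    proof -
      have half: "y = (s + t) / 2 \<and> z = (s - t) / 2" if "y + z = s" "y - z = t" for y z s t :: real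
        unfolding that[symmetric] by simp
      show "real (X (int i) \<omega>) = (v i \<omega> + (\<mu> / 2 + d i \<omega>)) / 2" "real (X (int i - 1) \<omega>) = (v i \<omega> - (\<mu> / 2 + d i \<omega>)) / 2"
        using half[OF coord(1)[of i] coord(2)[of i]] by blast+
    qed
    show "zero_extend (sample X n \<omega>) (int (Suc i)) - a * zero_extend (sample X n \<omega>) (int (Suc i) - 1)
                    - b * zero_extend (sample X n \<omega>) (int (Suc i) - 2) - m
      = real (\<epsilon> (Suc i) \<omega>) - \<mu> - ((a + b - 1) / 2 * v i \<omega> + (a - b + 1) / 2 * d i \<omega> + (m - \<mu> + (a - b + 1) / 2 * (\<mu> / 2)))"
      unfolding z next_X x by (simp add: field_simps)
  qed
  finally show ?thesis .
qed

lemma cls_estimator_minimizes: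
  assumes "cls_estimator n a b m" "x \<in> space (PiM {1..n} (\<lambda>_. borel))"
  shows "cls_objective n x (a x) (b x) (m x) \<le> cls_objective n x a' b' m'"
proof -
  have "cls_objective n x (a x) (b x) (m x) = (INF (a', b', m')\<in>UNIV. cls_objective n x a' b' m')"
    using assms by (simp add: cls_estimator_def)
  also have "\<dots> \<le> (case (a', b', m') of (a', b', m') \<Rightarrow> cls_objective n x a' b' m')"
  proof (rule cINF_lower)
    show "bdd_below (range (\<lambda>(a', b', m'). cls_objective n x a' b' m'))"
      by (rule bdd_belowI[of _ 0]) (auto simp: cls_objective_def intro!: sum_nonneg)
  qed simp
  finally show ?thesis by simp
qed

theorem theorem2p3:
  fixes M :: "'a measure" and N :: "'b measure"
    and \<epsilon> :: "nat \<Rightarrow> 'a \<Rightarrow> nat"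
    and \<xi> \<eta> :: "nat \<Rightarrow> nat \<Rightarrow> 'a \<Rightarrow> nat"
    and X :: "int \<Rightarrow> 'a \<Rightarrow> nat"
    and W :: "real \<Rightarrow> 'b \<Rightarrow> real"
    and \<alpha>_hat \<beta>_hat \<mu>_hat :: "nat \<Rightarrow> (nat \<Rightarrow> real) \<Rightarrow> real"
    and \<mu> \<sigma>2 :: real
  assumes inar: "inar2_process M 0 1 \<epsilon> \<xi> \<eta> X"
    and initial: "AE \<omega> in M. X 0 \<omega> = 0" "AE \<omega> in M. X (-1) \<omega> = 0"
    and second_moment: "integrable M (\<lambda>\<omega>. (real (\<epsilon> 1 \<omega>))\<^sup>2)"
    and mean: "\<mu> = prob_space.expectation M (\<lambda>\<omega>. real (\<epsilon> 1 \<omega>))"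
    and variance: "\<sigma>2 = prob_space.variance M (\<lambda>\<omega>. real (\<epsilon> 1 \<omega>))"
    and mean_pos: "\<mu> > 0"
    and cls: "\<And>n. 1 \<le> n \<Longrightarrow> cls_estimator n (\<alpha>_hat n) (\<beta>_hat n) (\<mu>_hat n)"
    and wiener: "wiener_process N W"
  shows
    "weak_conv_m
       (\<lambda>n. distr M borel (\<lambda>\<omega>. real n powr (3/2) *
              (\<alpha>_hat n (sample X n \<omega>) + \<beta>_hat n (sample X n \<omega>) - 1)))
       (normal_distribution 0 (48 * \<sigma>2 / \<mu>\<^sup>2)) \<and>
    (\<sigma>2 > 0 \<longrightarrow> weak_conv_measures
       (\<lambda>n. distr M borel (\<lambda>\<omega>. (real n * \<alpha>_hat n (sample X n \<omega>),
                                 real n * (\<beta>_hat n (sample X n \<omega>) - 1))))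
       (distr N borel (\<lambda>\<omega>. (ito_integral N W 1 W \<omega> / (LINT t:{0..1}|lborel. (W t \<omega>)\<^sup>2))
                              *\<^sub>R (-1, 1)))) \<and>
    weak_conv_m
       (\<lambda>n. distr M borel (\<lambda>\<omega>. real n powr (1/2) * (\<mu>_hat n (sample X n \<omega>) - \<mu>)))
       (normal_distribution 0 (4 * \<sigma>2))"
proof -
  interpret I: inar2_process M 0 1 \<epsilon> \<xi> \<eta> X by (rule inar)
  interpret W: wiener_process N W by (rule wiener)
  let ?e = "\<lambda>i \<omega>. real (\<epsilon> (Suc i) \<omega>) - \<mu>"
  have reg: "inar_regression M ?e \<sigma>2 \<mu>"
    using I.centered_innovations[OF second_moment mean variance] mean_pos
    by (simp add: inar_regression_def inar_regression_axioms_def)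
  interpret R: inar_regression M ?e \<sigma>2 \<mu> by (rule reg)
  \<comment> \<open>For the empty sample the estimators are arbitrary, possibly non-measurable functions; they are replaced by zero there.\<close>
  define a where "a n \<omega> = (if n = 0 then 0 else \<alpha>_hat n (sample X n \<omega>))" for n \<omega>
  define b where "b n \<omega> = (if n = 0 then 0 else \<beta>_hat n (sample X n \<omega>))" for n \<omega>
  define c where "c n \<omega> = (if n = 0 then 0 else \<mu>_hat n (sample X n \<omega>))" for n \<omega>
  have sample_meas: "sample X n \<in> measurable M (PiM {1..n} (\<lambda>_. borel))" for n
    unfolding sample_def[abs_def]
  proof (rule measurable_restrict)
    fix k assume "k \<in> {1..n}"
    then have [measurable]: "X (int k) \<in> measurable M (count_space UNIV)" by (intro I.X_measurable) auto
    show "(\<lambda>\<omega>. real (X (int k) \<omega>)) \<in> borel_measurable M" by measurable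
  qed
  have est_meas: "a n \<in> borel_measurable M \<and> b n \<in> borel_measurable M \<and> c n \<in> borel_measurable M" for n
  proof (cases "n = 0")
    case True
    then show ?thesis by (simp add: a_def[abs_def] b_def[abs_def] c_def[abs_def])
  next
    case False
    then have "(\<lambda>x. (\<alpha>_hat n x, \<beta>_hat n x, \<mu>_hat n x)) \<in> borel_measurable (PiM {1..n} (\<lambda>_. borel))"
      using cls[of n] by (simp add: cls_estimator_def)
    from measurable_compose[OF sample_meas this]
    have trip: "(\<lambda>\<omega>. (a n \<omega>, b n \<omega>, c n \<omega>)) \<in> borel_measurable M"
      using False by (simp add: a_def b_def c_def)
    have proj: "fst \<in> borel_measurable (borel :: (real \<times> real \<times> real) measure)"
      "(\<lambda>x. fst (snd x)) \<in> borel_measurable (borel :: (real \<times> real \<times> real) measure)"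
      "(\<lambda>x. snd (snd x)) \<in> borel_measurable (borel :: (real \<times> real \<times> real) measure)"
      by (intro borel_measurable_continuous_onI continuous_intros)+
    show ?thesis
      using measurable_compose[OF trip proj(1)] measurable_compose[OF trip proj(2)] measurable_compose[OF trip proj(3)] by simp
  qed
  then have [measurable]: "a n \<in> borel_measurable M" "b n \<in> borel_measurable M" "c n \<in> borel_measurable M" for n
    by auto
  define p where "p n \<omega> = (a n \<omega> + b n \<omega> - 1) / 2" for n \<omega>
  define q where "q n \<omega> = (a n \<omega> - b n \<omega> + 1) / 2" for n \<omega>
  define s where "s n \<omega> = c n \<omega> - \<mu> + q n \<omega> * (\<mu> / 2)" for n \<omega>
  have pqs_meas: "p n \<in> borel_measurable M" "q n \<in> borel_measurable M" "s n \<in> borel_measurable M" for n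
    unfolding p_def[abs_def] q_def[abs_def] s_def[abs_def] by measurable
  have good: "AE \<omega> in M. X 0 \<omega> = 0 \<and> X (-1) \<omega> = 0 \<and> (\<forall>k\<ge>1. X (int k) \<omega> = X (int k - 2) \<omega> + \<epsilon> k \<omega>)"
    using initial I.two_step_recursion[OF refl refl] by eventually_elim blast
  have min: "\<forall>\<^sub>F n in sequentially. AE \<omega> in M. \<forall>p' q' s'. R.rss n \<omega> (p n \<omega>) (q n \<omega>) (s n \<omega>) \<le> R.rss n \<omega> p' q' s'"
    using eventually_gt_at_top[of 0]
  proof eventually_elim
    case (elim n)
    have "AE \<omega> in M. \<omega> \<in> space M" by simp
    with good show ?case
    proof eventually_elim
      case (elim \<omega>)
      note obj = cls_objective_eq_rss[where X=X and \<epsilon>=\<epsilon> and \<omega>=\<omega> and \<mu>=\<mu> and n=n, OF reg elim(1)[THEN conjunct1] elim(1)[THEN conjunct2, THEN conjunct1] elim(1)[THEN conjunct2, THEN conjunct2]]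
      have space: "sample X n \<omega> \<in> space (PiM {1..n} (\<lambda>_. borel))"
        using measurable_space[OF sample_meas elim(2)] .
      show ?case
      proof (intro allI)
        fix p' q' s'
        have "cls_objective n (sample X n \<omega>) (a n \<omega>) (b n \<omega>) (c n \<omega>) \<le> cls_objective n (sample X n \<omega>) (p' + q') (p' - q' + 1) (s' - q' * (\<mu> / 2) + \<mu>)"
          using cls_estimator_minimizes[OF cls space] \<open>0 < n\<close> by (simp add: a_def b_def c_def)
        then show "R.rss n \<omega> (p n \<omega>) (q n \<omega>) (s n \<omega>) \<le> R.rss n \<omega> p' q' s'"
          unfolding obj by (simp add: p_def q_def s_def)
      qed
    qed
  qed
  note lim = R.stability_weak_conv[OF min pqs_meas wiener] R.coefficients_weak_conv[OF min pqs_meas wiener] R.intercept_weak_conv[OF min pqs_meas wiener]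
  have "weak_conv_m (\<lambda>n. distr M borel (\<lambda>\<omega>. real n powr (3/2) *
              (\<alpha>_hat n (sample X n \<omega>) + \<beta>_hat n (sample X n \<omega>) - 1))) (normal_distribution 0 (48 * \<sigma>2 / \<mu>\<^sup>2))"
  proof (rule weak_conv_m_eventually_cong[OF lim(1)])
    show "\<forall>\<^sub>F n in sequentially. distr M borel (\<lambda>\<omega>. 2 * (real n * sqrt n * p n \<omega>)) = distr M borel (\<lambda>\<omega>. real n powr (3/2) *
              (\<alpha>_hat n (sample X n \<omega>) + \<beta>_hat n (sample X n \<omega>) - 1))"
      using eventually_gt_at_top[of 0]
    proof eventually_elim
      case (elim n)
      have "real n powr (3/2) = real n powr (1 + 1/2)" by simp
      also have "\<dots> = real n * sqrt n" using elim by (simp only: powr_add) (simp add: powr_half_sqrt)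
      finally show ?case using elim by (simp add: p_def a_def b_def)
    qed
  qed
  moreover have "weak_conv_m (\<lambda>n. distr M borel (\<lambda>\<omega>. real n powr (1/2) * (\<mu>_hat n (sample X n \<omega>) - \<mu>))) (normal_distribution 0 (4 * \<sigma>2))"
  proof (rule weak_conv_m_eventually_cong[OF lim(3)])
    show "\<forall>\<^sub>F n in sequentially. distr M borel (\<lambda>\<omega>. sqrt n * (s n \<omega> - q n \<omega> * (\<mu> / 2))) = distr M borel (\<lambda>\<omega>. real n powr (1/2) * (\<mu>_hat n (sample X n \<omega>) - \<mu>))"
      using eventually_gt_at_top[of 0] by eventually_elim (simp add: s_def c_def powr_half_sqrt)
  qed
  moreover have "weak_conv_measures
       (\<lambda>n. distr M borel (\<lambda>\<omega>. (real n * \<alpha>_hat n (sample X n \<omega>), real n * (\<beta>_hat n (sample X n \<omega>) - 1))))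
       (distr N borel (\<lambda>\<omega>. (ito_integral N W 1 W \<omega> / W.sq_int \<omega>) *\<^sub>R (-1, 1)))"
    if pos: "\<sigma>2 > 0"
    unfolding weak_conv_measures_def
  proof (intro allI impI)
    fix f :: "real \<times> real \<Rightarrow> real"
    assume cont: "continuous_on UNIV f" and "bounded (range f)"
    then obtain B where B: "\<And>x. norm (f x) \<le> B" by (auto simp: bounded_iff)
    have [measurable]: "f \<in> borel_measurable borel" by (rule borel_measurable_continuous_onI[OF cont])
    have [measurable]: "ito_integral N W 1 W \<in> borel_measurable N" by (rule W.ito_integral_W)
    have [measurable]: "(\<lambda>\<omega>. (ito_integral N W 1 W \<omega> / W.sq_int \<omega>) *\<^sub>R (-1, 1) :: real \<times> real) \<in> borel_measurable N"
      by (intro borel_measurable_scaleR borel_measurable_divide W.sq_int_meas borel_measurable_const) measurable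
    have "integral\<^sup>L (distr N borel (\<lambda>\<omega>. (ito_integral N W 1 W \<omega> / W.sq_int \<omega>) *\<^sub>R (-1, 1))) f
      = W.expectation (\<lambda>\<omega>. f ((ito_integral N W 1 W \<omega> / W.sq_int \<omega>) *\<^sub>R (-1, 1)))"
      by (rule integral_distr) measurable
    also have "\<dots> = W.expectation (\<lambda>\<omega>. f (W.ratio \<omega>, - W.ratio \<omega>))"
    proof (rule integral_cong_AE)
      show "AE \<omega> in N. f ((ito_integral N W 1 W \<omega> / W.sq_int \<omega>) *\<^sub>R (-1, 1)) = f (W.ratio \<omega>, - W.ratio \<omega>)"
        using W.ito_integral_W(2)
      proof eventually_elim
        case (elim \<omega>)
        show ?case unfolding elim W.ratio_def by simp
      qed
    qed measurable
    finally have limit: "integral\<^sup>L (distr N borel (\<lambda>\<omega>. (ito_integral N W 1 W \<omega> / W.sq_int \<omega>) *\<^sub>R (-1, 1))) f = W.expectation (\<lambda>\<omega>. f (W.ratio \<omega>, - W.ratio \<omega>))" .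
    have "\<forall>\<^sub>F n in sequentially. I.expectation (\<lambda>\<omega>. f (real n * (p n \<omega> + q n \<omega>), real n * (p n \<omega> - q n \<omega>)))
      = integral\<^sup>L (distr M borel (\<lambda>\<omega>. (real n * \<alpha>_hat n (sample X n \<omega>), real n * (\<beta>_hat n (sample X n \<omega>) - 1)))) f"
      using eventually_gt_at_top[of 0]
    proof eventually_elim
      case (elim n)
      have pair: "(real n * \<alpha>_hat n (sample X n \<omega>), real n * (\<beta>_hat n (sample X n \<omega>) - 1)) = (real n * (p n \<omega> + q n \<omega>), real n * (p n \<omega> - q n \<omega>))" for \<omega>
        using elim by (simp add: p_def q_def a_def b_def field_simps)
      show ?case
        unfolding pair by (rule integral_distr[symmetric]) (use pqs_meas in measurable)
    qed
    with lim(2)[OF pos cont B]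
    show "(\<lambda>n. integral\<^sup>L (distr M borel (\<lambda>\<omega>. (real n * \<alpha>_hat n (sample X n \<omega>), real n * (\<beta>_hat n (sample X n \<omega>) - 1)))) f)
      \<longlonglongrightarrow> integral\<^sup>L (distr N borel (\<lambda>\<omega>. (ito_integral N W 1 W \<omega> / W.sq_int \<omega>) *\<^sub>R (-1, 1))) f"
      unfolding limit by (rule Lim_transform_eventually)
  qed
  ultimately show ?thesis by blast
qed

end
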